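(* Let $M$ be a connected, closed, oriented smooth manifold of dimension $m$, let $g_0$ be a smooth Riemannian metric on $M$, and let $(g_j)_{j\ge1}$ be a sequence of continuous Riemannian metrics on $M$. Suppose that for all $j$, $$g_j(v,v)\ge\left(1-\frac1j\right)g_0(v,v)\qquad\text{for all } x\in M,\ v\in T_xM,$$ and that, for some $p$ with $\frac12\le p\le\frac m2$, $$\|g_j-g_0\|_{L^p_{g_0}(M)}\to0\quad\text{as } j\to\infty.$$ Then there exist a subsequence $(g_k)$ of $(g_j)$ and a measurable set $U\subset M$ with $\operatorname{Vol}_{g_0}(U)=\operatorname{Vol}_{g_0}(M)$ and $\dim_{\mathcal H_{g_0}}(M\setminus U)\le m-2p$ such that $$d_k(x,y)\to d_0(x,y)\qquad\text{for all } x,y\in U.$$ Furthermore, for every $\varepsilon>0$ there is a measurable set $U_\varepsilon\subset M$ with $\operatorname{Vol}_{g_0}(M\setminus U_\varepsilon)<\varepsilon$ such that $d_k(x,y)\to d_0(x,y)$ uniformly for all $x,y\in U_\varepsilon$.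
   Context: $d_k$ and $d_0$ are the distance functions on $M$ of the Riemannian metrics $g_k$ and $g_0$ (infimum of lengths of piecewise $C^1$ curves). For a symmetric 2-tensor $h$, $|h|_{g_0}$ is its pointwise tensor norm with respect to $g_0$ and $\|h\|_{L^p_{g_0}(M)}=\left(\int_M|h|_{g_0}^p\,dV_{g_0}\right)^{1/p}$, where $dV_{g_0}$ is the Riemannian volume measure of $g_0$. $\dim_{\mathcal H_{g_0}}$ is the Hausdorff dimension with respect to the distance $d_0$. *)

theory Defs
  imports "HOL-Analysis.Analysis"
begin

text \<open>
  Iterated directional derivatives are used, so on an open set this is the usual notion of a
  function of class $C^k$.
\<close>

fun Ck_on :: "nat \<Rightarrow> 'a::euclidean_space set \<Rightarrow> ('a \<Rightarrow> 'b::euclidean_space) \<Rightarrow> bool" where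
  "Ck_on 0 S f \<longleftrightarrow> continuous_on S f"
| "Ck_on (Suc k) S f \<longleftrightarrow>
     (\<forall>x\<in>S. f differentiable (at x)) \<and>
     (\<forall>v. Ck_on k S (\<lambda>x. frechet_derivative f (at x) v))"

definition smooth_on :: "'a::euclidean_space set \<Rightarrow> ('a \<Rightarrow> 'b::euclidean_space) \<Rightarrow> bool" where
  "smooth_on S f \<longleftrightarrow> (\<forall>k. Ck_on k S f)"

text \<open>
  A manifold is a subset \<open>M\<close> of a Hausdorff space, with the subspace topology, together with an
  atlas. A chart is a pair of its domain and its coordinate map; the values of the coordinate map
  off the domain carry no meaning. The dimension is \<open>CARD('n)\<close>.
\<close>

type_synonym ('a, 'n) chart = "'a set \<times> ('a \<Rightarrow> real ^ 'n)"

definition chart_inv :: "('a, 'n::finite) chart \<Rightarrow> real ^ 'n \<Rightarrow> 'a" where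
  "chart_inv c = inv_into (fst c) (snd c)"

definition transition ::
  "('a, 'n::finite) chart \<Rightarrow> ('a, 'n) chart \<Rightarrow> real ^ 'n \<Rightarrow> real ^ 'n" where
  "transition c d = snd d \<circ> chart_inv c"

definition transition_deriv ::
  "('a, 'n::finite) chart \<Rightarrow> ('a, 'n) chart \<Rightarrow> 'a \<Rightarrow> real ^ 'n \<Rightarrow> real ^ 'n" where
  "transition_deriv c d x = frechet_derivative (transition c d) (at (snd c x))"

definition smooth_manifold :: "'a::t2_space set \<Rightarrow> ('a, 'n::finite) chart set \<Rightarrow> bool" where
  "smooth_manifold M A \<longleftrightarrow>
     second_countable (top_of_set M) \<and>
     (\<Union>c\<in>A. fst c) = M \<and>
     (\<forall>c\<in>A. openin (top_of_set M) (fst c) \<and> open (snd c ` fst c) \<and>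
        (\<exists>\<psi>. homeomorphism (fst c) (snd c ` fst c) (snd c) \<psi>)) \<and>
     (\<forall>c\<in>A. \<forall>d\<in>A. smooth_on (snd c ` (fst c \<inter> fst d)) (transition c d))"

text \<open>An oriented manifold is presented by an atlas compatible with the orientation.\<close>

definition oriented_smooth_manifold ::
  "'a::t2_space set \<Rightarrow> ('a, 'n::finite) chart set \<Rightarrow> bool" where
  "oriented_smooth_manifold M A \<longleftrightarrow>
     smooth_manifold M A \<and>
     (\<forall>c\<in>A. \<forall>d\<in>A. \<forall>x\<in>fst c \<inter> fst d. det (matrix (transition_deriv c d x)) > 0)"

text \<open>
  A tangent vector at \<open>x\<close> is the family of its component vectors in all the charts around \<open>x\<close>,
  related by the derivatives of the transition maps. The components in the other charts are set
  to 0, so that each tangent vector has one representation; the vector space operations are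
  pointwise.
\<close>

type_synonym ('a, 'n) tvec = "('a, 'n) chart \<Rightarrow> real ^ 'n"

definition tangent_space ::
  "('a, 'n::finite) chart set \<Rightarrow> 'a \<Rightarrow> ('a, 'n) tvec set" where
  "tangent_space A x =
     {v. (\<forall>c. c \<notin> A \<or> x \<notin> fst c \<longrightarrow> v c = 0) \<and>
         (\<forall>c\<in>A. \<forall>d\<in>A. x \<in> fst c \<and> x \<in> fst d \<longrightarrow> v d = transition_deriv c d x (v c))}"

text \<open>The tangent vector at \<open>x\<close> whose component vector in the chart \<open>c\<close> is \<open>u\<close>.\<close>

definition coord_vec ::
  "('a, 'n::finite) chart set \<Rightarrow> ('a, 'n) chart \<Rightarrow> 'a \<Rightarrow> real ^ 'n \<Rightarrow> ('a, 'n) tvec" where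
  "coord_vec A c x u = (\<lambda>d. if d \<in> A \<and> x \<in> fst d then transition_deriv c d x u else 0)"

text \<open>Only the values of a 2-tensor at points of \<open>M\<close> on tangent vectors at that point matter.\<close>

type_synonym ('a, 'n) tensor2 = "'a \<Rightarrow> ('a, 'n) tvec \<Rightarrow> ('a, 'n) tvec \<Rightarrow> real"

definition tensor_matrix ::
  "('a, 'n::finite) chart set \<Rightarrow> ('a, 'n) tensor2 \<Rightarrow> ('a, 'n) chart \<Rightarrow> 'a \<Rightarrow> real ^ 'n ^ 'n" where
  "tensor_matrix A h c x =
     (\<chi> i j. h x (coord_vec A c x (axis i 1)) (coord_vec A c x (axis j 1)))"

definition metric_tensor ::
  "'a set \<Rightarrow> ('a, 'n::finite) chart set \<Rightarrow> ('a, 'n) tensor2 \<Rightarrow> bool" where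
  "metric_tensor M A g \<longleftrightarrow>
     (\<forall>x\<in>M. \<forall>u\<in>tangent_space A x. \<forall>v\<in>tangent_space A x.
        g x u v = g x v u \<and>
        (u \<noteq> (\<lambda>c. 0) \<longrightarrow> g x u u > 0) \<and>
        (\<forall>w\<in>tangent_space A x. \<forall>a b.
           g x (\<lambda>c. a *\<^sub>R u c + b *\<^sub>R v c) w = a * g x u w + b * g x v w))"

definition continuous_metric ::
  "'a::t2_space set \<Rightarrow> ('a, 'n::finite) chart set \<Rightarrow> ('a, 'n) tensor2 \<Rightarrow> bool" where
  "continuous_metric M A g \<longleftrightarrow>
     metric_tensor M A g \<and> (\<forall>c\<in>A. continuous_on (fst c) (tensor_matrix A g c))"

definition smooth_metric ::
  "'a::t2_space set \<Rightarrow> ('a, 'n::finite) chart set \<Rightarrow> ('a, 'n) tensor2 \<Rightarrow> bool" where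
  "smooth_metric M A g \<longleftrightarrow>
     metric_tensor M A g \<and>
     (\<forall>c\<in>A. smooth_on (snd c ` fst c) (\<lambda>y. tensor_matrix A g c (chart_inv c y)))"

text \<open>
  On each piece the curve is $C^1$ up to the endpoints, where the derivative is one-sided. (The
  library's \<open>piecewise_C1_differentiable_on\<close> allows the derivative to be unbounded near a break
  point.)
\<close>

definition C1_curve_on ::
  "('a::t2_space, 'n::finite) chart set \<Rightarrow> real \<Rightarrow> real \<Rightarrow> (real \<Rightarrow> 'a) \<Rightarrow> bool" where
  "C1_curve_on A a b \<gamma> \<longleftrightarrow>
     (\<forall>c\<in>A. \<exists>D. continuous_on {t\<in>{a..b}. \<gamma> t \<in> fst c} D \<and>
        (\<forall>t\<in>{a..b}. \<gamma> t \<in> fst c \<longrightarrow>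
           ((snd c \<circ> \<gamma>) has_vector_derivative D t) (at t within {a..b})))"

definition piecewise_C1_curve ::
  "'a::t2_space set \<Rightarrow> ('a, 'n::finite) chart set \<Rightarrow> (real \<Rightarrow> 'a) \<Rightarrow> bool" where
  "piecewise_C1_curve M A \<gamma> \<longleftrightarrow>
     path \<gamma> \<and> path_image \<gamma> \<subseteq> M \<and>
     (\<exists>N s. s 0 = 0 \<and> s N = 1 \<and> (\<forall>i<N. s i < s (Suc i) \<and> C1_curve_on A (s i) (s (Suc i)) \<gamma>))"

text \<open>At the finitely many break points of a piecewise $C^1$ curve this value carries no meaning.\<close>

definition velocity ::
  "('a, 'n::finite) chart set \<Rightarrow> (real \<Rightarrow> 'a) \<Rightarrow> real \<Rightarrow> ('a, 'n) tvec" where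
  "velocity A \<gamma> t =
     (\<lambda>c. if c \<in> A \<and> \<gamma> t \<in> fst c then vector_derivative (snd c \<circ> \<gamma>) (at t) else 0)"

definition curve_length ::
  "('a, 'n::finite) chart set \<Rightarrow> ('a, 'n) tensor2 \<Rightarrow> (real \<Rightarrow> 'a) \<Rightarrow> real" where
  "curve_length A g \<gamma> =
     integral {0..1} (\<lambda>t. sqrt (g (\<gamma> t) (velocity A \<gamma> t) (velocity A \<gamma> t)))"

definition riemannian_dist ::
  "'a::t2_space set \<Rightarrow> ('a, 'n::finite) chart set \<Rightarrow> ('a, 'n) tensor2 \<Rightarrow> 'a \<Rightarrow> 'a \<Rightarrow> real" where
  "riemannian_dist M A g x y =
     Inf {curve_length A g \<gamma> |\<gamma>.
            piecewise_C1_curve M A \<gamma> \<and> pathstart \<gamma> = x \<and> pathfinish \<gamma> = y}"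

text \<open>
  The unique Borel measure on \<open>M\<close> that in each chart has density
  $\sqrt{\det (g_{ij})}$ with respect to Lebesgue measure in the coordinates.
\<close>

definition riemannian_volume ::
  "'a::t2_space set \<Rightarrow> ('a, 'n::finite) chart set \<Rightarrow> ('a, 'n) tensor2 \<Rightarrow> 'a measure" where
  "riemannian_volume M A g =
     (THE V. sets V = sets (restrict_space borel M) \<and>
        (\<forall>c\<in>A. \<forall>B\<in>sets V. B \<subseteq> fst c \<longrightarrow>
           emeasure V B =
             (\<integral>\<^sup>+y\<in>snd c ` B. ennreal (sqrt (det (tensor_matrix A g c (chart_inv c y)))) \<partial>lborel)))"

text \<open>
  The pointwise norm of a 2-tensor is computed in a \<open>g\<close>-orthonormal basis; it does not depend on
  which one is picked.
\<close>

definition orthonormal_frame ::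
  "('a, 'n::finite) chart set \<Rightarrow> ('a, 'n) tensor2 \<Rightarrow> 'a \<Rightarrow> ('n \<Rightarrow> ('a, 'n) tvec) \<Rightarrow> bool" where
  "orthonormal_frame A g x e \<longleftrightarrow>
     (\<forall>i. e i \<in> tangent_space A x) \<and> (\<forall>i j. g x (e i) (e j) = (if i = j then 1 else 0))"

definition tensor_norm ::
  "('a, 'n::finite) chart set \<Rightarrow> ('a, 'n) tensor2 \<Rightarrow> ('a, 'n) tensor2 \<Rightarrow> 'a \<Rightarrow> real" where
  "tensor_norm A g h x =
     (let e = (SOME e. orthonormal_frame A g x e)
      in sqrt (\<Sum>i\<in>UNIV. \<Sum>j\<in>UNIV. (h x (e i) (e j))\<^sup>2))"

definition Lp_tensor_norm ::
  "'a::t2_space set \<Rightarrow> ('a, 'n::finite) chart set \<Rightarrow> ('a, 'n) tensor2 \<Rightarrow> real \<Rightarrow>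
   ('a, 'n) tensor2 \<Rightarrow> real" where
  "Lp_tensor_norm M A g p h =
     (LINT x|riemannian_volume M A g. tensor_norm A g h x powr p) powr (1 / p)"

text \<open>
  Hausdorff measure and dimension of \<open>E\<close> for a distance function \<open>d\<close> on \<open>M\<close>. The dimension uses
  only exponents \<open>s > 0\<close>, which does not change the infimum and avoids the convention for \<open>0 powr 0\<close>.
  The empty set has dimension 0.
\<close>

definition diam :: "('a \<Rightarrow> 'a \<Rightarrow> real) \<Rightarrow> 'a set \<Rightarrow> real" where
  "diam d S = (if S = {} then 0 else (SUP (x, y)\<in>S \<times> S. d x y))"

definition hausdorff_premeasure ::
  "'a set \<Rightarrow> ('a \<Rightarrow> 'a \<Rightarrow> real) \<Rightarrow> real \<Rightarrow> real \<Rightarrow> 'a set \<Rightarrow> ennreal" where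
  "hausdorff_premeasure M d s \<delta> E =
     Inf {(\<Sum>i. ennreal (diam d (S i) powr s)) |S :: nat \<Rightarrow> 'a set.
            E \<subseteq> (\<Union>i. S i) \<and> (\<forall>i. S i \<subseteq> M \<and> (\<forall>x\<in>S i. \<forall>y\<in>S i. d x y \<le> \<delta>))}"

definition hausdorff_measure ::
  "'a set \<Rightarrow> ('a \<Rightarrow> 'a \<Rightarrow> real) \<Rightarrow> real \<Rightarrow> 'a set \<Rightarrow> ennreal" where
  "hausdorff_measure M d s E = (SUP \<delta>\<in>{0<..}. hausdorff_premeasure M d s \<delta> E)"

definition hausdorff_dim :: "'a set \<Rightarrow> ('a \<Rightarrow> 'a \<Rightarrow> real) \<Rightarrow> 'a set \<Rightarrow> ereal" where
  "hausdorff_dim M d E = (INF s\<in>{s. 0 < s \<and> hausdorff_measure M d s E = 0}. ereal s)"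

end

theory Submission
  imports Defs
begin

text \<open>
  Write \<open>H\<^sub>k\<close> for the square root of the pointwise norm \<open>|g\<^sub>k - g\<^sub>0|\<close>. Since
  \<open>g\<^sub>k(v,v) \<le> (1 + H\<^sub>k\<^sup>2) g\<^sub>0(v,v)\<close>, the \<open>g\<^sub>k\<close>-length of a curve exceeds its \<open>g\<^sub>0\<close>-length at most by
  the integral of \<open>H\<^sub>k\<close> along it, and the hypothesis says that \<open>H\<^sub>k\<close> tends to 0 in \<open>L\<^sup>q\<close> with
  \<open>q = 2p \<ge> 1\<close>. The lower bound on \<open>g\<^sub>k\<close> gives \<open>d\<^sub>k \<ge> (1 - o(1)) d\<^sub>0\<close> everywhere; the content of the
  theorem is the upper bound.

  In dimension at least 2 a single curve is a null set, so \<open>L\<^sup>q\<close> smallness says nothing about the integral of \<open>H\<^sub>k\<close> along it.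
  Instead, two points \<open>x\<close> and \<open>y\<close> of a chart are joined by two segments, from \<open>x\<close> to a point \<open>z\<close> near
  \<open>y\<close> and from \<open>z\<close> to \<open>y\<close>. The mean over all \<open>z\<close> in a small ball of the integrals of \<open>H\<^sub>k\<close> along these
  segments is at most a fixed multiple of the cone averages
  \<open>\<integral>\<^bsub>|u| < R\<^esub> \<integral>\<^bsub>0 < t < 1\<^esub> H\<^sub>k(x + tu) dt du\<close> at \<open>x\<close> and at \<open>y\<close>, so some \<open>z\<close> does as well as the mean
  (\<open>exists_connecting_point\<close>). Hence the upper bound holds locally, up to a factor close to 1, between
  points whose cone averages tend to 0 (\<open>local_estimate\<close>).

  It remains to see that the cone averages tend to 0 outside a set of dimension at most \<open>m - q\<close>, with
  \<open>m\<close> the dimension of the manifold. Fix \<open>s > m - q\<close>. If \<open>\<integral> H\<^sub>k\<^sup>q \<le> \<lambda> r\<^sup>s\<close> on the ball of every radius \<open>r \<le> R\<close>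
  around \<open>x\<close>, then by Hoelder's inequality \<open>H\<^sub>k(x + tu)\<close> has mean at most a constant times
  \<open>\<lambda>\<^bsup>1/q\<^esup> t\<^bsup>(s-m)/q\<^esup>\<close> over \<open>|u| < R\<close>, which is integrable in \<open>t\<close>, so the cone average at \<open>x\<close> is at most a
  constant times \<open>\<lambda>\<^bsup>1/q\<^esup>\<close> (\<open>cone_avg_le_of_power_growth\<close>). The points that violate the growth condition are
  covered, by Vitali's lemma, by balls whose radii satisfy \<open>\<Sum> \<rho>\<^sup>s \<le> 5\<^sup>s \<lambda>\<^bsup>-1\<^esup> \<integral> H\<^sub>k\<^sup>q\<close>
  (\<open>power_growth_covering\<close>). Along a subsequence with \<open>\<integral> H\<^sub>k\<^sup>q \<le> 4\<^bsup>-k\<^esup>\<close>, the choice \<open>\<lambda> = 2\<^bsup>-k\<^esup>\<close> makes these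
  bounds summable, and a Borel--Cantelli argument for Hausdorff content shows that the points lying in
  infinitely many of the bad sets have \<open>s\<close>-dimensional measure 0 (\<open>content_null_cone_avg_large\<close>). With
  \<open>s = m\<close> they form a set of volume 0.

  Call a point tame if its cone averages decay. Tame points are dense, so the local estimates can be
  chained along a nearly \<open>g\<^sub>0\<close>-minimal curve through tame points close to the curve, although the curve
  itself may avoid tame points altogether (\<open>bounded_near_pw_curve\<close>); this proves \<open>dist_tendsto\<close>. On the
  set where the averages are at most \<open>1/(k+1)\<close> for all \<open>k \<ge> K\<close>, the local estimates hold uniformly, and
  finite nets turn pointwise into uniform convergence (\<open>dist_uniform_limit\<close>). These sets increase to a
  set of full volume, which gives the last claim.

  Besides this, the proof needs that the Riemannian volume measure exists, which comes down to the
  change of variables formula for the transition maps (\<open>riemannian_volume\<close>), and that the tensor norm is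
  a continuous function that dominates the difference of the quadratic forms.
\<close>

section \<open>Positive definite matrices and orthonormal frames\<close>

definition pos_def :: "real^'n^'n \<Rightarrow> bool" where
  "pos_def Q \<longleftrightarrow> transpose Q = Q \<and> (\<forall>u. u \<noteq> 0 \<longrightarrow> 0 < u \<bullet> (Q *v u))"

lemma pos_def_sym: "pos_def Q \<Longrightarrow> u \<bullet> (Q *v v) = v \<bullet> (Q *v u)"
  by (metis dot_lmul_matrix inner_commute pos_def_def transpose_matrix_vector)

text \<open>
  Gram--Schmidt for the inner product of \<open>Q\<close>, as an induction over the index set: a vector outside the
  span of the frame built so far is made orthogonal to it and normalized.
\<close>

lemma pos_def_orthonormal_on:
  fixes Q :: "real^'n^'n" and I :: "'n set"
  assumes Q: "pos_def Q" and "finite I"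
  shows "\<exists>e :: 'n \<Rightarrow> real^'n. \<forall>i\<in>I. \<forall>j\<in>I. e i \<bullet> (Q *v e j) = (if i = j then 1 else 0)"
  using \<open>finite I\<close>
proof (induction I rule: finite_induct)
  case empty
  then show ?case by simp
next
  case (insert k I)
  then obtain e where e: "\<And>i j. i \<in> I \<Longrightarrow> j \<in> I \<Longrightarrow> e i \<bullet> (Q *v e j) = (if i = j then 1 else 0)"
    by blast
  have "card I < CARD('n)"
    using insert.hyps by (metis finite_class.finite UNIV_I psubsetI psubset_card_mono subset_UNIV)
  then have "dim (e ` I) < DIM(real^'n)"
    using dim_le_card[of "e ` I" "e ` I"] card_image_le[OF \<open>finite I\<close>, of e]
    by (simp add: span_superset insert.hyps)
  then obtain v where v: "v \<notin> span (e ` I)"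
    by (metis UNIV_I dim_UNIV dim_span less_irrefl subsetI top.extremum_uniqueI)
  define w where "w = v - (\<Sum>i\<in>I. (v \<bullet> (Q *v e i)) *\<^sub>R e i)"
  have "(\<Sum>i\<in>I. (v \<bullet> (Q *v e i)) *\<^sub>R e i) \<in> span (e ` I)"
    by (intro span_sum span_scale span_base imageI)
  then have "w \<noteq> 0" using v by (auto simp: w_def)
  then have pw: "0 < w \<bullet> (Q *v w)" using Q by (simp add: pos_def_def)
  have ort: "w \<bullet> (Q *v e j) = 0" if "j \<in> I" for j
  proof -
    have "(\<Sum>i\<in>I. (v \<bullet> (Q *v e i)) * (e i \<bullet> (Q *v e j))) = (\<Sum>i\<in>I. if i = j then v \<bullet> (Q *v e j) else 0)"
      by (rule sum.cong) (auto simp: e that)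
    then show ?thesis
      using that insert.hyps by (simp add: w_def inner_diff_left inner_sum_left)
  qed
  define w' where "w' = (1 / sqrt (w \<bullet> (Q *v w))) *\<^sub>R w"
  have w'1: "w' \<bullet> (Q *v w') = 1"
    using pw by (simp add: w'_def matrix_vector_mult_scaleR field_simps)
  have w'0: "w' \<bullet> (Q *v e j) = 0" "e j \<bullet> (Q *v w') = 0" if "j \<in> I" for j
    using ort[OF that] pos_def_sym[OF Q, of "e j" w'] by (auto simp: w'_def)
  show ?case
    by (rule exI[of _ "e(k := w')"]) (use e w'1 w'0 insert.hyps in auto)
qed

lemma matrix_congruence_nth:
  fixes E H :: "real^'n^'n"
  shows "(transpose E ** H ** E) $ i $ j = column i E \<bullet> (H *v column j E)"
proof -
  have "(transpose E ** H ** E) $ i $ j = (transpose E ** (H ** E)) $ i $ j"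
    by (simp add: matrix_mul_assoc)
  also have "\<dots> = column i E \<bullet> column j (H ** E)"
    by (simp add: matrix_matrix_mult_def transpose_def inner_vec_def column_def)
  also have "column j (H ** E) = H *v column j E"
    by (simp add: vec_eq_iff matrix_matrix_mult_def matrix_vector_mult_def column_def)
  finally show ?thesis .
qed

lemma pos_def_orthonormal:
  fixes Q :: "real^'n^'n"
  assumes "pos_def Q"
  shows "\<exists>E :: real^'n^'n. transpose E ** Q ** E = mat 1"
proof -
  obtain e :: "'n \<Rightarrow> real^'n" where e: "\<And>i j. e i \<bullet> (Q *v e j) = (if i = j then 1 else 0)"
    using pos_def_orthonormal_on[OF assms, of UNIV] by auto
  define E :: "real^'n^'n" where "E = (\<chi> a i. e i $ a)"
  have "column i E = e i" for i by (simp add: E_def column_def vec_eq_iff)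
  then have "(transpose E ** Q ** E) $ i $ j = mat 1 $ i $ j" for i j
    by (simp add: matrix_congruence_nth e mat_def)
  then have "transpose E ** Q ** E = mat 1"
    by (simp add: vec_eq_iff)
  then show ?thesis by blast
qed

lemma congruence_quadratic_form:
  fixes E B :: "real^'n^'n"
  shows "(E *v a) \<bullet> (B *v (E *v a)) = a \<bullet> ((transpose E ** B ** E) *v a)"
proof -
  have "(E *v a) \<bullet> w = a \<bullet> (transpose E *v w)" for w
    using dot_lmul_matrix[of a "transpose E" w] by simp
  then show ?thesis by (simp only: matrix_vector_mul_assoc matrix_mul_assoc)
qed

lemma matrix_inv_mult:
  fixes B :: "real^'n^'n"
  assumes "invertible B"
  shows "B ** matrix_inv B = mat 1" "matrix_inv B ** B = mat 1"
  using assms someI_ex[of "\<lambda>B'. B ** B' = mat 1 \<and> B' ** B = mat 1"]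
  unfolding invertible_def matrix_inv_def by auto

lemma orthonormal_frame_inverse:
  fixes E Q :: "real^'n^'n"
  assumes "transpose E ** Q ** E = mat 1"
  shows "invertible E" "invertible Q" "E ** transpose E = matrix_inv Q"
proof -
  have 1: "(transpose E ** Q) ** E = mat 1" using assms by simp
  show "invertible E" using 1 by (metis invertible_left_inverse)
  have 2: "E ** (transpose E ** Q) = mat 1"
    using 1 matrix_left_right_inverse by blast
  then have 3: "(E ** transpose E) ** Q = mat 1" by (simp add: matrix_mul_assoc)
  show "invertible Q" using 3 by (metis invertible_left_inverse)
  then show "E ** transpose E = matrix_inv Q"
    by (metis 3 matrix_inv_mult(1) matrix_mul_assoc matrix_mul_lid matrix_mul_rid)
qed

text \<open>
  The inverse of an orthonormal frame turns the norm of \<open>Q\<close> into the Euclidean one, so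
  a constant metric is a Euclidean norm after a linear map.
\<close>

lemma pos_def_norm:
  fixes Q :: "real^'n^'n"
  assumes "pos_def Q"
  shows "\<exists>P :: real^'n^'n. invertible P \<and> (\<forall>u. u \<bullet> (Q *v u) = (norm (P *v u))\<^sup>2)"
proof -
  obtain E :: "real^'n^'n" where E: "transpose E ** Q ** E = mat 1" using pos_def_orthonormal[OF assms] by blast
  define P where "P = matrix_inv E"
  have iE: "invertible E" by (rule orthonormal_frame_inverse(1)[OF E])
  have EP: "E ** P = mat 1" using iE by (simp add: P_def matrix_inv_mult(1))
  have PE: "P ** E = mat 1" using EP matrix_left_right_inverse by blast
  have "u \<bullet> (Q *v u) = (norm (P *v u))\<^sup>2" for u
  proof -
    define w where "w = P *v u"
    have u: "u = E *v w" by (simp add: w_def matrix_vector_mul_assoc EP)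
    have "u \<bullet> (Q *v u) = w \<bullet> w"
      by (subst (1 2) u) (simp only: congruence_quadratic_form E matrix_vector_mul_lid)
    then show ?thesis by (simp add: w_def power2_norm_eq_inner)
  qed
  moreover have "invertible P" using PE by (metis EP invertible_def)
  ultimately show ?thesis by blast
qed

text \<open>
  Cramer's rule exhibits the entries of the inverse as quotients of polynomials in the entries of
  the matrix, which makes them continuous.
\<close>

lemma matrix_inv_nth_cramer:
  fixes A :: "real^'n^'n"
  assumes "invertible A"
  shows "matrix_inv A $ k $ l = det (\<chi> i j. if j = k then axis l 1 $ i else A $ i $ j) / det A"
proof -
  have "A *v column l (matrix_inv A) = axis l 1"
  proof -
    have "column l (matrix_inv A) = matrix_inv A *v axis l 1"
      by (simp add: matrix_vector_mult_basis)
    then show ?thesis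
      using assms by (simp add: matrix_vector_mul_assoc matrix_inv_mult(1))
  qed
  moreover have "det A \<noteq> 0" using assms invertible_det_nz by blast
  ultimately have "column l (matrix_inv A) = (\<chi> k. det (\<chi> i j. if j = k then axis l 1 $ i else A $ i $ j) / det A)"
    using cramer[of A "column l (matrix_inv A)" "axis l 1"] by blast
  then show ?thesis by (simp add: vec_eq_iff column_def)
qed

lemma continuous_on_det_nth:
  fixes B :: "'x::topological_space \<Rightarrow> real^'n^'n"
  assumes "\<And>i j. continuous_on S (\<lambda>x. B x $ i $ j)"
  shows "continuous_on S (\<lambda>x. det (B x))"
  unfolding det_def by (intro continuous_intros assms)

lemma continuous_on_matrix_inv_nth:
  fixes B :: "'x::topological_space \<Rightarrow> real^'n^'n"
  assumes B: "continuous_on S B" and inv: "\<And>x. x \<in> S \<Longrightarrow> invertible (B x)"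
  shows "continuous_on S (\<lambda>x. matrix_inv (B x) $ k $ l)"
proof -
  have c: "continuous_on S (\<lambda>x. B x $ i $ j)" for i j
    by (intro continuous_intros B)
  have "continuous_on S (\<lambda>x. det (\<chi> i j. if j = k then axis l 1 $ i else B x $ i $ j) / det (B x))"
  proof (intro continuous_on_divide continuous_on_det_nth c ballI)
    show "continuous_on S (\<lambda>x. (\<chi> i j. if j = k then axis l 1 $ i else B x $ i $ j) $ i $ j)" for i j
      by (cases "j = k") (auto intro!: c)
    show "det (B x) \<noteq> 0" if "x \<in> S" for x using inv[OF that] invertible_det_nz by blast
  qed
  then show ?thesis
    by (rule continuous_on_eq) (simp add: matrix_inv_nth_cramer inv)
qed

lemma sum_swap4:
  "(\<Sum>j\<in>J. \<Sum>a\<in>A. \<Sum>b\<in>B. \<Sum>c\<in>C. \<Sum>d\<in>D. f j a b c d) =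
   (\<Sum>a\<in>A. \<Sum>b\<in>B. \<Sum>c\<in>C. \<Sum>d\<in>D. \<Sum>j\<in>J. (f j a b c d :: real))"
  apply (subst sum.swap, rule sum.cong[OF refl])
  apply (subst sum.swap, rule sum.cong[OF refl])
  apply (subst sum.swap, rule sum.cong[OF refl])
  apply (subst sum.swap, rule sum.cong[OF refl])
  apply (rule refl)
  done

text \<open>
  Expanding the squares leaves the frame only in the combination \<open>E ** transpose E\<close>, which is the
  inverse Gram matrix. So the norm is the same in every orthonormal frame, and it is continuous in
  \<open>H\<close> and \<open>Q\<close>, which cannot be read off from frames picked separately at each point.
\<close>

lemma frame_norm_square:
  fixes E H Q :: "real^'n^'n"
  assumes "transpose E ** Q ** E = mat 1"
  shows "(\<Sum>i\<in>UNIV. \<Sum>j\<in>UNIV. (column i E \<bullet> (H *v column j E))\<^sup>2) =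
    (\<Sum>a\<in>UNIV. \<Sum>b\<in>UNIV. \<Sum>a'\<in>UNIV. \<Sum>b'\<in>UNIV.
       H $ a $ b * H $ a' $ b' * matrix_inv Q $ a $ a' * matrix_inv Q $ b $ b')"
proof -
  have K: "matrix_inv Q $ a $ a' = (\<Sum>i\<in>UNIV. E $ a $ i * E $ a' $ i)" for a a'
    unfolding orthonormal_frame_inverse(3)[OF assms, symmetric]
    by (simp add: matrix_matrix_mult_def transpose_def)
  have "(column i E \<bullet> (H *v column j E))\<^sup>2 =
     (\<Sum>a\<in>UNIV. \<Sum>b\<in>UNIV. \<Sum>a'\<in>UNIV. \<Sum>b'\<in>UNIV.
       H $ a $ b * H $ a' $ b' * (E $ a $ i * E $ a' $ i) * (E $ b $ j * E $ b' $ j))" for i j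
  proof -
    have "column i E \<bullet> (H *v column j E) = (\<Sum>a\<in>UNIV. \<Sum>b\<in>UNIV. E $ a $ i * (H $ a $ b * E $ b $ j))"
      by (simp add: inner_vec_def column_def matrix_vector_mult_def sum_distrib_left)
    then show ?thesis
      unfolding power2_eq_square
      by (simp add: sum_product sum_distrib_left sum_distrib_right)
         (intro sum.cong refl, simp add: algebra_simps)
  qed
  then have "(\<Sum>i\<in>UNIV. \<Sum>j\<in>UNIV. (column i E \<bullet> (H *v column j E))\<^sup>2) =
     (\<Sum>i\<in>UNIV. \<Sum>j\<in>UNIV. \<Sum>a\<in>UNIV. \<Sum>b\<in>UNIV. \<Sum>a'\<in>UNIV. \<Sum>b'\<in>UNIV.
       H $ a $ b * H $ a' $ b' * (E $ a $ i * E $ a' $ i) * (E $ b $ j * E $ b' $ j))"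
    by simp
  also have "\<dots> = (\<Sum>i\<in>UNIV. \<Sum>a\<in>UNIV. \<Sum>b\<in>UNIV. \<Sum>a'\<in>UNIV. \<Sum>b'\<in>UNIV. \<Sum>j\<in>UNIV.
       H $ a $ b * H $ a' $ b' * (E $ a $ i * E $ a' $ i) * (E $ b $ j * E $ b' $ j))"
    by (rule sum.cong[OF refl], rule sum_swap4)
  also have "\<dots> = (\<Sum>a\<in>UNIV. \<Sum>b\<in>UNIV. \<Sum>a'\<in>UNIV. \<Sum>b'\<in>UNIV. \<Sum>i\<in>UNIV. \<Sum>j\<in>UNIV.
       H $ a $ b * H $ a' $ b' * (E $ a $ i * E $ a' $ i) * (E $ b $ j * E $ b' $ j))"
    by (rule sum_swap4)
  also have "\<dots> = (\<Sum>a\<in>UNIV. \<Sum>b\<in>UNIV. \<Sum>a'\<in>UNIV. \<Sum>b'\<in>UNIV.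
       H $ a $ b * H $ a' $ b' * matrix_inv Q $ a $ a' * matrix_inv Q $ b $ b')"
    by (simp add: K sum_distrib_left sum_distrib_right mult.assoc)
       (rule sum.cong[OF refl], rule sum.cong[OF refl], rule sum.cong[OF refl],
        rule sum.cong[OF refl], rule sum.swap)
  finally show ?thesis .
qed

text \<open>
  In the coordinates of the frame the form is \<open>\<Sum>i j. a\<^sub>i a\<^sub>j H\<^sub>i\<^sub>j\<close>, and Cauchy--Schwarz over
  pairs of indices applies.
\<close>

lemma frame_norm_bound:
  fixes E H Q :: "real^'n^'n"
  assumes E: "transpose E ** Q ** E = mat 1"
  shows "\<bar>u \<bullet> (H *v u)\<bar> \<le> sqrt (\<Sum>i\<in>UNIV. \<Sum>j\<in>UNIV. (column i E \<bullet> (H *v column j E))\<^sup>2) * (u \<bullet> (Q *v u))"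
proof -
  define a where "a = matrix_inv E *v u"
  have u: "u = E *v a"
    using orthonormal_frame_inverse(1)[OF E]
    by (simp add: a_def matrix_vector_mul_assoc matrix_inv_mult(1))
  have form: "u \<bullet> (B *v u) = (\<Sum>i\<in>UNIV. \<Sum>j\<in>UNIV. (a $ i * a $ j) * (column i E \<bullet> (B *v column j E)))" for B
  proof -
    have "u \<bullet> (B *v u) = a \<bullet> ((transpose E ** B ** E) *v a)"
      by (simp only: u congruence_quadratic_form)
    also have "\<dots> = (\<Sum>i\<in>UNIV. \<Sum>j\<in>UNIV. (a $ i * a $ j) * (column i E \<bullet> (B *v column j E)))"
      by (simp add: inner_vec_def[of a] matrix_vector_mult_def[of "_ ** E"] matrix_congruence_nth sum_distrib_left mult_ac)
    finally show ?thesis .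
  qed
  have Qu: "u \<bullet> (Q *v u) = a \<bullet> a"
    by (simp only: u congruence_quadratic_form E matrix_vector_mul_lid)
  have "\<bar>u \<bullet> (H *v u)\<bar> = \<bar>\<Sum>(i,j)\<in>UNIV \<times> UNIV. (a $ i * a $ j) * (column i E \<bullet> (H *v column j E))\<bar>"
    by (simp add: form sum.cartesian_product)
  also have "\<dots> \<le> sqrt (\<Sum>(i,j)\<in>UNIV\<times>UNIV. (a $ i * a $ j)\<^sup>2) * sqrt (\<Sum>(i,j)\<in>UNIV\<times>UNIV. (column i E \<bullet> (H *v column j E))\<^sup>2)"
  proof -
    let ?f = "\<lambda>(i,j). a $ i * a $ j" and ?g = "\<lambda>(i,j). column i E \<bullet> (H *v column j E)"
    have "\<bar>\<Sum>x\<in>UNIV\<times>UNIV. ?f x * ?g x\<bar> \<le> (\<Sum>x\<in>UNIV\<times>UNIV. \<bar>?f x\<bar> * \<bar>?g x\<bar>)"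
      by (rule order_trans[OF sum_abs]) (simp add: abs_mult)
    also have "\<dots> \<le> L2_set ?f (UNIV\<times>UNIV) * L2_set ?g (UNIV\<times>UNIV)"
      by (rule L2_set_mult_ineq)
    finally show ?thesis by (simp add: L2_set_def case_prod_unfold)
  qed
  also have "(\<Sum>(i,j)\<in>UNIV\<times>UNIV. (a $ i * a $ j)\<^sup>2) = (a \<bullet> a)\<^sup>2"
    by (simp add: inner_vec_def power2_eq_square sum_product sum.cartesian_product mult_ac)
  finally show ?thesis
    by (simp add: Qu sum.cartesian_product mult_ac)
qed

section \<open>Cone averages\<close>

lemma ball_borel [measurable]: "ball x r \<in> sets borel"
  by simp

text \<open>
  Up to normalization this is the mean value of \<open>h\<close> along a segment that starts at \<open>x\<close>, averaged over all such
  segments of length less than \<open>R\<close>. In dimension \<open>m > 1\<close> it is bounded by a multiple of the potential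
  \<open>\<integral> h(w) |w - x|\<^bsup>1-m\<^esup> dw\<close> over the ball, as polar coordinates show.
\<close>

definition cone_avg :: "real \<Rightarrow> ('b::euclidean_space \<Rightarrow> real) \<Rightarrow> 'b \<Rightarrow> ennreal" where
  "cone_avg R h x = (\<integral>\<^sup>+u\<in>ball 0 R. (\<integral>\<^sup>+t\<in>{0..1}. ennreal (h (x + t *\<^sub>R u)) \<partial>lborel) \<partial>lborel)"

lemma measurable_segment_integral:
  fixes h :: "'b::euclidean_space \<Rightarrow> real"
  assumes [measurable]: "h \<in> borel_measurable borel"
  shows "(\<lambda>z. \<integral>\<^sup>+t\<in>{0..1}. ennreal (h (x + t *\<^sub>R (z - x))) \<partial>lborel) \<in> borel_measurable lborel"
  by measurable

lemma measurable_cone_avg [measurable]: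
  fixes h :: "'b::euclidean_space \<Rightarrow> real"
  assumes [measurable]: "h \<in> borel_measurable borel"
  shows "cone_avg R h \<in> borel_measurable borel"
  unfolding cone_avg_def by measurable

lemma cone_avg_segments_le:
  fixes h :: "'b::euclidean_space \<Rightarrow> real"
  assumes h [measurable]: "h \<in> borel_measurable borel" and sub: "ball y \<rho> \<subseteq> ball x R"
  shows "(\<integral>\<^sup>+z\<in>ball y \<rho>. (\<integral>\<^sup>+t\<in>{0..1}. ennreal (h (x + t *\<^sub>R (z - x))) \<partial>lborel) \<partial>lborel) \<le> cone_avg R h x"
proof -
  let ?f = "\<lambda>z. \<integral>\<^sup>+t\<in>{0..1}. ennreal (h (x + t *\<^sub>R (z - x))) \<partial>lborel"
  have "(\<integral>\<^sup>+z\<in>ball y \<rho>. ?f z \<partial>lborel) \<le> (\<integral>\<^sup>+z\<in>ball x R. ?f z \<partial>lborel)"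
    using sub by (intro nn_integral_mono) (auto simp: indicator_def)
  also have "\<dots> = (\<integral>\<^sup>+z. ?f z * indicator (ball x R) z \<partial>distr lborel borel (\<lambda>u. x + u))"
    by (simp add: lborel_distr_plus)
  also have "\<dots> = (\<integral>\<^sup>+u. ?f (x + u) * indicator (ball x R) (x + u) \<partial>lborel)"
    by (rule nn_integral_distr) measurable
  also have "\<dots> = cone_avg R h x"
    unfolding cone_avg_def by (intro nn_integral_cong) (simp add: indicator_def dist_norm)
  finally show ?thesis .
qed

text \<open>
  Otherwise the integral over \<open>z\<close> of the two line integrals would exceed the sum of the two cone
  averages.
\<close>

lemma exists_connecting_point:
  fixes h :: "'b::euclidean_space \<Rightarrow> real"
  assumes h [measurable]: "h \<in> borel_measurable borel"
    and Z: "ball w \<rho> \<subseteq> ball x R" "ball w \<rho> \<subseteq> ball y R"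
    and \<delta>: "cone_avg R h x \<le> \<delta>" "cone_avg R h y \<le> \<delta>" "2 * \<delta> < \<kappa> * emeasure lborel (ball w \<rho>)"
  shows "\<exists>z\<in>ball w \<rho>. (\<integral>\<^sup>+t\<in>{0..1}. ennreal (h (x + t *\<^sub>R (z - x))) \<partial>lborel) +
      (\<integral>\<^sup>+t\<in>{0..1}. ennreal (h (y + t *\<^sub>R (z - y))) \<partial>lborel) \<le> \<kappa>"
proof (rule ccontr)
  define F where "F x z = (\<integral>\<^sup>+t\<in>{0..1}. ennreal (h (x + t *\<^sub>R (z - x))) \<partial>lborel)" for x z
  have F [measurable]: "F x \<in> borel_measurable lborel" for x
    unfolding F_def by (rule measurable_segment_integral[OF h])
  assume "\<not> ?thesis"
  then have "\<kappa> \<le> F x z + F y z" if "z \<in> ball w \<rho>" for z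
    using that unfolding F_def by (meson le_cases)
  then have "(\<integral>\<^sup>+z. \<kappa> * indicator (ball w \<rho>) z \<partial>lborel) \<le>
      (\<integral>\<^sup>+z. F x z * indicator (ball w \<rho>) z + F y z * indicator (ball w \<rho>) z \<partial>lborel)"
    by (intro nn_integral_mono) (simp add: indicator_def)
  also have "\<dots> = (\<integral>\<^sup>+z\<in>ball w \<rho>. F x z \<partial>lborel) + (\<integral>\<^sup>+z\<in>ball w \<rho>. F y z \<partial>lborel)"
    by (rule nn_integral_add) measurable
  also have "\<dots> \<le> \<delta> + \<delta>"
    unfolding F_def
    using order_trans[OF cone_avg_segments_le[OF h Z(1)] \<delta>(1)] order_trans[OF cone_avg_segments_le[OF h Z(2)] \<delta>(2)]
    by (rule add_mono)
  also have "\<dots> = 2 * \<delta>" by (simp add: mult_2)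
  finally have "\<kappa> * emeasure lborel (ball w \<rho>) \<le> 2 * \<delta>"
    by (simp add: nn_integral_cmult_indicator)
  then show False using \<delta>(3) by simp
qed

lemma nn_integral_ball_scale:
  fixes f :: "'b::euclidean_space \<Rightarrow> ennreal"
  assumes [measurable]: "f \<in> borel_measurable borel" and t: "0 < t"
  shows "(\<integral>\<^sup>+w\<in>ball x (t * R). f w \<partial>lborel) = ennreal (t ^ DIM('b)) * (\<integral>\<^sup>+u\<in>ball 0 R. f (x + t *\<^sub>R u) \<partial>lborel)"
proof -
  have "(\<integral>\<^sup>+w\<in>ball x (t * R). f w \<partial>lborel) =
      (\<integral>\<^sup>+w. f w * indicator (ball x (t * R)) w \<partial>density (distr lborel borel (\<lambda>u. x + t *\<^sub>R u)) (\<lambda>_. \<bar>t\<bar> ^ DIM('b)))"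
    by (subst lborel_affine[of t x]) (use t in simp_all)
  also have "\<dots> = (\<integral>\<^sup>+u. ennreal (t ^ DIM('b)) * (f (x + t *\<^sub>R u) * indicator (ball x (t * R)) (x + t *\<^sub>R u)) \<partial>lborel)"
    using t by (subst nn_integral_density) (simp_all add: nn_integral_distr)
  also have "\<dots> = (\<integral>\<^sup>+u. ennreal (t ^ DIM('b)) * (f (x + t *\<^sub>R u) * indicator (ball 0 R) u) \<partial>lborel)"
    using t by (intro nn_integral_cong) (auto simp: indicator_def dist_norm)
  also have "\<dots> = ennreal (t ^ DIM('b)) * (\<integral>\<^sup>+u\<in>ball 0 R. f (x + t *\<^sub>R u) \<partial>lborel)"
    by (rule nn_integral_cmult) measurable
  finally show ?thesis .
qed

lemma le_threshold_plus_power: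
  fixes a \<tau> q :: real
  assumes "0 \<le> a" "0 < \<tau>" "1 \<le> q"
  shows "a \<le> \<tau> + \<tau> powr (1 - q) * a powr q"
proof (cases "a \<le> \<tau>")
  case True
  then show ?thesis by (smt (verit) mult_nonneg_nonneg powr_ge_zero)
next
  case False
  then have "a = a powr (1 - q) * a powr q"
    using assms by (simp add: powr_add[symmetric])
  also have "\<dots> \<le> \<tau> powr (1 - q) * a powr q"
    using False assms by (intro mult_right_mono powr_mono2') auto
  finally show ?thesis using assms by simp
qed

text \<open>
  This is Hoelder's inequality on the ball up to a constant. It follows from the additive inequality
  \<open>le_threshold_plus_power\<close> with a well chosen threshold.
\<close>

lemma nn_integral_ball_le_of_power_growth:
  fixes h :: "'b::euclidean_space \<Rightarrow> real"
  assumes h [measurable]: "h \<in> borel_measurable borel" and h0: "\<And>x. 0 \<le> h x"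
    and q: "1 \<le> q" and l: "0 < l" and r: "0 < r"
    and growth: "(\<integral>\<^sup>+w\<in>ball x r. ennreal (h w powr q) \<partial>lborel) \<le> ennreal (l * r powr s)"
  shows "(\<integral>\<^sup>+w\<in>ball x r. ennreal (h w) \<partial>lborel) \<le>
    ennreal ((unit_ball_vol (real DIM('b)) + 1) * l powr (1 / q) * r powr ((s - real DIM('b)) / q + real DIM('b)))"
proof -
  let ?m = "real DIM('b)"
  \<comment> \<open>The order of magnitude of the q-mean of h over the ball; it balances the two summands below.\<close>
  define \<tau> where "\<tau> = l powr (1 / q) * r powr ((s - ?m) / q)"
  have \<tau>: "0 < \<tau>" using l r by (simp add: \<tau>_def)
  have "(\<integral>\<^sup>+w\<in>ball x r. ennreal (h w) \<partial>lborel) \<le>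
      (\<integral>\<^sup>+w. ennreal \<tau> * indicator (ball x r) w + ennreal (\<tau> powr (1 - q)) * (ennreal (h w powr q) * indicator (ball x r) w) \<partial>lborel)"
  proof (intro nn_integral_mono)
    fix w
    have "ennreal (h w) \<le> ennreal (\<tau> + \<tau> powr (1 - q) * h w powr q)"
      by (intro ennreal_leI le_threshold_plus_power h0 \<tau> q)
    also have "\<dots> = ennreal \<tau> + ennreal (\<tau> powr (1 - q)) * ennreal (h w powr q)"
      using \<tau> by (simp add: ennreal_mult)
    finally show "ennreal (h w) * indicator (ball x r) w \<le> ennreal \<tau> * indicator (ball x r) w + ennreal (\<tau> powr (1 - q)) * (ennreal (h w powr q) * indicator (ball x r) w)"
      by (auto simp: indicator_def)
  qed
  also have "\<dots> = ennreal \<tau> * emeasure lborel (ball x r) + ennreal (\<tau> powr (1 - q)) * (\<integral>\<^sup>+w\<in>ball x r. ennreal (h w powr q) \<partial>lborel)"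
    by (subst nn_integral_add) (auto simp: nn_integral_cmult nn_integral_cmult_indicator)
  also have "\<dots> \<le> ennreal \<tau> * ennreal (unit_ball_vol ?m * r ^ DIM('b)) + ennreal (\<tau> powr (1 - q)) * ennreal (l * r powr s)"
    using r by (intro add_mono mult_left_mono growth) (auto simp: emeasure_ball)
  also have "\<dots> = ennreal (\<tau> * (unit_ball_vol ?m * r ^ DIM('b)) + \<tau> powr (1 - q) * (l * r powr s))"
    using \<tau> l r by (simp add: ennreal_mult ennreal_plus)
  also have "\<tau> * (unit_ball_vol ?m * r ^ DIM('b)) + \<tau> powr (1 - q) * (l * r powr s) =
     (unit_ball_vol ?m + 1) * l powr (1 / q) * r powr ((s - ?m) / q + ?m)"
  proof -
    have 1: "r ^ DIM('b) = r powr ?m" using r by (simp add: powr_realpow)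
    have "\<tau> powr (1 - q) = l powr ((1 - q) / q) * r powr ((s - ?m) / q * (1 - q))"
      using l r by (simp add: \<tau>_def powr_mult powr_powr)
    then have "\<tau> powr (1 - q) * (l * r powr s) = l powr ((1 - q) / q + 1) * r powr ((s - ?m) / q * (1 - q) + s)"
      using l r by (simp add: powr_add)
    also have "(1 - q) / q + 1 = 1 / q" using q by (simp add: field_simps)
    also have "(s - ?m) / q * (1 - q) + s = (s - ?m) / q + ?m" using q by (simp add: field_simps)
    finally show ?thesis by (simp add: 1 \<tau>_def powr_add algebra_simps)
  qed
  finally show ?thesis .
qed

lemma nn_integral_powr_unit:
  assumes "-1 < a"
  shows "(\<integral>\<^sup>+t\<in>{0..1}. ennreal (t powr a) \<partial>lborel) = ennreal (1 / (a + 1))"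
proof -
  have "((\<lambda>t. t powr a) has_integral (1 powr (a + 1) / (a + 1))) {0..1::real}"
    by (rule has_integral_powr_from_0) (use assms in auto)
  then have "((\<lambda>t. t powr a) has_integral (1 / (a + 1))) {0..1::real}" by simp
  then have "((\<lambda>t. if t \<in> {0..1} then t powr a else 0) has_integral (1 / (a + 1))) UNIV"
    by (simp only: has_integral_restrict_UNIV)
  then have "integral\<^sup>N lborel (\<lambda>t. ennreal (if t \<in> {0..1} then t powr a else 0)) = ennreal (1 / (a + 1))"
    by (intro nn_integral_has_integral_lborel) auto
  moreover have "(\<integral>\<^sup>+t\<in>{0..1}. ennreal (t powr a) \<partial>lborel) =
      integral\<^sup>N lborel (\<lambda>t. ennreal (if t \<in> {0..1} then t powr a else 0))"
    by (intro nn_integral_cong) (auto simp: indicator_def)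
  ultimately show ?thesis by simp
qed

text \<open>
  By Fubini the cone average is the integral over \<open>t\<close> of means over balls of radius \<open>t * R\<close>. The growth
  condition bounds these by a multiple of \<open>t powr a\<close> with \<open>a = (s - m) / q\<close>, and the hypothesis on \<open>s\<close> says
  exactly that \<open>a > -1\<close>.
\<close>

lemma cone_avg_le_of_power_growth:
  fixes h :: "'b::euclidean_space \<Rightarrow> real"
  assumes h [measurable]: "h \<in> borel_measurable borel" and h0: "\<And>x. 0 \<le> h x"
    and q: "1 \<le> q" and l: "0 < l" and R: "0 < R" and s: "real DIM('b) - q < s"
    and growth: "\<And>r. 0 < r \<Longrightarrow> r \<le> R \<Longrightarrow> (\<integral>\<^sup>+w\<in>ball x r. ennreal (h w powr q) \<partial>lborel) \<le> ennreal (l * r powr s)"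
  shows "cone_avg R h x \<le> ennreal ((unit_ball_vol (real DIM('b)) + 1) * R powr ((s - real DIM('b)) / q + real DIM('b)) /
      ((s - real DIM('b)) / q + 1) * l powr (1 / q))"
proof -
  let ?m = "real DIM('b)"
  define a where "a = (s - ?m) / q"
  define C where "C = (unit_ball_vol ?m + 1) * l powr (1 / q) * R powr (a + ?m)"
  have a: "-1 < a" using s q by (simp add: a_def field_simps)
  have C: "0 \<le> C" using l by (simp add: C_def)
  have "cone_avg R h x = (\<integral>\<^sup>+u. (\<integral>\<^sup>+t. indicator (ball 0 R) u * (ennreal (h (x + t *\<^sub>R u)) * indicator {0..1} t) \<partial>lborel) \<partial>lborel)"
    unfolding cone_avg_def by (intro nn_integral_cong) (auto simp: indicator_def)
  also have "\<dots> = (\<integral>\<^sup>+t. (\<integral>\<^sup>+u. indicator (ball 0 R) u * (ennreal (h (x + t *\<^sub>R u)) * indicator {0..1} t) \<partial>lborel) \<partial>lborel)"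
    by (rule lborel_pair.Fubini'[symmetric]) measurable
  also have "\<dots> \<le> (\<integral>\<^sup>+t. ennreal C * (ennreal (t powr a) * indicator {0..1} t) \<partial>lborel)"
  proof (rule nn_integral_mono_AE, rule AE_mp[OF AE_lborel_singleton[of 0]], rule AE_I2, rule impI)
    fix t :: real assume "t \<noteq> 0"
    show "(\<integral>\<^sup>+u. indicator (ball 0 R) u * (ennreal (h (x + t *\<^sub>R u)) * indicator {0..1} t) \<partial>lborel)
       \<le> ennreal C * (ennreal (t powr a) * indicator {0..1} t)"
    proof (cases "t \<in> {0..1}")
      case True
      then have t: "0 < t" "t \<le> 1" using \<open>t \<noteq> 0\<close> by auto
      let ?I = "\<integral>\<^sup>+u\<in>ball 0 R. ennreal (h (x + t *\<^sub>R u)) \<partial>lborel"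
      have tR: "0 < t * R" "t * R \<le> R" using t R by auto
      have "ennreal (t ^ DIM('b)) * ?I = (\<integral>\<^sup>+w\<in>ball x (t * R). ennreal (h w) \<partial>lborel)"
        by (rule nn_integral_ball_scale[symmetric]) (use t in simp_all)
      also have "\<dots> \<le> ennreal ((unit_ball_vol ?m + 1) * l powr (1 / q) * (t * R) powr (a + ?m))"
        unfolding a_def by (rule nn_integral_ball_le_of_power_growth[OF h h0 q l tR(1) growth[OF tR]])
      also have "\<dots> = ennreal (t ^ DIM('b) * (C * t powr a))"
        using t R by (simp add: C_def powr_mult powr_add powr_realpow mult_ac)
      also have "\<dots> = ennreal (t ^ DIM('b)) * ennreal (C * t powr a)"
        using t C by (subst ennreal_mult) simp_all
      finally have "?I \<le> ennreal (C * t powr a)"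
        using t by (subst (asm) ennreal_mult_le_mult_iff) simp_all
      then show ?thesis using True C by (simp add: ennreal_mult mult.commute)
    qed simp
  qed
  also have "\<dots> = ennreal C * ennreal (1 / (a + 1))"
    by (subst nn_integral_cmult) (simp_all add: nn_integral_powr_unit[OF a])
  also have "\<dots> = ennreal (C * (1 / (a + 1)))"
    using C a by (subst ennreal_mult) simp_all
  also have "C * (1 / (a + 1)) = (unit_ball_vol ?m + 1) * R powr (a + ?m) / (a + 1) * l powr (1 / q)"
    by (simp add: C_def)
  finally show ?thesis by (simp add: a_def)
qed

section \<open>Covering the points of large cone average\<close>

text \<open>
  Every point where the growth condition fails is the centre of a ball \<open>B\<close> of radius \<open>r\<close> with
  \<open>l r\<^sup>s < \<integral>\<^bsub>B\<^esub> F\<close>. By Vitali's lemma disjoint balls of this kind cover after dilation by 5, and for disjoint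
  balls the right-hand sides sum up to at most the total integral.
\<close>

lemma power_growth_covering:
  fixes F :: "'b::euclidean_space \<Rightarrow> ennreal"
  assumes F [measurable]: "F \<in> borel_measurable borel" and l: "0 < l"
    and tot: "(\<integral>\<^sup>+w. F w \<partial>lborel) \<le> ennreal (l * c)"
  shows "\<exists>(a :: nat \<Rightarrow> 'b) \<rho>. (\<forall>j. 0 \<le> \<rho> j) \<and>
    {x. \<exists>r. 0 < r \<and> r \<le> R \<and> ennreal (l * r powr s) < (\<integral>\<^sup>+w\<in>ball x r. F w \<partial>lborel)} \<subseteq> (\<Union>j. ball (a j) (5 * \<rho> j)) \<and>
    (\<Sum>j. ennreal (\<rho> j powr s)) \<le> ennreal c"
proof -
  define S where "S = {x. \<exists>r. 0 < r \<and> r \<le> R \<and> ennreal (l * r powr s) < (\<integral>\<^sup>+w\<in>ball x r. F w \<partial>lborel)}"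
  define r where "r x = (SOME r. 0 < r \<and> r \<le> R \<and> ennreal (l * r powr s) < (\<integral>\<^sup>+w\<in>ball x r. F w \<partial>lborel))" for x
  have r: "0 < r x \<and> r x \<le> R \<and> ennreal (l * r x powr s) < (\<integral>\<^sup>+w\<in>ball x (r x). F w \<partial>lborel)" if "x \<in> S" for x
    unfolding r_def by (rule someI_ex) (use that in \<open>simp add: S_def\<close>)
  have "S \<subseteq> (\<Union>x\<in>S. ball ((\<lambda>x. x) x) (r x))" using r by fastforce
  then obtain C where C: "countable C" "C \<subseteq> S"
     "pairwise (\<lambda>i j. disjnt (ball i (r i)) (ball j (r j))) C"
     "S \<subseteq> (\<Union>i\<in>C. ball i (5 * r i))"
    by (rule Vitali_covering_lemma_balls[where B = R]) (use r in blast)+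
  define I where "I = to_nat_on C ` C"
  define a where "a j = from_nat_into C j" for j
  \<comment> \<open>The disjoint family may be finite; the remaining indices get empty balls.\<close>
  define \<rho> where "\<rho> j = (if j \<in> I then r (a j) else 0)" for j
  have aI: "a j \<in> C" if "j \<in> I" for j
    using that C(1) by (auto simp: I_def a_def)
  have a_to: "a (to_nat_on C x) = x" if "x \<in> C" for x
    using that C(1) by (simp add: a_def)
  have a_inj: "i = j" if "i \<in> I" "j \<in> I" "a i = a j" for i j
    using that C(1) by (auto simp: I_def a_def)
  have "S \<subseteq> (\<Union>j. ball (a j) (5 * \<rho> j))"
  proof
    fix x assume "x \<in> S"
    then obtain i where i: "i \<in> C" "x \<in> ball i (5 * r i)" using C(4) by blast
    then have "x \<in> ball (a (to_nat_on C i)) (5 * \<rho> (to_nat_on C i))"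
      by (simp add: a_to \<rho>_def I_def)
    then show "x \<in> (\<Union>j. ball (a j) (5 * \<rho> j))" by blast
  qed
  moreover have \<rho>0: "0 \<le> \<rho> j" for j
    using r C(2) aI by (auto simp: \<rho>_def subset_iff less_imp_le)
  moreover have "(\<Sum>j. ennreal (\<rho> j powr s)) \<le> ennreal c"
  proof -
    have disj: "disjoint_family (\<lambda>j. ball (a j) (\<rho> j))"
      unfolding disjoint_family_on_def
    proof (intro ballI impI)
      fix i j :: nat assume "i \<noteq> j"
      show "ball (a i) (\<rho> i) \<inter> ball (a j) (\<rho> j) = {}"
      proof (cases "i \<in> I \<and> j \<in> I")
        case True
        then have "a i \<noteq> a j" using a_inj \<open>i \<noteq> j\<close> by blast
        then show ?thesis
          using C(3) aI True by (simp add: pairwise_def disjnt_def \<rho>_def)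
      qed (auto simp: \<rho>_def)
    qed
    have "ennreal l * (\<Sum>j. ennreal (\<rho> j powr s)) = (\<Sum>j. ennreal (l * \<rho> j powr s))"
      using l by (simp add: ennreal_mult ennreal_suminf_cmult)
    also have "\<dots> \<le> (\<Sum>j. \<integral>\<^sup>+w\<in>ball (a j) (\<rho> j). F w \<partial>lborel)"
    proof (intro suminf_le summableI)
      fix j show "ennreal (l * \<rho> j powr s) \<le> (\<integral>\<^sup>+w\<in>ball (a j) (\<rho> j). F w \<partial>lborel)"
        using r C(2) aI[of j] by (cases "j \<in> I") (auto simp: \<rho>_def subset_iff intro: less_imp_le)
    qed
    also have "\<dots> = (\<integral>\<^sup>+w. (\<Sum>j. F w * indicator (ball (a j) (\<rho> j)) w) \<partial>lborel)"
      by (rule nn_integral_suminf[symmetric]) measurable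
    also have "\<dots> = (\<integral>\<^sup>+w. F w * indicator (\<Union>j. ball (a j) (\<rho> j)) w \<partial>lborel)"
      by (intro nn_integral_cong) (simp add: suminf_indicator[OF disj] ennreal_suminf_cmult)
    also have "\<dots> \<le> (\<integral>\<^sup>+w. F w \<partial>lborel)"
      by (intro nn_integral_mono) (simp add: indicator_def)
    also have "\<dots> \<le> ennreal l * ennreal c"
      using tot l by (simp add: ennreal_mult')
    finally show ?thesis
      using l by (subst (asm) ennreal_mult_le_mult_iff) simp_all
  qed
  ultimately show ?thesis unfolding S_def by blast
qed

text \<open>
  The sum of the powers of the radii is made small without an upper bound on the single radii. For
  \<open>s > 0\<close> a small sum forces small radii (\<open>radius_le_of_sum_powr_le\<close>), so this describes the null sets of
  \<open>s\<close>-dimensional Hausdorff measure.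
\<close>

definition content_null :: "real \<Rightarrow> 'b::euclidean_space set \<Rightarrow> bool" where
  "content_null s X \<longleftrightarrow> (\<forall>\<eta>>0. \<exists>(a :: nat \<Rightarrow> 'b) r. (\<forall>j. 0 \<le> r j) \<and> X \<subseteq> (\<Union>j. ball (a j) (r j)) \<and>
     (\<Sum>j. ennreal (r j powr s)) \<le> ennreal \<eta>)"

lemma content_null_subset: "content_null s Y \<Longrightarrow> X \<subseteq> Y \<Longrightarrow> content_null s X"
  unfolding content_null_def by (meson order_trans)

lemma radius_le_of_sum_powr_le:
  assumes "0 \<le> r (j::nat)" "0 < s" "0 \<le> \<eta>" "(\<Sum>j. ennreal (r j powr s)) \<le> ennreal \<eta>"
  shows "r j \<le> \<eta> powr (1 / s)"
proof -
  have "(\<Sum>i\<in>{j}. ennreal (r i powr s)) \<le> (\<Sum>j. ennreal (r j powr s))"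
    by (rule sum_le_suminf) auto
  then have "ennreal (r j powr s) \<le> ennreal \<eta>"
    using assms(4) by simp
  then have "r j powr s \<le> \<eta>" using assms by (simp add: ennreal_le_iff)
  then have "(r j powr s) powr (1 / s) \<le> \<eta> powr (1 / s)"
    using assms by (intro powr_mono2) auto
  then show ?thesis using assms by (simp add: powr_powr)
qed

text \<open>
  The radii in a cover with small sum are at most 1, so \<open>r\<^sup>m \<le> r\<^sup>s\<close> and the covering balls have small
  total volume.
\<close>

lemma content_null_imp_negligible:
  fixes X :: "'b::euclidean_space set"
  assumes "content_null s X" "0 < s" "s \<le> real DIM('b)"
  shows "negligible X"
  unfolding negligible_outer_le
proof (intro allI impI)
  fix e :: real assume e: "0 < e"
  let ?m = "real DIM('b)"
  define \<eta> where "\<eta> = min 1 (e / unit_ball_vol ?m)"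
  have \<eta>: "0 < \<eta>" "\<eta> \<le> 1" "unit_ball_vol ?m * \<eta> \<le> e" using e by (auto simp: \<eta>_def min_def field_simps)
  obtain a r where ar: "\<And>j::nat. 0 \<le> r j" "X \<subseteq> (\<Union>j. ball (a j) (r j))" "(\<Sum>j. ennreal (r j powr s)) \<le> ennreal \<eta>"
    using assms(1)[unfolded content_null_def, rule_format, OF \<eta>(1)] by blast
  have r1: "r j \<le> 1" for j
  proof -
    have "r j \<le> \<eta> powr (1 / s)"
      by (rule radius_le_of_sum_powr_le) (use ar assms \<eta> in auto)
    also have "\<dots> \<le> 1" using \<eta> assms by (simp add: powr_le1)
    finally show ?thesis .
  qed
  have "emeasure lborel (\<Union>j. ball (a j) (r j)) \<le> (\<Sum>j. emeasure lborel (ball (a j) (r j)))"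
    by (intro emeasure_subadditive_countably) auto
  also have "\<dots> \<le> (\<Sum>j. ennreal (unit_ball_vol ?m) * ennreal (r j powr s))"
  proof (intro suminf_le summableI)
    fix j
    have "r j ^ DIM('b) \<le> r j powr s"
    proof (cases "r j = 0")
      case False
      then have "r j ^ DIM('b) = r j powr ?m" using ar(1)[of j] by (simp add: powr_realpow)
      also have "\<dots> \<le> r j powr s" using ar(1)[of j] r1[of j] assms False by (intro powr_mono') auto
      finally show ?thesis .
    qed (simp add: power_0_left)
    then show "emeasure lborel (ball (a j) (r j)) \<le> ennreal (unit_ball_vol ?m) * ennreal (r j powr s)"
      using ar(1)[of j] by (simp add: emeasure_ball ennreal_mult[symmetric] mult_left_mono)
  qed
  also have "\<dots> = ennreal (unit_ball_vol ?m) * (\<Sum>j. ennreal (r j powr s))"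
    by (rule ennreal_suminf_cmult)
  also have "\<dots> \<le> ennreal (unit_ball_vol ?m) * ennreal \<eta>"
    by (intro mult_left_mono ar) simp
  also have "\<dots> \<le> ennreal e"
    using \<eta> by (subst ennreal_mult[symmetric]) (auto intro: ennreal_leI)
  finally have le: "emeasure lborel (\<Union>j. ball (a j) (r j)) \<le> ennreal e" .
  have op: "open (\<Union>j. ball (a j) (r j))" by blast
  have "(\<Union>j. ball (a j) (r j)) \<in> lmeasurable"
    using le op by (intro fmeasurableI) (auto simp: order_le_less_trans)
  moreover have "measure lebesgue (\<Union>j. ball (a j) (r j)) \<le> e"
    using le op e by (simp add: measure_def enn2real_leI)
  ultimately show "\<exists>T. X \<subseteq> T \<and> T \<in> lmeasurable \<and> measure lebesgue T \<le> e"
    using ar(2) by blast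
qed

text \<open>
  The Borel--Cantelli argument: the covers of the sets \<open>S k\<close> with \<open>k \<ge> K\<close> together cover \<open>X\<close>, and
  their total cost is the tail of a geometric series.
\<close>

lemma content_null_limsup:
  fixes S :: "nat \<Rightarrow> 'b::euclidean_space set"
  assumes X: "\<And>K. X \<subseteq> (\<Union>k\<in>{K..}. S k)"
    and S: "\<And>k. k \<ge> N \<Longrightarrow> \<exists>(a :: nat \<Rightarrow> 'b) r. (\<forall>j. 0 \<le> r j) \<and> S k \<subseteq> (\<Union>j. ball (a j) (r j)) \<and>
     (\<Sum>j. ennreal (r j powr s)) \<le> ennreal (c * (1 / 2) ^ k)"
    and c: "0 \<le> c"
  shows "content_null s X"
  unfolding content_null_def
proof (intro allI impI)
  fix \<eta> :: real assume \<eta>: "0 < \<eta>"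
  have "(\<lambda>K. 2 * c * (1 / 2) ^ K) \<longlonglongrightarrow> 2 * c * 0"
    by (intro tendsto_mult tendsto_const LIMSEQ_realpow_zero) auto
  then have "\<forall>\<^sub>F K in sequentially. 2 * c * (1 / 2) ^ K < \<eta>"
    by (rule order_tendstoD) (use \<eta> in simp)
  then obtain K where K: "K \<ge> N" "2 * c * (1 / 2) ^ K < \<eta>"
    unfolding eventually_sequentially by (metis max.cobounded1 max.cobounded2)
  have "\<exists>a r. (\<forall>j::nat. 0 \<le> r j) \<and> S (K + k) \<subseteq> (\<Union>j. ball (a j) (r j)) \<and>
     (\<Sum>j. ennreal (r j powr s)) \<le> ennreal (c * (1 / 2) ^ (K + k))" for k
    by (rule S) (use K in simp)
  then obtain a r where ar: "\<And>k j::nat. 0 \<le> r k j" "\<And>k. S (K + k) \<subseteq> (\<Union>j. ball (a k j) (r k j))"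
     "\<And>k. (\<Sum>j. ennreal (r k j powr s)) \<le> ennreal (c * (1 / 2) ^ (K + k))"
    by metis
  define a' where "a' i = (case prod_decode i of (k, j) \<Rightarrow> a k j)" for i
  define r' where "r' i = (case prod_decode i of (k, j) \<Rightarrow> r k j)" for i
  have "X \<subseteq> (\<Union>i. ball (a' i) (r' i))"
  proof
    fix x assume "x \<in> X"
    then obtain k where "k \<ge> K" "x \<in> S k" using X[of K] by blast
    then have "x \<in> S (K + (k - K))" by simp
    then obtain j where "x \<in> ball (a (k - K) j) (r (k - K) j)" using ar(2) by blast
    then have "x \<in> ball (a' (prod_encode (k - K, j))) (r' (prod_encode (k - K, j)))"
      by (simp add: a'_def r'_def)
    then show "x \<in> (\<Union>i. ball (a' i) (r' i))" by blast
  qed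
  moreover have "(\<Sum>i. ennreal (r' i powr s)) \<le> ennreal \<eta>"
  proof -
    have "(\<Sum>i. ennreal (r' i powr s)) = (\<Sum>i. (\<lambda>(k, j). ennreal (r k j powr s)) (prod_decode i))"
      by (simp add: r'_def case_prod_unfold)
    also have "\<dots> = (\<Sum>k. \<Sum>j. ennreal (r k j powr s))"
      by (rule suminf_ennreal_2dimen) simp
    also have "\<dots> \<le> (\<Sum>k. ennreal (c * (1 / 2) ^ (K + k)))"
      by (intro suminf_le ar summableI)
    also have "\<dots> = ennreal (\<Sum>k. c * (1 / 2) ^ K * (1 / 2) ^ k)"
      using c by (subst suminf_ennreal2) (auto simp: power_add mult.assoc intro!: summable_mult)
    also have "(\<Sum>k. c * (1 / 2) ^ K * (1 / 2) ^ k) = 2 * c * (1 / 2) ^ K"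
      by (subst suminf_mult) (auto simp: suminf_geometric)
    also have "ennreal (2 * c * (1 / 2) ^ K) \<le> ennreal \<eta>"
      using K by (intro ennreal_leI) simp
    finally show ?thesis .
  qed
  moreover have "\<forall>i. 0 \<le> r' i" using ar(1) by (auto simp: r'_def split: prod.split)
  ultimately show "\<exists>a r. (\<forall>j::nat. 0 \<le> r j) \<and> X \<subseteq> (\<Union>j. ball (a j) (r j)) \<and>
     (\<Sum>j. ennreal (r j powr s)) \<le> ennreal \<eta>" by blast
qed

lemma exponential_beats_linear:
  assumes "1 \<le> q"
  shows "\<forall>\<^sub>F k in sequentially. C * ((1 / 2) ^ k) powr (1 / q) \<le> 1 / (real k + 1)"
proof -
  define b where "b = (1 / 2) powr (1 / q)"
  have b: "0 \<le> b" "b < 1" using assms powr_less_mono2[of "1/q" "1/2" 1] by (auto simp: b_def)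
  have "(\<lambda>k. real k * b ^ k) \<longlonglongrightarrow> 0"
    using powser_times_n_limit_0[of b] b by simp
  moreover have "(\<lambda>k. b ^ k) \<longlonglongrightarrow> 0" using b by (intro LIMSEQ_realpow_zero) auto
  ultimately have "(\<lambda>k. \<bar>C\<bar> * (real k * b ^ k + b ^ k)) \<longlonglongrightarrow> \<bar>C\<bar> * (0 + 0)"
    by (intro tendsto_mult[OF tendsto_const tendsto_add])
  then have "\<forall>\<^sub>F k in sequentially. \<bar>C\<bar> * (real k * b ^ k + b ^ k) < 1"
    by (rule order_tendstoD) simp
  then show ?thesis
  proof eventually_elim
    case (elim k)
    have "((1 / 2) ^ k) powr (1 / q) = b ^ k"
      unfolding b_def by (simp add: powr_power[symmetric] powr_realpow[symmetric] powr_powr mult.commute)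
    moreover have "C * b ^ k \<le> \<bar>C\<bar> * b ^ k" using b by (intro mult_right_mono) auto
    moreover have "\<bar>C\<bar> * b ^ k * (real k + 1) \<le> 1" using elim by (simp add: algebra_simps)
    then have "\<bar>C\<bar> * b ^ k \<le> 1 / (real k + 1)" by (simp add: field_simps)
    ultimately show ?case by (metis order_trans)
  qed
qed

text \<open>
  The power growth condition is used with the factor \<open>l = 2\<^bsup>-k\<^esup>\<close>. Where it holds, the cone average is
  of order \<open>2\<^bsup>-k/q\<^esup>\<close>, which is eventually below \<open>1/(k+1)\<close>. The cost of covering the points where it fails
  is \<open>4\<^bsup>-k\<^esup> / 2\<^bsup>-k\<^esup>\<close>, up to a constant, and these costs are summable.
\<close>

lemma content_null_cone_avg_large:
  fixes h :: "nat \<Rightarrow> 'b::euclidean_space \<Rightarrow> real"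
  assumes h [measurable]: "\<And>k. h k \<in> borel_measurable borel" and h0: "\<And>k x. 0 \<le> h k x"
    and q: "1 \<le> q" and R: "0 < R" and s: "real DIM('b) - q < s" and c: "0 \<le> c"
    and small: "\<And>k. (\<integral>\<^sup>+w. ennreal (h k w powr q) \<partial>lborel) \<le> ennreal (c * (1 / 4) ^ k)"
  shows "content_null s {x. \<exists>\<^sub>F k in sequentially. \<not> cone_avg R (h k) x \<le> ennreal (1 / (real k + 1))}"
proof -
  let ?m = "real DIM('b)"
  define C where "C = (unit_ball_vol ?m + 1) * R powr ((s - ?m) / q + ?m) / ((s - ?m) / q + 1)"
  define S where "S k = {x. \<exists>r. 0 < r \<and> r \<le> R \<and>
     ennreal ((1 / 2) ^ k * r powr s) < (\<integral>\<^sup>+w\<in>ball x r. ennreal (h k w powr q) \<partial>lborel)}" for k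
  obtain K0 where K0: "\<And>k. k \<ge> K0 \<Longrightarrow> C * ((1 / 2) ^ k) powr (1 / q) \<le> 1 / (real k + 1)"
    using exponential_beats_linear[OF q, of C] unfolding eventually_sequentially by blast
  have bad: "x \<in> S k" if "k \<ge> K0" "\<not> cone_avg R (h k) x \<le> ennreal (1 / (real k + 1))" for x k
  proof (rule ccontr)
    assume "x \<notin> S k"
    then have "(\<integral>\<^sup>+w\<in>ball x r. ennreal (h k w powr q) \<partial>lborel) \<le> ennreal ((1 / 2) ^ k * r powr s)"
      if "0 < r" "r \<le> R" for r
      using that by (force simp: S_def)
    from cone_avg_le_of_power_growth[OF h h0 q _ R s this]
    have "cone_avg R (h k) x \<le> ennreal (C * ((1 / 2) ^ k) powr (1 / q))"
      by (simp add: C_def)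
    also have "\<dots> \<le> ennreal (1 / (real k + 1))" by (intro ennreal_leI K0 that)
    finally show False using that by simp
  qed
  show ?thesis
  proof (rule content_null_limsup[where S = S and N = 0 and c = "5 powr s * c"])
    fix K
    show "{x. \<exists>\<^sub>F k in sequentially. \<not> cone_avg R (h k) x \<le> ennreal (1 / (real k + 1))} \<subseteq> (\<Union>k\<in>{K..}. S k)"
    proof
      fix x assume "x \<in> {x. \<exists>\<^sub>F k in sequentially. \<not> cone_avg R (h k) x \<le> ennreal (1 / (real k + 1))}"
      then have "\<exists>k\<ge>max K K0. \<not> cone_avg R (h k) x \<le> ennreal (1 / (real k + 1))"
        by (simp only: mem_Collect_eq frequently_sequentially)
      then obtain k where k: "k \<ge> K" "k \<ge> K0" "\<not> cone_avg R (h k) x \<le> ennreal (1 / (real k + 1))"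
        by auto
      then show "x \<in> (\<Union>k\<in>{K..}. S k)" using bad[OF k(2,3)] by auto
    qed
  next
    fix k
    have "(\<integral>\<^sup>+w. ennreal (h k w powr q) \<partial>lborel) \<le> ennreal ((1 / 2) ^ k * (c * (1 / 2) ^ k))"
    proof -
      have eq: "(1 / 2) ^ k * (c * (1 / 2) ^ k) = c * (1 / 4 :: real) ^ k"
        by (simp add: mult.left_commute[of _ c] flip: power_mult_distrib)
      show ?thesis unfolding eq by (rule small)
    qed
    moreover have pw: "(\<lambda>w. ennreal (h k w powr q)) \<in> borel_measurable borel" by measurable
    ultimately have "\<exists>(a :: nat \<Rightarrow> 'b) \<rho>. (\<forall>j. 0 \<le> \<rho> j) \<and> S k \<subseteq> (\<Union>j. ball (a j) (5 * \<rho> j)) \<and>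
       (\<Sum>j. ennreal (\<rho> j powr s)) \<le> ennreal (c * (1 / 2) ^ k)"
      unfolding S_def by (intro power_growth_covering pw) simp_all
    then obtain a \<rho> where a: "\<And>j::nat. 0 \<le> \<rho> j" "S k \<subseteq> (\<Union>j. ball (a j) (5 * \<rho> j))"
       "(\<Sum>j. ennreal (\<rho> j powr s)) \<le> ennreal (c * (1 / 2) ^ k)"
      by blast
    have "(\<Sum>j. ennreal ((5 * \<rho> j) powr s)) = ennreal (5 powr s) * (\<Sum>j. ennreal (\<rho> j powr s))"
      using a(1) by (simp add: powr_mult ennreal_mult ennreal_suminf_cmult)
    also have "\<dots> \<le> ennreal (5 powr s) * ennreal (c * (1 / 2) ^ k)"
      by (intro mult_left_mono a) simp
    also have "\<dots> = ennreal (5 powr s * c * (1 / 2) ^ k)"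
      using c by (simp add: ennreal_mult[symmetric] mult.assoc)
    finally show "\<exists>a r. (\<forall>j::nat. 0 \<le> r j) \<and> S k \<subseteq> (\<Union>j. ball (a j) (r j)) \<and>
       (\<Sum>j. ennreal (r j powr s)) \<le> ennreal (5 powr s * c * (1 / 2) ^ k)"
      using a by (intro exI[of _ a] exI[of _ "\<lambda>j. 5 * \<rho> j"]) simp
  qed (use c in simp)
qed

section \<open>Null sets of Hausdorff measure\<close>

text \<open>
  This says that the premeasure at scale \<open>\<delta>\<close> vanishes, in a form that passes to countable unions.
\<close>

definition small_covers :: "'a set \<Rightarrow> ('a \<Rightarrow> 'a \<Rightarrow> real) \<Rightarrow> real \<Rightarrow> real \<Rightarrow> 'a set \<Rightarrow> bool" where
  "small_covers M d s \<delta> E \<longleftrightarrow> (\<forall>\<epsilon>>0. \<exists>S :: nat \<Rightarrow> 'a set. E \<subseteq> (\<Union>i. S i) \<and>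
     (\<forall>i. S i \<subseteq> M \<and> (\<forall>x\<in>S i. \<forall>y\<in>S i. d x y \<le> \<delta>)) \<and> (\<Sum>i. ennreal (diam d (S i) powr s)) \<le> ennreal \<epsilon>)"

lemma hausdorff_measure_0I:
  assumes "\<And>\<delta>. 0 < \<delta> \<Longrightarrow> small_covers M d s \<delta> E"
  shows "hausdorff_measure M d s E = 0"
proof -
  have "hausdorff_premeasure M d s \<delta> E \<le> 0" if \<delta>: "0 < \<delta>" for \<delta>
  proof (rule ennreal_le_epsilon)
    fix \<epsilon> :: real assume \<epsilon>: "0 < \<epsilon>"
    obtain S :: "nat \<Rightarrow> 'a set" where S: "E \<subseteq> (\<Union>i. S i)" "\<forall>i. S i \<subseteq> M \<and> (\<forall>x\<in>S i. \<forall>y\<in>S i. d x y \<le> \<delta>)"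
      "(\<Sum>i. ennreal (diam d (S i) powr s)) \<le> ennreal \<epsilon>"
      using assms[OF \<delta>, unfolded small_covers_def, rule_format, OF \<epsilon>] by blast
    have "hausdorff_premeasure M d s \<delta> E \<le> (\<Sum>i. ennreal (diam d (S i) powr s))"
      unfolding hausdorff_premeasure_def by (rule Inf_lower) (use S in blast)
    then show "hausdorff_premeasure M d s \<delta> E \<le> 0 + ennreal \<epsilon>" using S(3) by simp
  qed
  then show ?thesis unfolding hausdorff_measure_def by simp
qed

lemma small_covers_subset: "small_covers M d s \<delta> E \<Longrightarrow> E' \<subseteq> E \<Longrightarrow> small_covers M d s \<delta> E'"
  unfolding small_covers_def by (meson order_trans)

lemma small_covers_UN:
  assumes "\<And>n :: nat. small_covers M d s \<delta> (E n)"
  shows "small_covers M d s \<delta> (\<Union>n. E n)"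
  unfolding small_covers_def
proof (intro allI impI)
  fix \<epsilon> :: real assume \<epsilon>: "0 < \<epsilon>"
  have "\<exists>S :: nat \<Rightarrow> 'a set. E n \<subseteq> (\<Union>i. S i) \<and>
     (\<forall>i. S i \<subseteq> M \<and> (\<forall>x\<in>S i. \<forall>y\<in>S i. d x y \<le> \<delta>)) \<and> (\<Sum>i. ennreal (diam d (S i) powr s)) \<le> ennreal (\<epsilon> * (1 / 2) ^ Suc n)" for n
  proof -
    have "0 < \<epsilon> * (1 / 2) ^ Suc n" using \<epsilon> by simp
    then show ?thesis using assms[of n] unfolding small_covers_def by blast
  qed
  then obtain S :: "nat \<Rightarrow> nat \<Rightarrow> 'a set" where S: "\<And>n. E n \<subseteq> (\<Union>i. S n i)"
    "\<And>n i. S n i \<subseteq> M \<and> (\<forall>x\<in>S n i. \<forall>y\<in>S n i. d x y \<le> \<delta>)"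
    "\<And>n. (\<Sum>i. ennreal (diam d (S n i) powr s)) \<le> ennreal (\<epsilon> * (1 / 2) ^ Suc n)"
    by metis
  define T where "T j = (case prod_decode j of (n, i) \<Rightarrow> S n i)" for j
  have "(\<Union>n. E n) \<subseteq> (\<Union>j. T j)"
  proof
    fix x assume "x \<in> (\<Union>n. E n)"
    then obtain n i where "x \<in> S n i" using S(1) by blast
    then have "x \<in> T (prod_encode (n, i))" by (simp add: T_def)
    then show "x \<in> (\<Union>j. T j)" by blast
  qed
  moreover have "\<forall>j. T j \<subseteq> M \<and> (\<forall>x\<in>T j. \<forall>y\<in>T j. d x y \<le> \<delta>)"
    using S(2) by (simp add: T_def split: prod.split)
  moreover have "(\<Sum>j. ennreal (diam d (T j) powr s)) \<le> ennreal \<epsilon>"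
  proof -
    have "(\<Sum>j. ennreal (diam d (T j) powr s)) = (\<Sum>j. (\<lambda>(n, i). ennreal (diam d (S n i) powr s)) (prod_decode j))"
      by (simp add: T_def case_prod_unfold)
    also have "\<dots> = (\<Sum>n. \<Sum>i. ennreal (diam d (S n i) powr s))"
      by (rule suminf_ennreal_2dimen) simp
    also have "\<dots> \<le> (\<Sum>n. ennreal (\<epsilon> * (1 / 2) ^ Suc n))"
      by (intro suminf_le S summableI)
    also have "\<dots> = ennreal \<epsilon>"
      using sums_mult[OF power_half_series, of \<epsilon>] \<epsilon>
      by (intro suminf_ennreal_eq) auto
    finally show ?thesis .
  qed
  ultimately show "\<exists>S :: nat \<Rightarrow> 'a set. (\<Union>n. E n) \<subseteq> (\<Union>i. S i) \<and>
     (\<forall>i. S i \<subseteq> M \<and> (\<forall>x\<in>S i. \<forall>y\<in>S i. d x y \<le> \<delta>)) \<and> (\<Sum>i. ennreal (diam d (S i) powr s)) \<le> ennreal \<epsilon>"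
    by blast
qed

lemma small_covers_empty: "small_covers M d s \<delta> {}"
  unfolding small_covers_def
proof (intro allI impI)
  fix \<epsilon> :: real assume "0 < \<epsilon>"
  show "\<exists>S :: nat \<Rightarrow> 'a set. {} \<subseteq> (\<Union>i. S i) \<and>
     (\<forall>i. S i \<subseteq> M \<and> (\<forall>x\<in>S i. \<forall>y\<in>S i. d x y \<le> \<delta>)) \<and> (\<Sum>i. ennreal (diam d (S i) powr s)) \<le> ennreal \<epsilon>"
    by (rule exI[of _ "\<lambda>_. {}"]) (simp add: diam_def)
qed

lemma small_covers_finite_UN:
  assumes "finite F" "\<And>i. i \<in> F \<Longrightarrow> small_covers M d s \<delta> (E i)"
  shows "small_covers M d s \<delta> (\<Union>i\<in>F. E i)"
proof -
  obtain xs where xs: "set xs = F" using finite_list[OF assms(1)] by blast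
  define E' where "E' n = (if n < length xs then E (xs ! n) else {})" for n
  have "small_covers M d s \<delta> (\<Union>n. E' n)"
    by (rule small_covers_UN) (use assms(2) xs small_covers_empty in \<open>auto simp: E'_def\<close>)
  moreover have "(\<Union>i\<in>F. E i) \<subseteq> (\<Union>n. E' n)"
  proof
    fix x assume "x \<in> (\<Union>i\<in>F. E i)"
    then obtain n where "n < length xs" "x \<in> E (xs ! n)" using xs by (metis UN_E in_set_conv_nth)
    then have "x \<in> E' n" by (simp add: E'_def)
    then show "x \<in> (\<Union>n. E' n)" by blast
  qed
  ultimately show ?thesis by (rule small_covers_subset)
qed

lemma diam_bounds:
  assumes "\<And>x y. x \<in> S \<Longrightarrow> y \<in> S \<Longrightarrow> 0 \<le> d x y \<and> d x y \<le> B" "0 \<le> B"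
  shows "0 \<le> diam d S \<and> diam d S \<le> B"
proof (cases "S = {}")
  case True
  then show ?thesis using assms(2) by (simp add: diam_def)
next
  case False
  then obtain x where x: "x \<in> S" by blast
  have bdd: "bdd_above ((\<lambda>(x, y). d x y) ` (S \<times> S))"
    by (rule bdd_aboveI[of _ B]) (use assms in auto)
  have "d x x \<le> (SUP (x, y)\<in>S \<times> S. d x y)"
    by (rule cSUP_upper2[OF bdd, of "(x, x)"]) (use x in auto)
  moreover have "(SUP (x, y)\<in>S \<times> S. d x y) \<le> B"
    by (rule cSUP_least) (use False assms in auto)
  ultimately show ?thesis using assms(1)[OF x x] False by (simp add: diam_def)
qed

text \<open>
  The image of a ball of radius \<open>r\<close> has diameter at most \<open>2 L r\<close>. The covering sets are cut down to
  \<open>B\<close> first, because \<open>\<psi>\<close> is controlled only there.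
\<close>

lemma small_covers_lipschitz_image:
  fixes \<psi> :: "'b::euclidean_space \<Rightarrow> 'a"
  assumes X: "content_null s X" "X \<subseteq> B" and s: "0 < s" and \<delta>: "0 < \<delta>" and L: "0 < L"
    and \<psi>: "\<And>y. y \<in> B \<Longrightarrow> \<psi> y \<in> M"
    and lip: "\<And>y z. y \<in> B \<Longrightarrow> z \<in> B \<Longrightarrow> 0 \<le> d (\<psi> y) (\<psi> z) \<and> d (\<psi> y) (\<psi> z) \<le> L * dist y z"
  shows "small_covers M d s \<delta> (\<psi> ` X)"
  unfolding small_covers_def
proof (intro allI impI)
  fix \<epsilon> :: real assume \<epsilon>: "0 < \<epsilon>"
  \<comment> \<open>The first bound makes the covering sets small enough for the scale, the second one makes their sum small.\<close>
  define \<eta> where "\<eta> = min ((\<delta> / (2 * L)) powr s) (\<epsilon> / (2 * L) powr s)"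
  have \<eta>: "0 < \<eta>" "(2 * L) powr s * \<eta> \<le> \<epsilon>" "2 * L * \<eta> powr (1 / s) \<le> \<delta>"
  proof -
    show "0 < \<eta>" using \<delta> L \<epsilon> by (simp add: \<eta>_def)
    have "\<eta> \<le> \<epsilon> / (2 * L) powr s" by (simp add: \<eta>_def)
    then show "(2 * L) powr s * \<eta> \<le> \<epsilon>" using L by (simp add: field_simps)
    have "\<eta> powr (1 / s) \<le> ((\<delta> / (2 * L)) powr s) powr (1 / s)"
      using \<open>0 < \<eta>\<close> s by (intro powr_mono2) (auto simp: \<eta>_def)
    also have "\<dots> = \<delta> / (2 * L)" using s \<delta> L by (simp add: powr_powr)
    finally show "2 * L * \<eta> powr (1 / s) \<le> \<delta>" using L by (simp add: field_simps)
  qed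
  obtain a r where ar: "\<And>j::nat. 0 \<le> r j" "X \<subseteq> (\<Union>j. ball (a j) (r j))" "(\<Sum>j. ennreal (r j powr s)) \<le> ennreal \<eta>"
    using X(1)[unfolded content_null_def, rule_format, OF \<eta>(1)] by blast
  define S where "S j = \<psi> ` (ball (a j) (r j) \<inter> B)" for j
  have d: "0 \<le> d x y \<and> d x y \<le> 2 * L * r j" if xy: "x \<in> S j" "y \<in> S j" for x y j
  proof -
    obtain u v where uv: "u \<in> ball (a j) (r j)" "u \<in> B" "v \<in> ball (a j) (r j)" "v \<in> B" "x = \<psi> u" "y = \<psi> v"
      using xy by (auto simp: S_def)
    have "dist u v \<le> 2 * r j" using uv(1,3) dist_triangle3[of u v "a j"] by simp
    then have "L * dist u v \<le> 2 * L * r j" using L by (simp add: mult.commute mult_left_mono)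
    then show ?thesis using lip[OF uv(2,4)] uv by auto
  qed
  have r\<eta>: "2 * L * r j \<le> \<delta>" for j
  proof -
    have "r j \<le> \<eta> powr (1 / s)"
      by (rule radius_le_of_sum_powr_le) (use ar s \<eta> in auto)
    then have "2 * L * r j \<le> 2 * L * \<eta> powr (1 / s)" using L by simp
    then show ?thesis using \<eta>(3) by simp
  qed
  have "\<psi> ` X \<subseteq> (\<Union>j. S j)" using ar(2) X(2) unfolding S_def by blast
  moreover have "\<forall>i. S i \<subseteq> M \<and> (\<forall>x\<in>S i. \<forall>y\<in>S i. d x y \<le> \<delta>)"
  proof (intro allI conjI ballI)
    show "S i \<subseteq> M" for i using \<psi> by (auto simp: S_def)
    show "d x y \<le> \<delta>" if "x \<in> S i" "y \<in> S i" for i x y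
      using d[OF that] r\<eta>[of i] by simp
  qed
  moreover have "(\<Sum>j. ennreal (diam d (S j) powr s)) \<le> ennreal \<epsilon>"
  proof -
    have "(\<Sum>j. ennreal (diam d (S j) powr s)) \<le> (\<Sum>j. ennreal ((2 * L) powr s) * ennreal (r j powr s))"
    proof (intro suminf_le summableI)
      fix j
      have "0 \<le> diam d (S j) \<and> diam d (S j) \<le> 2 * L * r j"
        by (rule diam_bounds) (use d L ar(1)[of j] in auto)
      then have "diam d (S j) powr s \<le> (2 * L * r j) powr s" using s by (intro powr_mono2) auto
      also have "\<dots> = (2 * L) powr s * r j powr s" using L ar(1)[of j] by (simp add: powr_mult)
      finally show "ennreal (diam d (S j) powr s) \<le> ennreal ((2 * L) powr s) * ennreal (r j powr s)"
        by (simp add: ennreal_mult[symmetric] ennreal_leI)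
    qed
    also have "\<dots> = ennreal ((2 * L) powr s) * (\<Sum>j. ennreal (r j powr s))"
      by (rule ennreal_suminf_cmult)
    also have "\<dots> \<le> ennreal ((2 * L) powr s) * ennreal \<eta>"
      by (intro mult_left_mono ar) simp
    also have "\<dots> \<le> ennreal \<epsilon>"
      using \<eta> by (subst ennreal_mult[symmetric]) (auto intro: ennreal_leI)
    finally show ?thesis .
  qed
  ultimately show "\<exists>S :: nat \<Rightarrow> 'a set. \<psi> ` X \<subseteq> (\<Union>i. S i) \<and>
     (\<forall>i. S i \<subseteq> M \<and> (\<forall>x\<in>S i. \<forall>y\<in>S i. d x y \<le> \<delta>)) \<and> (\<Sum>i. ennreal (diam d (S i) powr s)) \<le> ennreal \<epsilon>"
    by blast
qed

lemma hausdorff_dim_le: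
  assumes "0 \<le> b" "\<And>s. b < s \<Longrightarrow> hausdorff_measure M d s E = 0"
  shows "hausdorff_dim M d E \<le> ereal b"
proof (rule ereal_le_epsilon2)
  fix e :: real assume e: "0 < e"
  have "hausdorff_dim M d E \<le> ereal (b + e)"
    unfolding hausdorff_dim_def using assms e by (intro INF_lower) auto
  then show "hausdorff_dim M d E \<le> ereal b + ereal e" by simp
qed

section \<open>Charts, tangent vectors and metrics in coordinates\<close>

lemma smooth_on_differentiable: "smooth_on S f \<Longrightarrow> x \<in> S \<Longrightarrow> f differentiable (at x)"
  unfolding smooth_on_def using Ck_on.simps(2) by blast

lemma smooth_on_continuous_deriv:
  "smooth_on S f \<Longrightarrow> continuous_on S (\<lambda>x. frechet_derivative f (at x) v)"
  unfolding smooth_on_def using Ck_on.simps by blast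

lemma smooth_on_continuous: "smooth_on S f \<Longrightarrow> continuous_on S f"
  unfolding smooth_on_def using Ck_on.simps(1) by blast

locale smooth_atlas =
  fixes M :: "'a::t2_space set" and A :: "('a, 'n::finite) chart set"
  assumes smooth_manifold: "smooth_manifold M A"
begin

lemma chart_openin: "c \<in> A \<Longrightarrow> openin (top_of_set M) (fst c)"
  and chart_image_open: "c \<in> A \<Longrightarrow> open (snd c ` fst c)"
  and chart_cover: "x \<in> M \<Longrightarrow> \<exists>c\<in>A. x \<in> fst c"
  and transition_smooth: "c \<in> A \<Longrightarrow> d \<in> A \<Longrightarrow> smooth_on (snd c ` (fst c \<inter> fst d)) (transition c d)"
  using smooth_manifold unfolding smooth_manifold_def by blast+

lemma chart_subset: "c \<in> A \<Longrightarrow> fst c \<subseteq> M"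
  using chart_openin openin_imp_subset by blast

lemma chart_homeomorphism:
  assumes "c \<in> A"
  shows "homeomorphism (fst c) (snd c ` fst c) (snd c) (chart_inv c)"
proof -
  obtain \<psi> where \<psi>: "homeomorphism (fst c) (snd c ` fst c) (snd c) \<psi>"
    using smooth_manifold assms unfolding smooth_manifold_def by blast
  have inj: "inj_on (snd c) (fst c)"
    using \<psi> unfolding homeomorphism_def by (intro inj_on_inverseI[of _ \<psi>]) auto
  have "chart_inv c y = \<psi> y" if "y \<in> snd c ` fst c" for y
  proof -
    obtain x where x: "x \<in> fst c" "y = snd c x" using \<open>y \<in> snd c ` fst c\<close> by blast
    then have "\<psi> y = x" using \<psi> unfolding homeomorphism_def by auto
    then show ?thesis using x inj by (simp add: chart_inv_def inv_into_f_f)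
  qed
  then show ?thesis
    by (intro homeomorphism_cong[OF \<psi>]) simp_all
qed

lemma chart_inv_left: "c \<in> A \<Longrightarrow> x \<in> fst c \<Longrightarrow> chart_inv c (snd c x) = x"
  and chart_inv_right: "c \<in> A \<Longrightarrow> y \<in> snd c ` fst c \<Longrightarrow> snd c (chart_inv c y) = y"
  and chart_inv_in: "c \<in> A \<Longrightarrow> y \<in> snd c ` fst c \<Longrightarrow> chart_inv c y \<in> fst c"
  and chart_continuous: "c \<in> A \<Longrightarrow> continuous_on (fst c) (snd c)"
  and chart_inv_continuous: "c \<in> A \<Longrightarrow> continuous_on (snd c ` fst c) (chart_inv c)"
  using chart_homeomorphism[of c] unfolding homeomorphism_def by auto

lemma chart_inv_in_M: "c \<in> A \<Longrightarrow> y \<in> snd c ` fst c \<Longrightarrow> chart_inv c y \<in> M"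
  using chart_inv_in chart_subset by blast

lemma chart_image_openin:
  assumes "c \<in> A" "openin (top_of_set M) W"
  shows "open (snd c ` (W \<inter> fst c))"
proof -
  have "openin (top_of_set (fst c)) (W \<inter> fst c)"
  proof -
    obtain T where T: "open T" "W = M \<inter> T" using assms(2) by (auto simp: openin_open)
    then have "W \<inter> fst c = fst c \<inter> T" using chart_subset[OF assms(1)] by blast
    then show ?thesis using T(1) by (auto simp: openin_open)
  qed
  then have "openin (top_of_set (snd c ` fst c)) (snd c ` (W \<inter> fst c))"
    using homeomorphism_imp_open_map[OF chart_homeomorphism[OF assms(1)]] by blast
  then show ?thesis
    using chart_image_open[OF assms(1)] openin_open_eq by blast
qed

lemma chart_inv_image_openin:
  assumes "c \<in> A" "open Y" "Y \<subseteq> snd c ` fst c"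
  shows "openin (top_of_set M) (chart_inv c ` Y)"
proof -
  have "openin (top_of_set (snd c ` fst c)) Y"
    using assms by (simp add: open_subset)
  then have "openin (top_of_set (fst c)) (chart_inv c ` Y)"
    using homeomorphism_imp_open_map chart_homeomorphism[OF assms(1)] homeomorphism_symD by blast
  then show ?thesis
    using chart_openin[OF assms(1)] openin_trans by blast
qed

lemma overlap_open: "c \<in> A \<Longrightarrow> d \<in> A \<Longrightarrow> open (snd c ` (fst c \<inter> fst d))"
  using chart_image_openin[of c "fst d"] chart_openin[of d] by (simp add: Int_commute)

lemma transition_at: "c \<in> A \<Longrightarrow> x \<in> fst c \<Longrightarrow> transition c d (snd c x) = snd d x"
  by (simp add: transition_def chart_inv_left)

lemma transition_has_derivative:
  assumes "c \<in> A" "d \<in> A" "x \<in> fst c" "x \<in> fst d"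
  shows "(transition c d has_derivative transition_deriv c d x) (at (snd c x))"
  unfolding transition_deriv_def
  using smooth_on_differentiable[OF transition_smooth[OF assms(1,2)], of "snd c x"] assms
  by (simp add: frechet_derivative_works)

lemma transition_deriv_linear:
  assumes "c \<in> A" "d \<in> A" "x \<in> fst c" "x \<in> fst d"
  shows "linear (transition_deriv c d x)"
  using transition_has_derivative[OF assms] has_derivative_linear by blast

lemma transition_deriv_self:
  assumes "c \<in> A" "x \<in> fst c"
  shows "transition_deriv c c x u = u"
proof -
  have "((\<lambda>y. y) has_derivative (\<lambda>y. y)) (at (snd c x))" by (rule has_derivative_ident)
  then have "(transition c c has_derivative (\<lambda>y. y)) (at (snd c x))"
    by (rule has_derivative_transform_within_open[OF _ chart_image_open[OF assms(1)]])
       (use assms in \<open>auto simp: transition_at\<close>)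
  from has_derivative_unique[OF this transition_has_derivative[OF assms(1,1,2,2)]]
  show ?thesis by metis
qed

lemma transition_deriv_compose:
  assumes A: "c \<in> A" "d \<in> A" "e \<in> A" and x: "x \<in> fst c" "x \<in> fst d" "x \<in> fst e"
  shows "transition_deriv d e x (transition_deriv c d x u) = transition_deriv c e x u"
proof -
  have "((transition d e \<circ> transition c d) has_derivative (transition_deriv d e x \<circ> transition_deriv c d x)) (at (snd c x))"
    using transition_has_derivative[OF A(1,2) x(1,2)] transition_has_derivative[OF A(2,3) x(2,3)]
    by (intro diff_chain_at) (simp_all add: transition_at A x)
  then have "(transition c e has_derivative (transition_deriv d e x \<circ> transition_deriv c d x)) (at (snd c x))"
    by (rule has_derivative_transform_within_open[OF _ overlap_open[OF A(1,2)]])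
       (use A x in \<open>auto simp: transition_at\<close>)
  from has_derivative_unique[OF this transition_has_derivative[OF A(1,3) x(1,3)]]
  show ?thesis by (metis comp_apply)
qed

lemma coord_vec_nth:
  assumes "c \<in> A" "d \<in> A" "x \<in> fst c" "x \<in> fst d"
  shows "coord_vec A c x u d = transition_deriv c d x u"
  using assms by (simp add: coord_vec_def)

lemma coord_vec_self: "c \<in> A \<Longrightarrow> x \<in> fst c \<Longrightarrow> coord_vec A c x u c = u"
  by (simp add: coord_vec_def transition_deriv_self)

lemma coord_vec_tangent:
  assumes "c \<in> A" "x \<in> fst c"
  shows "coord_vec A c x u \<in> tangent_space A x"
  using assms by (auto simp: tangent_space_def coord_vec_def transition_deriv_compose)

lemma tangent_eq_coord_vec:
  assumes "c \<in> A" "x \<in> fst c" "v \<in> tangent_space A x"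
  shows "v = coord_vec A c x (v c)"
proof (rule ext)
  fix d
  show "v d = coord_vec A c x (v c) d"
  proof (cases "d \<in> A \<and> x \<in> fst d")
    case True
    then have "v d = transition_deriv c d x (v c)"
      using assms unfolding tangent_space_def by blast
    then show ?thesis using True unfolding coord_vec_def by presburger
  next
    case False
    then have "v d = 0" using assms unfolding tangent_space_def by blast
    then show ?thesis using False unfolding coord_vec_def by presburger
  qed
qed

lemma coord_vec_add_scale:
  assumes "c \<in> A" "x \<in> fst c"
  shows "coord_vec A c x (a *\<^sub>R u + b *\<^sub>R v) = (\<lambda>d. a *\<^sub>R coord_vec A c x u d + b *\<^sub>R coord_vec A c x v d)"
  using assms transition_deriv_linear[OF assms(1) _ assms(2)]
  by (auto simp: coord_vec_def fun_eq_iff linear_add linear_scale)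

definition form :: "('a, 'n) tensor2 \<Rightarrow> ('a, 'n) chart \<Rightarrow> 'a \<Rightarrow> real^'n \<Rightarrow> real^'n \<Rightarrow> real" where
  "form h c x u v = h x (coord_vec A c x u) (coord_vec A c x v)"

lemma metric_bilinear:
  assumes g: "metric_tensor M A g" and c: "c \<in> A" "x \<in> fst c"
  shows "bilinear (form g c x)"
proof -
  have x: "x \<in> M" using c chart_subset by blast
  note T = coord_vec_tangent[OF c]
  have sym: "form g c x u v = form g c x v u" for u v
    using g x T unfolding metric_tensor_def form_def by blast
  have lin: "form g c x (a *\<^sub>R u + b *\<^sub>R v) w = a * form g c x u w + b * form g c x v w" for a b u v w
    using g x T unfolding metric_tensor_def form_def coord_vec_add_scale[OF c] by blast
  have l: "linear (\<lambda>u. form g c x u w)" for w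
    by (rule linearI) (use lin[of 1 _ 1] lin[of _ _ 0 0] in auto)
  have "linear (form g c x w)" for w
  proof -
    have "form g c x w = (\<lambda>u. form g c x u w)" by (rule ext, rule sym)
    then show ?thesis by (simp only: l)
  qed
  then show ?thesis unfolding bilinear_def by (intro conjI allI l)
qed

lemma bilinear_matrix:
  fixes f :: "real^'k \<Rightarrow> real^'k \<Rightarrow> real"
  assumes "bilinear f"
  shows "f u v = u \<bullet> ((\<chi> i j. f (axis i 1) (axis j 1)) *v v)"
proof -
  have "f u v = f (\<Sum>i\<in>UNIV. u $ i *\<^sub>R axis i 1) (\<Sum>j\<in>UNIV. v $ j *\<^sub>R axis j 1)"
    by (metis basis_expansion scalar_mult_eq_scaleR)
  also have "\<dots> = (\<Sum>i\<in>UNIV. \<Sum>j\<in>UNIV. u $ i * (v $ j * f (axis i 1) (axis j 1)))"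
    by (subst bilinear_sum[OF assms])
       (simp add: sum.cartesian_product bilinear_lmul[OF assms] bilinear_rmul[OF assms] mult.left_commute)
  finally show ?thesis
    by (simp add: inner_vec_def matrix_vector_mult_def sum_distrib_left mult_ac)
qed

lemma metric_coord:
  assumes "metric_tensor M A g" "c \<in> A" "x \<in> fst c"
  shows "g x (coord_vec A c x u) (coord_vec A c x v) = u \<bullet> (tensor_matrix A g c x *v v)"
  using bilinear_matrix[OF metric_bilinear[OF assms], of u v] by (simp add: form_def tensor_matrix_def)

lemma metric_tangent:
  assumes "metric_tensor M A g" "c \<in> A" "x \<in> fst c" "u \<in> tangent_space A x" "v \<in> tangent_space A x"
  shows "g x u v = u c \<bullet> (tensor_matrix A g c x *v v c)"
  using metric_coord[OF assms(1-3), of "u c" "v c"]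
    tangent_eq_coord_vec[OF assms(2,3,4)] tangent_eq_coord_vec[OF assms(2,3,5)]
  by simp

text \<open>
  A component vector other than 0 gives a tangent vector other than 0, since its component in the chart
  \<open>c\<close> itself is the given vector.
\<close>

lemma metric_pos_def:
  assumes g: "metric_tensor M A g" and c: "c \<in> A" "x \<in> fst c"
  shows "pos_def (tensor_matrix A g c x)"
proof -
  have x: "x \<in> M" using c chart_subset by blast
  note T = coord_vec_tangent[OF c]
  have sym: "g x (coord_vec A c x u) (coord_vec A c x v) = g x (coord_vec A c x v) (coord_vec A c x u)" for u v
    using g x T unfolding metric_tensor_def by blast
  have pos: "0 < u \<bullet> (tensor_matrix A g c x *v u)" if "u \<noteq> 0" for u
  proof -
    have "coord_vec A c x u \<noteq> (\<lambda>d. 0)"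
      using coord_vec_self[OF c, of u] that by auto
    then have "0 < g x (coord_vec A c x u) (coord_vec A c x u)"
      using g x T unfolding metric_tensor_def by blast
    then show ?thesis by (simp add: metric_coord[OF g c])
  qed
  have "tensor_matrix A g c x $ i $ j = tensor_matrix A g c x $ j $ i" for i j
    unfolding tensor_matrix_def vec_lambda_beta by (rule sym)
  then have "transpose (tensor_matrix A g c x) = tensor_matrix A g c x"
    unfolding vec_eq_iff transpose_def vec_lambda_beta by blast
  with pos show ?thesis unfolding pos_def_def by blast
qed

lemma tensor_matrix_change:
  assumes g: "metric_tensor M A g" and A: "c \<in> A" "d \<in> A" and x: "x \<in> fst c" "x \<in> fst d"
  shows "tensor_matrix A g c x =
    transpose (matrix (transition_deriv c d x)) ** tensor_matrix A g d x ** matrix (transition_deriv c d x)"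
proof -
  have 1: "coord_vec A c x u = coord_vec A d x (transition_deriv c d x u)" for u
    using tangent_eq_coord_vec[OF A(2) x(2) coord_vec_tangent[OF A(1) x(1)]] coord_vec_nth[OF A x] by metis
  have "tensor_matrix A g c x $ i $ j = 
     transition_deriv c d x (axis i 1) \<bullet> (tensor_matrix A g d x *v transition_deriv c d x (axis j 1))" for i j
    unfolding tensor_matrix_def[of A g c x] vec_lambda_beta
    by (subst (1 2) 1) (rule metric_coord[OF g A(2) x(2)])
  then show ?thesis
    by (simp add: vec_eq_iff matrix_congruence_nth column_def matrix_def)
qed

lemma det_tensor_matrix_change:
  assumes g: "metric_tensor M A g" and A: "c \<in> A" "d \<in> A" and x: "x \<in> fst c" "x \<in> fst d"
  shows "sqrt (det (tensor_matrix A g c x)) =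
    \<bar>det (matrix (transition_deriv c d x))\<bar> * sqrt (det (tensor_matrix A g d x))"
  by (simp add: tensor_matrix_change[OF assms] det_mul real_sqrt_mult)

text \<open>
  The frame that the tensor norm chooses is unknown. Its components in a chart are the columns of a matrix
  \<open>E\<close> that brings the Gram matrix to the identity, and for the norm nothing else about the frame matters.
\<close>

lemma tensor_norm_frame:
  assumes g: "metric_tensor M A g" and c: "c \<in> A" "x \<in> fst c"
    and h: "bilinear (form h c x)"
  obtains E :: "real^'n^'n" where "transpose E ** tensor_matrix A g c x ** E = mat 1"
    "tensor_norm A g h x = sqrt (\<Sum>i\<in>UNIV. \<Sum>j\<in>UNIV. (column i E \<bullet> (tensor_matrix A h c x *v column j E))\<^sup>2)"
proof -
  define ee where "ee = (SOME e. orthonormal_frame A g x e)"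
  obtain E0 :: "real^'n^'n" where E0: "transpose E0 ** tensor_matrix A g c x ** E0 = mat 1"
    using pos_def_orthonormal[OF metric_pos_def[OF g c]] by blast
  have "orthonormal_frame A g x (\<lambda>i. coord_vec A c x (column i E0))"
    unfolding orthonormal_frame_def
    by (simp add: coord_vec_tangent[OF c] metric_coord[OF g c] matrix_congruence_nth[symmetric] E0 mat_def)
  then have e: "orthonormal_frame A g x ee" unfolding ee_def by (rule someI[of "orthonormal_frame A g x"])
  define E :: "real^'n^'n" where "E = (\<chi> a i. ee i c $ a)"
  have col: "column i E = ee i c" for i by (simp add: E_def column_def vec_eq_iff)
  have T: "ee i \<in> tangent_space A x" for i using e by (simp add: orthonormal_frame_def)
  have "transpose E ** tensor_matrix A g c x ** E = mat 1"
  proof -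
    have "(transpose E ** tensor_matrix A g c x ** E) $ i $ j = mat 1 $ i $ j" for i j
      unfolding matrix_congruence_nth col metric_tangent[OF g c T T, symmetric]
      using e by (simp add: orthonormal_frame_def mat_def)
    then show ?thesis by (simp add: vec_eq_iff)
  qed
  moreover have "h x (ee i) (ee j) = column i E \<bullet> (tensor_matrix A h c x *v column j E)" for i j
  proof -
    have "h x (ee i) (ee j) = form h c x (ee i c) (ee j c)"
      unfolding form_def using tangent_eq_coord_vec[OF c T] by metis
    also have "\<dots> = column i E \<bullet> (tensor_matrix A h c x *v column j E)"
      unfolding col by (subst bilinear_matrix[OF h]) (simp add: form_def tensor_matrix_def)
    finally show ?thesis .
  qed
  ultimately show ?thesis
    by (intro that[of E]) (simp_all add: tensor_norm_def Let_def ee_def)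
qed

end

section \<open>Continuously differentiable pieces of curves\<close>

lemma transform_vector_derivative_within:
  assumes "(f has_vector_derivative f') (at t within S)" "t \<in> S"
    "openin (top_of_set S) T" "t \<in> T" "\<And>s. s \<in> T \<Longrightarrow> f s = g s"
  shows "(g has_vector_derivative f') (at t within S)"
proof -
  obtain e where e: "e > 0" "ball t e \<inter> S \<subseteq> T"
    using assms(3,4) by (metis openin_contains_ball)
  show ?thesis
    by (rule has_vector_derivative_transform_within[OF assms(1) e(1) assms(2)])
       (use e assms in \<open>auto simp: dist_commute subset_iff\<close>)
qed

lemma vector_derivative_within_Icc:
  fixes a b :: real
  assumes "a < b" "t \<in> {a..b}" "(f has_vector_derivative D) (at t within {a..b})"
  shows "vector_derivative f (at t within {a..b}) = D"
  using vector_derivative_within_cbox[of a b t f D] assms by simp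

context smooth_atlas
begin

definition C1_piece :: "real \<Rightarrow> real \<Rightarrow> (real \<Rightarrow> 'a) \<Rightarrow> bool" where
  "C1_piece a b \<gamma> \<longleftrightarrow> a < b \<and> continuous_on {a..b} \<gamma> \<and> \<gamma> ` {a..b} \<subseteq> M \<and> C1_curve_on A a b \<gamma>"

text \<open>
  At the end points the derivative is one-sided, so that this velocity is continuous on the closed
  interval. It differs from \<open>velocity\<close> at most at the end points, which does not affect lengths.
\<close>

definition vel_on :: "real \<Rightarrow> real \<Rightarrow> (real \<Rightarrow> 'a) \<Rightarrow> real \<Rightarrow> ('a, 'n) tvec" where
  "vel_on a b \<gamma> t = (\<lambda>c. if c \<in> A \<and> \<gamma> t \<in> fst c then vector_derivative (snd c \<circ> \<gamma>) (at t within {a..b}) else 0)"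

definition speed :: "('a, 'n) tensor2 \<Rightarrow> (real \<Rightarrow> 'a) \<Rightarrow> real \<Rightarrow> real" where
  "speed g \<gamma> t = sqrt (g (\<gamma> t) (velocity A \<gamma> t) (velocity A \<gamma> t))"

definition speed_on :: "('a, 'n) tensor2 \<Rightarrow> real \<Rightarrow> real \<Rightarrow> (real \<Rightarrow> 'a) \<Rightarrow> real \<Rightarrow> real" where
  "speed_on g a b \<gamma> t = sqrt (g (\<gamma> t) (vel_on a b \<gamma> t) (vel_on a b \<gamma> t))"

lemma C1_piece_derivative:
  assumes "C1_piece a b \<gamma>" "c \<in> A"
  shows "continuous_on {t\<in>{a..b}. \<gamma> t \<in> fst c} (\<lambda>t. vel_on a b \<gamma> t c)"
    and "\<And>t. t \<in> {a..b} \<Longrightarrow> \<gamma> t \<in> fst c \<Longrightarrow> ((snd c \<circ> \<gamma>) has_vector_derivative vel_on a b \<gamma> t c) (at t within {a..b})"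
proof -
  obtain D where D: "continuous_on {t\<in>{a..b}. \<gamma> t \<in> fst c} D"
    "\<And>t. t \<in> {a..b} \<Longrightarrow> \<gamma> t \<in> fst c \<Longrightarrow> ((snd c \<circ> \<gamma>) has_vector_derivative D t) (at t within {a..b})"
    using assms unfolding C1_piece_def C1_curve_on_def by blast
  have eq: "vel_on a b \<gamma> t c = D t" if "t \<in> {a..b}" "\<gamma> t \<in> fst c" for t
    using vector_derivative_within_Icc[OF _ _ D(2)[OF that]] assms that
    by (simp add: vel_on_def C1_piece_def)
  show "continuous_on {t\<in>{a..b}. \<gamma> t \<in> fst c} (\<lambda>t. vel_on a b \<gamma> t c)"
    by (rule continuous_on_eq[OF D(1)]) (simp add: eq)
  show "((snd c \<circ> \<gamma>) has_vector_derivative vel_on a b \<gamma> t c) (at t within {a..b})"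
    if "t \<in> {a..b}" "\<gamma> t \<in> fst c" for t
    using D(2)[OF that] eq[OF that] by simp
qed

lemma curve_in_chart_openin:
  assumes "C1_piece a b \<gamma>" "c \<in> A"
  shows "openin (top_of_set {a..b}) {t\<in>{a..b}. \<gamma> t \<in> fst c}"
proof -
  have "openin (top_of_set {a..b}) ({a..b} \<inter> \<gamma> -` fst c)"
    using assms chart_openin[OF assms(2)] unfolding C1_piece_def
    by (metis continuous_openin_preimage_gen continuous_openin_preimage image_subset_iff_funcset)
  moreover have "{a..b} \<inter> \<gamma> -` fst c = {t\<in>{a..b}. \<gamma> t \<in> fst c}" by auto
  ultimately show ?thesis by simp
qed

text \<open>
  The chain rule for the transition map relates the components in two charts.
\<close>

lemma vel_on_tangent:
  assumes p: "C1_piece a b \<gamma>" and t: "t \<in> {a..b}"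
  shows "vel_on a b \<gamma> t \<in> tangent_space A (\<gamma> t)"
proof -
  have "vel_on a b \<gamma> t d = transition_deriv c d (\<gamma> t) (vel_on a b \<gamma> t c)"
    if "c \<in> A" "d \<in> A" "\<gamma> t \<in> fst c" "\<gamma> t \<in> fst d" for c d
  proof -
    have "((transition c d \<circ> (snd c \<circ> \<gamma>)) has_vector_derivative transition_deriv c d (\<gamma> t) (vel_on a b \<gamma> t c)) (at t within {a..b})"
    proof (rule vector_derivative_diff_chain_within[OF C1_piece_derivative(2)[OF p that(1) t that(3)]])
      show "(transition c d has_derivative transition_deriv c d (\<gamma> t)) (at ((snd c \<circ> \<gamma>) t) within (snd c \<circ> \<gamma>) ` {a..b})"
        unfolding comp_apply by (rule has_derivative_at_withinI[OF transition_has_derivative[OF that]])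
    qed
    then have "((snd d \<circ> \<gamma>) has_vector_derivative transition_deriv c d (\<gamma> t) (vel_on a b \<gamma> t c)) (at t within {a..b})"
      by (rule transform_vector_derivative_within[OF _ t curve_in_chart_openin[OF p that(1)]])
         (use that t transition_at in auto)
    then show ?thesis
      using vector_derivative_within_Icc[of a b t "snd d \<circ> \<gamma>"] p t that
      by (simp add: vel_on_def C1_piece_def)
  qed
  moreover have "vel_on a b \<gamma> t c = 0" if "c \<notin> A \<or> \<gamma> t \<notin> fst c" for c
    using that by (auto simp: vel_on_def)
  ultimately show ?thesis
    unfolding tangent_space_def by blast
qed

lemma speed_on_coord:
  assumes g: "continuous_metric M A g" and p: "C1_piece a b \<gamma>" and t: "t \<in> {a..b}" and c: "c \<in> A" "\<gamma> t \<in> fst c"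
  shows "speed_on g a b \<gamma> t = sqrt (vel_on a b \<gamma> t c \<bullet> (tensor_matrix A g c (\<gamma> t) *v vel_on a b \<gamma> t c))"
  using metric_tangent[OF _ c vel_on_tangent[OF p t] vel_on_tangent[OF p t], of g] g
  by (simp add: speed_on_def continuous_metric_def)

lemma metric_nonneg:
  assumes "continuous_metric M A g" "x \<in> M" "v \<in> tangent_space A x"
  shows "0 \<le> g x v v"
proof -
  obtain c where c: "c \<in> A" "x \<in> fst c" using chart_cover assms by blast
  have g: "metric_tensor M A g" using assms by (simp add: continuous_metric_def)
  show ?thesis
    using metric_tangent[OF g c assms(3,3)] metric_pos_def[OF g c]
    by (cases "v c = 0") (auto simp: pos_def_def less_imp_le)
qed

text \<open>
  Continuity is local, and on the relatively open set of times spent in one chart the speed is a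
  continuous expression in the components.
\<close>

lemma continuous_speed_on:
  assumes g: "continuous_metric M A g" and p: "C1_piece a b \<gamma>"
  shows "continuous_on {a..b} (speed_on g a b \<gamma>)"
  unfolding continuous_on_eq_continuous_within
proof
  fix t assume t: "t \<in> {a..b}"
  then have "\<gamma> t \<in> M" using p by (auto simp: C1_piece_def)
  then obtain c where c: "c \<in> A" "\<gamma> t \<in> fst c" using chart_cover by blast
  let ?T = "{t\<in>{a..b}. \<gamma> t \<in> fst c}"
  have \<gamma>: "continuous_on ?T \<gamma>"
    by (rule continuous_on_subset[of "{a..b}"]) (use p in \<open>auto simp: C1_piece_def\<close>)
  have "continuous_on (fst c) (tensor_matrix A g c)" using g c by (simp add: continuous_metric_def)
  then have G: "continuous_on ?T (\<lambda>t. tensor_matrix A g c (\<gamma> t))"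
    by (rule continuous_on_compose2[OF _ \<gamma>]) auto
  note D = C1_piece_derivative(1)[OF p c(1)]
  have "continuous_on ?T (\<lambda>t. sqrt (vel_on a b \<gamma> t c \<bullet> (tensor_matrix A g c (\<gamma> t) *v vel_on a b \<gamma> t c)))"
    unfolding inner_vec_def matrix_vector_mult_def vec_lambda_beta
    by (intro continuous_intros G D)
  then have "continuous_on ?T (speed_on g a b \<gamma>)"
    by (rule continuous_on_eq) (use speed_on_coord[OF g p _ c(1)] in auto)
  then have "continuous (at t within ?T) (speed_on g a b \<gamma>)"
    using t c by (simp add: continuous_on_eq_continuous_within)
  moreover obtain O' where O': "open O'" "?T = {a..b} \<inter> O'"
    using curve_in_chart_openin[OF p c(1)] by (auto simp: openin_open)
  have "at t within ?T = at t within {a..b}"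
    by (rule at_within_nhd[of _ O']) (use O' t c in auto)
  ultimately show "continuous (at t within {a..b}) (speed_on g a b \<gamma>)" by simp
qed

lemma speed_eq_speed_on:
  assumes "a < t" "t < b"
  shows "velocity A \<gamma> t = vel_on a b \<gamma> t" "speed g \<gamma> t = speed_on g a b \<gamma> t"
proof -
  show "velocity A \<gamma> t = vel_on a b \<gamma> t"
    using assms by (simp add: velocity_def vel_on_def at_within_Icc_at fun_eq_iff)
  then show "speed g \<gamma> t = speed_on g a b \<gamma> t" by (simp add: speed_def speed_on_def)
qed

lemma speed_has_integral:
  assumes g: "continuous_metric M A g" and p: "C1_piece a b \<gamma>"
  shows "(speed g \<gamma> has_integral integral {a..b} (speed_on g a b \<gamma>)) {a..b}"
proof -
  have "(speed_on g a b \<gamma> has_integral integral {a..b} (speed_on g a b \<gamma>)) {a..b}"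
    by (intro integrable_integral integrable_continuous_interval continuous_speed_on g p)
  moreover have "(speed g \<gamma> has_integral y) (cbox a b) \<longleftrightarrow> (speed_on g a b \<gamma> has_integral y) (cbox a b)" for y
    by (rule has_integral_spike_interior_eq) (simp add: speed_eq_speed_on(2)[of a _ b])
  ultimately show ?thesis by simp
qed

lemma speed_on_nonneg:
  assumes "continuous_metric M A g" "C1_piece a b \<gamma>" "t \<in> {a..b}"
  shows "0 \<le> speed_on g a b \<gamma> t"
  unfolding speed_on_def
  by (intro real_sqrt_ge_zero metric_nonneg[OF assms(1)] vel_on_tangent[OF assms(2,3)])
     (use assms in \<open>auto simp: C1_piece_def\<close>)

lemma C1_piece_subinterval:
  assumes p: "C1_piece a b \<gamma>" and "a \<le> a'" "a' < b'" "b' \<le> b"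
  shows "C1_piece a' b' \<gamma>"
proof -
  have sub: "{a'..b'} \<subseteq> {a..b}" using assms by auto
  have "\<exists>D. continuous_on {t\<in>{a'..b'}. \<gamma> t \<in> fst c} D \<and>
        (\<forall>t\<in>{a'..b'}. \<gamma> t \<in> fst c \<longrightarrow> ((snd c \<circ> \<gamma>) has_vector_derivative D t) (at t within {a'..b'}))"
    if "c \<in> A" for c
  proof (intro exI[of _ "\<lambda>t. vel_on a b \<gamma> t c"] conjI ballI impI)
    show "continuous_on {t\<in>{a'..b'}. \<gamma> t \<in> fst c} (\<lambda>t. vel_on a b \<gamma> t c)"
      by (rule continuous_on_subset[OF C1_piece_derivative(1)[OF p that]]) (use sub in auto)
    fix t assume "t \<in> {a'..b'}" "\<gamma> t \<in> fst c"
    then show "((snd c \<circ> \<gamma>) has_vector_derivative vel_on a b \<gamma> t c) (at t within {a'..b'})"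
      using C1_piece_derivative(2)[OF p that] sub
      by (intro has_vector_derivative_within_subset[OF _ sub]) auto
  qed
  then have "C1_curve_on A a' b' \<gamma>" by (simp add: C1_curve_on_def)
  then show ?thesis
    using p assms sub unfolding C1_piece_def by (auto intro: continuous_on_subset)
qed

lemma C1_piece_affine:
  assumes p: "C1_piece a b \<gamma>" and k: "0 < k" and ab: "a = k * a' + l" "b = k * b' + l"
    and eq: "\<And>t. t \<in> {a'..b'} \<Longrightarrow> \<gamma>' t = \<gamma> (k * t + l)"
  shows "C1_piece a' b' \<gamma>'"
    and "t \<in> {a'..b'} \<Longrightarrow> vel_on a' b' \<gamma>' t = (\<lambda>c. k *\<^sub>R vel_on a b \<gamma> (k * t + l) c)"
proof -
  have lt: "a' < b'" using p k ab by (simp add: C1_piece_def)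
  have in_ab: "k * t + l \<in> {a..b}" if "t \<in> {a'..b'}" for t
    using that k ab by auto
  have img: "(\<lambda>t. k * t + l) ` {a'..b'} \<subseteq> {a..b}" using in_ab by blast
  have D: "((snd c \<circ> \<gamma>') has_vector_derivative k *\<^sub>R vel_on a b \<gamma> (k * t + l) c) (at t within {a'..b'})"
    if t: "t \<in> {a'..b'}" and c: "c \<in> A" "\<gamma>' t \<in> fst c" for t c
  proof -
    have "((\<lambda>t. k * t + l) has_vector_derivative k) (at t within {a'..b'})"
      by (auto intro!: derivative_eq_intros)
    moreover have "((snd c \<circ> \<gamma>) has_vector_derivative vel_on a b \<gamma> (k * t + l) c) (at (k * t + l) within (\<lambda>t. k * t + l) ` {a'..b'})"
      using C1_piece_derivative(2)[OF p c(1) in_ab[OF t]] c eq[OF t] img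
      by (auto intro: has_vector_derivative_within_subset)
    ultimately have "((snd c \<circ> \<gamma> \<circ> (\<lambda>t. k * t + l)) has_vector_derivative k *\<^sub>R vel_on a b \<gamma> (k * t + l) c) (at t within {a'..b'})"
      by (rule vector_diff_chain_within)
    then show ?thesis
      by (rule has_vector_derivative_transform[OF t, rotated]) (simp add: eq)
  qed
  have cont: "continuous_on {t\<in>{a'..b'}. \<gamma>' t \<in> fst c} (\<lambda>t. k *\<^sub>R vel_on a b \<gamma> (k * t + l) c)" if "c \<in> A" for c
    by (intro continuous_intros continuous_on_compose2[OF C1_piece_derivative(1)[OF p that]])
       (use in_ab eq in auto)
  have "continuous_on {a'..b'} (\<lambda>t. \<gamma> (k * t + l))"
    by (rule continuous_on_compose2[of "{a..b}" \<gamma>]) (use p img in \<open>auto simp: C1_piece_def intro!: continuous_intros\<close>)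
  then have "continuous_on {a'..b'} \<gamma>'" by (rule continuous_on_eq) (simp add: eq)
  moreover have "\<gamma>' ` {a'..b'} \<subseteq> M" using p in_ab by (auto simp: C1_piece_def eq image_subset_iff)
  moreover have "C1_curve_on A a' b' \<gamma>'"
    using D cont unfolding C1_curve_on_def by blast
  ultimately show p': "C1_piece a' b' \<gamma>'" using lt by (simp add: C1_piece_def)
  show "vel_on a' b' \<gamma>' t = (\<lambda>c. k *\<^sub>R vel_on a b \<gamma> (k * t + l) c)" if t: "t \<in> {a'..b'}"
  proof
    fix c
    show "vel_on a' b' \<gamma>' t c = k *\<^sub>R vel_on a b \<gamma> (k * t + l) c"
    proof (cases "c \<in> A \<and> \<gamma>' t \<in> fst c")
      case True
      then show ?thesis
        using vector_derivative_within_Icc[OF lt t D[OF t]] by (simp add: vel_on_def)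
    next
      case False
      then show ?thesis using eq[OF t] by (auto simp: vel_on_def)
    qed
  qed
qed

lemma metric_scale:
  assumes g: "metric_tensor M A g" and x: "x \<in> M" "v \<in> tangent_space A x"
  shows "g x (\<lambda>c. k *\<^sub>R v c) (\<lambda>c. k *\<^sub>R v c) = k\<^sup>2 * g x v v"
proof -
  obtain c where c: "c \<in> A" "x \<in> fst c" using chart_cover x by blast
  have v: "v = coord_vec A c x (v c)" by (rule tangent_eq_coord_vec[OF c x(2)])
  have kv: "(\<lambda>d. k *\<^sub>R v d) = coord_vec A c x (k *\<^sub>R v c)"
    using coord_vec_add_scale[OF c, of k "v c" 0 0] v by (simp add: fun_eq_iff)
  then have "(\<lambda>d. k *\<^sub>R v d) \<in> tangent_space A x" using coord_vec_tangent[OF c] by simp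
  then show ?thesis
    using metric_tangent[OF g c] x(2)
    by (simp add: matrix_vector_mult_scaleR power2_eq_square)
qed

lemma integral_speed_affine:
  assumes g: "continuous_metric M A g" and p: "C1_piece a b \<gamma>" and k: "0 < k" and ab: "a = k * a' + l" "b = k * b' + l"
    and eq: "\<And>t. t \<in> {a'..b'} \<Longrightarrow> \<gamma>' t = \<gamma> (k * t + l)"
  shows "integral {a'..b'} (speed g \<gamma>') = integral {a..b} (speed g \<gamma>)"
proof -
  have p': "C1_piece a' b' \<gamma>'" by (rule C1_piece_affine(1)[OF p k ab]) (rule eq)
  have v: "vel_on a' b' \<gamma>' t = (\<lambda>c. k *\<^sub>R vel_on a b \<gamma> (k * t + l) c)" if "t \<in> {a'..b'}" for t
    by (rule C1_piece_affine(2)[OF p k ab]) (use eq that in auto)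
  have in_ab: "k * t + l \<in> {a..b}" if "t \<in> {a'..b'}" for t
    using that k ab by auto
  have s: "speed_on g a' b' \<gamma>' t = k * speed_on g a b \<gamma> (k * t + l)" if t: "t \<in> {a'..b'}" for t
  proof -
    have "\<gamma> (k * t + l) \<in> M" using in_ab[OF t] p by (auto simp: C1_piece_def)
    then show ?thesis
      using metric_scale[OF _ _ vel_on_tangent[OF p in_ab[OF t]], of g k] g k
      by (simp add: speed_on_def v[OF t] eq[OF t] continuous_metric_def real_sqrt_mult)
  qed
  have int: "(speed_on g a b \<gamma> has_integral integral {a..b} (speed_on g a b \<gamma>)) (cbox a b)"
    using integrable_integral[OF integrable_continuous_interval[OF continuous_speed_on[OF g p]]] by simp
  have "((\<lambda>t. speed_on g a b \<gamma> (k * t + l)) has_integral (1 / k) * integral {a..b} (speed_on g a b \<gamma>)) {a'..b'}"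
  proof -
    have "(a - l) /\<^sub>R k = a'" "(b - l) /\<^sub>R k = b'" using k by (simp_all add: ab)
    then show ?thesis
      using has_integral_affinity'[OF int k, of l] by (simp add: divide_inverse mult.commute)
  qed
  then have "((\<lambda>t. k * speed_on g a b \<gamma> (k * t + l)) has_integral k * ((1 / k) * integral {a..b} (speed_on g a b \<gamma>))) {a'..b'}"
    by (intro has_integral_mult_right) simp
  then have "(speed_on g a' b' \<gamma>' has_integral integral {a..b} (speed_on g a b \<gamma>)) {a'..b'}"
    using k by (subst has_integral_cong[OF s]) simp_all
  then show ?thesis
    using speed_has_integral[OF g p] speed_has_integral[OF g p']
    by (simp add: integral_unique)
qed

section \<open>Piecewise curves and the distance function\<close>

text \<open>
  Appending one piece at a time replaces the partition in \<open>piecewise_C1_curve\<close>, and facts about lengths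
  are proved by induction over the pieces.
\<close>

inductive pw_curve :: "(real \<Rightarrow> 'a) \<Rightarrow> real \<Rightarrow> real \<Rightarrow> bool" for \<gamma> where
  refl: "pw_curve \<gamma> a a"
| step: "pw_curve \<gamma> a b \<Longrightarrow> C1_piece b c \<gamma> \<Longrightarrow> pw_curve \<gamma> a c"

lemma pw_curve_le: "pw_curve \<gamma> a b \<Longrightarrow> a \<le> b"
  by (induction rule: pw_curve.induct) (auto simp: C1_piece_def)

lemma pw_curve_trans: "pw_curve \<gamma> b c \<Longrightarrow> pw_curve \<gamma> a b \<Longrightarrow> pw_curve \<gamma> a c"
  by (induction rule: pw_curve.induct) (auto intro: pw_curve.step)

lemma pw_curve_integrable:
  assumes "pw_curve \<gamma> a b" "continuous_metric M A g"
  shows "speed g \<gamma> integrable_on {a..b}"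
  using assms(1)
proof induction
  case (step a b c)
  have "speed g \<gamma> integrable_on {b..c}"
    using speed_has_integral[OF assms(2) step.hyps(2)] by blast
  moreover have "a \<le> b" "b \<le> c" using pw_curve_le step.hyps by (auto simp: C1_piece_def)
  ultimately show ?case
    using step.IH by (meson Henstock_Kurzweil_Integration.integrable_combine)
next
  case (refl a)
  have "speed g \<gamma> integrable_on cbox a a" by (rule integrable_on_refl)
  then show ?case by simp
qed

lemma pw_curve_integral_nonneg:
  assumes "pw_curve \<gamma> a b" "continuous_metric M A g"
  shows "0 \<le> integral {a..b} (speed g \<gamma>)"
  using assms(1)
proof induction
  case (step a b c)
  have "a \<le> b" "b \<le> c" using pw_curve_le step.hyps by (auto simp: C1_piece_def)
  then have "integral {a..c} (speed g \<gamma>) = integral {a..b} (speed g \<gamma>) + integral {b..c} (speed g \<gamma>)"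
    using Henstock_Kurzweil_Integration.integral_combine[of a b c "speed g \<gamma>"] pw_curve_integrable[OF pw_curve.step[OF step.hyps] assms(2)]
    by simp
  moreover have "0 \<le> integral {b..c} (speed g \<gamma>)"
  proof -
    have "integral {b..c} (speed g \<gamma>) = integral {b..c} (speed_on g b c \<gamma>)"
      using speed_has_integral[OF assms(2) step.hyps(2)] by (rule integral_unique)
    also have "\<dots> \<ge> 0"
      by (intro integral_nonneg integrable_continuous_interval continuous_speed_on
          speed_on_nonneg[OF assms(2) step.hyps(2)] assms(2) step.hyps(2))
    finally show ?thesis .
  qed
  ultimately show ?case using step.IH by simp
qed simp

lemma pw_curve_integral_combine:
  assumes "pw_curve \<gamma> a b" "pw_curve \<gamma> b c" "continuous_metric M A g"
  shows "integral {a..c} (speed g \<gamma>) = integral {a..b} (speed g \<gamma>) + integral {b..c} (speed g \<gamma>)"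
  using Henstock_Kurzweil_Integration.integral_combine[of a b c "speed g \<gamma>"]
    pw_curve_integrable[OF pw_curve_trans[OF assms(2,1)] assms(3)] pw_curve_le[OF assms(1)] pw_curve_le[OF assms(2)]
  by simp

lemma pw_curve_continuous:
  assumes "pw_curve \<gamma> a b" "a < b"
  shows "continuous_on {a..b} \<gamma> \<and> \<gamma> ` {a..b} \<subseteq> M"
  using assms
proof induction
  case (step a b c)
  show ?case
  proof (cases "a = b")
    case True
    then show ?thesis using step.hyps by (simp add: C1_piece_def)
  next
    case False
    then have ab: "a < b" "b < c" using pw_curve_le[OF step.hyps(1)] step.hyps(2) by (auto simp: C1_piece_def)
    then have eq: "{a..c} = {a..b} \<union> {b..c}" by auto
    show ?thesis
      unfolding eq using step.IH[OF ab(1)] step.hyps(2)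
      by (auto simp: C1_piece_def image_Un intro!: continuous_on_closed_Un)
  qed
qed simp

lemma piecewise_C1_curve_iff: "piecewise_C1_curve M A \<gamma> \<longleftrightarrow> pw_curve \<gamma> 0 1"
proof
  assume *: "piecewise_C1_curve M A \<gamma>"
  then obtain N s where s: "s 0 = 0" "s N = (1::real)" "\<And>i. i < N \<Longrightarrow> s i < s (Suc i) \<and> C1_curve_on A (s i) (s (Suc i)) \<gamma>"
    unfolding piecewise_C1_curve_def by blast
  have mono: "s i \<le> s j" if "i \<le> j" "j \<le> N" for i j
    using that
  proof (induction j rule: dec_induct)
    case (step n)
    then show ?case using s(3)[of n] by simp
  qed simp
  have "pw_curve \<gamma> 0 (s i)" if "i \<le> N" for i
    using that
  proof (induction i)
    case 0
    then show ?case using s(1) by (simp add: pw_curve.refl)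
  next
    case (Suc i)
    have "{s i..s (Suc i)} \<subseteq> {0..1}"
      using mono[of 0 i] mono[of "Suc i" N] Suc.prems s by auto
    then have "C1_piece (s i) (s (Suc i)) \<gamma>"
      using * s(3)[of i] Suc.prems
      by (auto simp: C1_piece_def piecewise_C1_curve_def path_def path_image_def intro: continuous_on_subset)
    then show ?case using Suc by (auto intro: pw_curve.step)
  qed
  from this[of N] s show "pw_curve \<gamma> 0 1" by simp
next
  assume *: "pw_curve \<gamma> 0 1"
  have "\<exists>N s. s 0 = a \<and> s N = b \<and> (\<forall>i<N. s i < s (Suc i) \<and> C1_curve_on A (s i) (s (Suc i)) \<gamma>)" if "pw_curve \<gamma> a b" for a b
    using that
  proof induction
    case (refl a)
    show ?case by (rule exI[of _ 0], rule exI[of _ "\<lambda>i. a"]) simp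
  next
    case (step a b c)
    then obtain N s where s: "s 0 = a" "s N = b" "\<And>i. i < N \<Longrightarrow> s i < s (Suc i) \<and> C1_curve_on A (s i) (s (Suc i)) \<gamma>"
      by blast
    show ?case
      by (rule exI[of _ "Suc N"], rule exI[of _ "s(Suc N := c)"])
         (use s step.hyps in \<open>auto simp: C1_piece_def less_Suc_eq\<close>)
  qed
  from this[OF *] pw_curve_continuous[OF *]
  show "piecewise_C1_curve M A \<gamma>"
    unfolding piecewise_C1_curve_def path_def path_image_def by simp
qed

lemma pw_curve_affine:
  assumes "pw_curve \<gamma> a b" and k: "0 < k" and "a = k * a' + l" "b = k * b' + l"
    and "\<And>t. t \<in> {a'..b'} \<Longrightarrow> \<gamma>' t = \<gamma> (k * t + l)" and g: "continuous_metric M A g"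
  shows "pw_curve \<gamma>' a' b' \<and> integral {a'..b'} (speed g \<gamma>') = integral {a..b} (speed g \<gamma>)"
  using assms(1,3,4,5)
proof (induction arbitrary: a' b')
  case (refl a)
  then have "a' = b'" using k by simp
  then show ?case by (simp add: pw_curve.refl)
next
  case (step a b c a' c')
  define b' where "b' = (b - l) / k"
  have b: "b = k * b' + l" using k by (simp add: b'_def)
  have "b < c" "a \<le> b" using step.hyps pw_curve_le by (auto simp: C1_piece_def)
  then have "a' \<le> b'" "b' < c'" using k step.prems(1,2) b by auto
  then have 1: "pw_curve \<gamma>' a' b' \<and> integral {a'..b'} (speed g \<gamma>') = integral {a..b} (speed g \<gamma>)"
    using step.IH[OF step.prems(1) b] step.prems(3) by auto
  have eq: "\<gamma>' t = \<gamma> (k * t + l)" if "t \<in> {b'..c'}" for t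
    using that step.prems(3) \<open>a' \<le> b'\<close> by auto
  have p: "C1_piece b' c' \<gamma>'"
    by (rule C1_piece_affine(1)[OF step.hyps(2) k b step.prems(2)]) (rule eq)
  have "integral {b'..c'} (speed g \<gamma>') = integral {b..c} (speed g \<gamma>)"
    by (rule integral_speed_affine[OF g step.hyps(2) k b step.prems(2)]) (rule eq)
  moreover have "pw_curve \<gamma>' b' c'" "pw_curve \<gamma> b c"
    using p step.hyps(2) by (auto intro: pw_curve.intros)
  ultimately show ?case
    using 1 pw_curve_integral_combine[OF _ _ g] step.hyps(1) pw_curve.step[OF _ p] by fastforce
qed

definition curves :: "'a \<Rightarrow> 'a \<Rightarrow> (real \<Rightarrow> 'a) set" where
  "curves x y = {\<gamma>. piecewise_C1_curve M A \<gamma> \<and> pathstart \<gamma> = x \<and> pathfinish \<gamma> = y}"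

lemma riemannian_dist_curves: "riemannian_dist M A g x y = Inf (curve_length A g ` curves x y)"
  unfolding riemannian_dist_def curves_def by (rule arg_cong[of _ _ Inf]) auto

lemma curve_length_speed: "curve_length A g \<gamma> = integral {0..1} (speed g \<gamma>)"
  by (simp add: curve_length_def speed_def[abs_def])

lemma curve_length_nonneg: "continuous_metric M A g \<Longrightarrow> \<gamma> \<in> curves x y \<Longrightarrow> 0 \<le> curve_length A g \<gamma>"
  using pw_curve_integral_nonneg by (simp add: curves_def piecewise_C1_curve_iff curve_length_speed)

lemma dist_le_length:
  assumes "continuous_metric M A g" "\<gamma> \<in> curves x y"
  shows "riemannian_dist M A g x y \<le> curve_length A g \<gamma>"
  unfolding riemannian_dist_curves
  by (rule cInf_lower) (use assms curve_length_nonneg in \<open>auto intro!: bdd_belowI[of _ 0]\<close>)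

lemma dist_nonneg:
  assumes "continuous_metric M A g" "curves x y \<noteq> {}"
  shows "0 \<le> riemannian_dist M A g x y"
  unfolding riemannian_dist_curves
  by (rule cInf_greatest) (use assms curve_length_nonneg in auto)

lemma dist_less_obtain:
  assumes "curves x y \<noteq> {}" "riemannian_dist M A g x y < e"
  obtains \<gamma> where "\<gamma> \<in> curves x y" "curve_length A g \<gamma> < e"
  using cInf_lessD[of "curve_length A g ` curves x y" e] assms
  unfolding riemannian_dist_curves by auto

text \<open>
  The two halves of the joined path are affine reparametrizations of the given curves.
\<close>

lemma join_curves:
  assumes g: "continuous_metric M A g" and "\<gamma>1 \<in> curves x y" "\<gamma>2 \<in> curves y z"
  shows "\<gamma>1 +++ \<gamma>2 \<in> curves x z" "curve_length A g (\<gamma>1 +++ \<gamma>2) = curve_length A g \<gamma>1 + curve_length A g \<gamma>2"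
proof -
  let ?\<gamma> = "\<gamma>1 +++ \<gamma>2"
  have 1: "pw_curve \<gamma>1 0 1" "pathstart \<gamma>1 = x" "pathfinish \<gamma>1 = y" and 2: "pw_curve \<gamma>2 0 1" "pathstart \<gamma>2 = y" "pathfinish \<gamma>2 = z"
    using assms by (auto simp: curves_def piecewise_C1_curve_iff)
  have a: "pw_curve ?\<gamma> 0 (1/2) \<and> integral {0..1/2} (speed g ?\<gamma>) = integral {0..1} (speed g \<gamma>1)"
    by (rule pw_curve_affine[OF 1(1), of 2 _ 0]) (use g in \<open>auto simp: joinpaths_def\<close>)
  have b: "pw_curve ?\<gamma> (1/2) 1 \<and> integral {1/2..1} (speed g ?\<gamma>) = integral {0..1} (speed g \<gamma>2)"
  proof (rule pw_curve_affine[OF 2(1), of 2 _ "-1"])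
    fix t :: real assume t: "t \<in> {1/2..1}"
    show "?\<gamma> t = \<gamma>2 (2 * t + - 1)"
    \<comment> \<open>At the midpoint the join takes the value of the first curve, which equals that of the second.\<close>
    proof (cases "t = 1 / 2")
      case True
      show ?thesis unfolding True using 1(3) 2(2) by (simp add: joinpaths_def pathfinish_def pathstart_def)
    qed (use t in \<open>simp add: joinpaths_def\<close>)
  qed (use g in simp_all)
  show "?\<gamma> \<in> curves x z"
    using pw_curve_trans a b 1 2 by (auto simp: curves_def piecewise_C1_curve_iff)
  show "curve_length A g ?\<gamma> = curve_length A g \<gamma>1 + curve_length A g \<gamma>2"
    unfolding curve_length_speed using pw_curve_integral_combine[OF conjunct1[OF a] conjunct1[OF b] g] a b by simp
qed

lemma dist_triangle:
  assumes g: "continuous_metric M A g" and ne: "curves x y \<noteq> {}" "curves y z \<noteq> {}"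
  shows "riemannian_dist M A g x z \<le> riemannian_dist M A g x y + riemannian_dist M A g y z"
proof (rule field_le_epsilon)
  fix e :: real assume e: "0 < e"
  obtain \<gamma>1 where 1: "\<gamma>1 \<in> curves x y" "curve_length A g \<gamma>1 < riemannian_dist M A g x y + e / 2"
    by (rule dist_less_obtain[OF ne(1), of g "riemannian_dist M A g x y + e / 2"]) (use e in auto)
  obtain \<gamma>2 where 2: "\<gamma>2 \<in> curves y z" "curve_length A g \<gamma>2 < riemannian_dist M A g y z + e / 2"
    by (rule dist_less_obtain[OF ne(2), of g "riemannian_dist M A g y z + e / 2"]) (use e in auto)
  show "riemannian_dist M A g x z \<le> riemannian_dist M A g x y + riemannian_dist M A g y z + e"
    using dist_le_length[OF g join_curves(1)[OF g 1(1) 2(1)]] join_curves(2)[OF g 1(1) 2(1)] 1 2 by simp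
qed

text \<open>
  The inequality between the metrics passes to the speeds, then to the lengths of each single curve, and
  finally to the infimum.
\<close>

lemma dist_scale_mono:
  assumes g: "continuous_metric M A g" "continuous_metric M A g'" and k: "0 \<le> k" and ne: "curves x y \<noteq> {}"
    and le: "\<And>x v. x \<in> M \<Longrightarrow> v \<in> tangent_space A x \<Longrightarrow> k\<^sup>2 * g x v v \<le> g' x v v"
  shows "k * riemannian_dist M A g x y \<le> riemannian_dist M A g' x y"
proof -
  have pw: "k * integral {a..b} (speed g \<gamma>) \<le> integral {a..b} (speed g' \<gamma>)" if "pw_curve \<gamma> a b" for a b \<gamma>
    using that
  proof induction
    case (step a b c)
    note p = step.hyps(2)
    have bc: "pw_curve \<gamma> b c" using p by (auto intro: pw_curve.intros)
    have "k * integral {b..c} (speed_on g b c \<gamma>) = integral {b..c} (\<lambda>t. k * speed_on g b c \<gamma> t)"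
      by simp
    also have "\<dots> \<le> integral {b..c} (speed_on g' b c \<gamma>)"
    proof (intro integral_le integrable_continuous_interval continuous_intros continuous_speed_on g p)
      fix t assume t: "t \<in> {b..c}"
      then have "k\<^sup>2 * g (\<gamma> t) (vel_on b c \<gamma> t) (vel_on b c \<gamma> t) \<le> g' (\<gamma> t) (vel_on b c \<gamma> t) (vel_on b c \<gamma> t)"
        using p by (intro le vel_on_tangent) (auto simp: C1_piece_def)
      then have "sqrt (k\<^sup>2 * g (\<gamma> t) (vel_on b c \<gamma> t) (vel_on b c \<gamma> t)) \<le> speed_on g' b c \<gamma> t"
        unfolding speed_on_def by (rule real_sqrt_le_mono)
      then show "k * speed_on g b c \<gamma> t \<le> speed_on g' b c \<gamma> t"
        using k by (simp add: real_sqrt_mult speed_on_def)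
    qed
    finally have "k * integral {b..c} (speed g \<gamma>) \<le> integral {b..c} (speed g' \<gamma>)"
      using speed_has_integral[OF g(1) p] speed_has_integral[OF g(2) p] by (simp add: integral_unique)
    then show ?case
      using step.IH pw_curve_integral_combine[OF step.hyps(1) bc g(1)] pw_curve_integral_combine[OF step.hyps(1) bc g(2)]
      by (simp add: distrib_left)
  qed simp
  show ?thesis
    unfolding riemannian_dist_curves[of g']
  proof (rule cInf_greatest)
    show "curve_length A g' ` curves x y \<noteq> {}" using ne by simp
    fix L assume "L \<in> curve_length A g' ` curves x y"
    then obtain \<gamma> where \<gamma>: "\<gamma> \<in> curves x y" "L = curve_length A g' \<gamma>" by blast
    have "k * riemannian_dist M A g x y \<le> k * curve_length A g \<gamma>"
      using dist_le_length[OF g(1) \<gamma>(1)] k by (rule mult_left_mono)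
    also have "\<dots> \<le> L"
      using pw \<gamma> by (simp add: curves_def piecewise_C1_curve_iff curve_length_speed)
    finally show "k * riemannian_dist M A g x y \<le> L" .
  qed
qed

text \<open>
  In another chart the segment becomes its image under the transition map, whose derivatives are
  continuous; this is why it is continuously differentiable in every chart.
\<close>

lemma segment_curve:
  assumes c: "c \<in> A" and sub: "\<And>t. t \<in> {0..1} \<Longrightarrow> x + t *\<^sub>R (y - x) \<in> snd c ` fst c"
  defines "\<gamma> \<equiv> \<lambda>t. chart_inv c (x + t *\<^sub>R (y - x))"
  shows "C1_piece 0 1 \<gamma>" "t \<in> {0..1} \<Longrightarrow> vel_on 0 1 \<gamma> t c = y - x"
proof -
  have line: "continuous_on S (\<lambda>t. x + t *\<^sub>R (y - x))" for S :: "real set" by (intro continuous_intros)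
  have cont: "continuous_on {0..1} \<gamma>"
    unfolding \<gamma>_def by (rule continuous_on_compose2[OF chart_inv_continuous[OF c] line]) (use sub in auto)
  have coord: "snd c (\<gamma> t) = x + t *\<^sub>R (y - x)" "\<gamma> t \<in> fst c" if "t \<in> {0..1}" for t
    using that sub c by (auto simp: \<gamma>_def chart_inv_right chart_inv_in)
  have D: "((snd d \<circ> \<gamma>) has_vector_derivative transition_deriv c d (\<gamma> t) (y - x)) (at t within {0..1})"
    if t: "t \<in> {0..1}" and d: "d \<in> A" "\<gamma> t \<in> fst d" for t d
  proof -
    have "((\<lambda>t. x + t *\<^sub>R (y - x)) has_vector_derivative (y - x)) (at t within {0..1})"
      by (auto intro!: derivative_eq_intros)
    moreover have "(transition c d has_derivative transition_deriv c d (\<gamma> t)) (at (x + t *\<^sub>R (y - x)) within (\<lambda>t. x + t *\<^sub>R (y - x)) ` {0..1})"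
      using transition_has_derivative[OF c d(1) coord(2)[OF t] d(2)] coord(1)[OF t] by (simp add: has_derivative_at_withinI)
    ultimately have "((transition c d \<circ> (\<lambda>t. x + t *\<^sub>R (y - x))) has_vector_derivative transition_deriv c d (\<gamma> t) (y - x)) (at t within {0..1})"
      by (rule vector_derivative_diff_chain_within)
    then show ?thesis by (simp add: transition_def \<gamma>_def comp_def)
  qed
  have "continuous_on {t\<in>{0..1}. \<gamma> t \<in> fst d} (\<lambda>t. transition_deriv c d (\<gamma> t) (y - x))" if d: "d \<in> A" for d
  proof -
    have "continuous_on {t\<in>{0..1}. \<gamma> t \<in> fst d} (\<lambda>t. frechet_derivative (transition c d) (at (x + t *\<^sub>R (y - x))) (y - x))"
    proof (rule continuous_on_compose2[OF smooth_on_continuous_deriv[OF transition_smooth[OF c d]] line])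
      show "(\<lambda>t. x + t *\<^sub>R (y - x)) ` {t\<in>{0..1}. \<gamma> t \<in> fst d} \<subseteq> snd c ` (fst c \<inter> fst d)"
      proof
        fix z assume "z \<in> (\<lambda>t. x + t *\<^sub>R (y - x)) ` {t\<in>{0..1}. \<gamma> t \<in> fst d}"
        then obtain t where t: "t \<in> {0..1}" "\<gamma> t \<in> fst d" "z = x + t *\<^sub>R (y - x)" by blast
        then show "z \<in> snd c ` (fst c \<inter> fst d)" using coord[OF t(1)] by force
      qed
    qed
    then show ?thesis
      by (rule continuous_on_eq) (use coord in \<open>auto simp: transition_deriv_def\<close>)
  qed
  then have "C1_curve_on A 0 1 \<gamma>" unfolding C1_curve_on_def using D by blast
  then show p: "C1_piece 0 1 \<gamma>"
    using cont coord(2) chart_subset[OF c] by (auto simp: C1_piece_def)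
  show "vel_on 0 1 \<gamma> t c = y - x" if t: "t \<in> {0..1}"
    using vector_derivative_within_Icc[OF _ t D[OF t c coord(2)[OF t]]] c coord(2)[OF t]
    by (simp add: vel_on_def transition_deriv_self)
qed

text \<open>
  The estimate is stated with an upper bound \<open>f\<close> for the speed of the segment, because it will serve for metrics
  that are controlled only by such bounds.
\<close>

lemma dist_le_segment:
  assumes g: "continuous_metric M A g" and c: "c \<in> A" and sub: "\<And>t. t \<in> {0..1} \<Longrightarrow> x + t *\<^sub>R (y - x) \<in> snd c ` fst c"
    and f: "f integrable_on {0..1}"
    and le: "\<And>t. t \<in> {0..1} \<Longrightarrow> sqrt ((y - x) \<bullet> (tensor_matrix A g c (chart_inv c (x + t *\<^sub>R (y - x))) *v (y - x))) \<le> f t"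
  shows "curves (chart_inv c x) (chart_inv c y) \<noteq> {}"
    "riemannian_dist M A g (chart_inv c x) (chart_inv c y) \<le> integral {0..1} f"
proof -
  define \<gamma> where "\<gamma> = (\<lambda>t. chart_inv c (x + t *\<^sub>R (y - x)))"
  have p: "C1_piece 0 1 \<gamma>" and v: "\<And>t. t \<in> {0..1} \<Longrightarrow> vel_on 0 1 \<gamma> t c = y - x"
    using segment_curve[OF c sub] by (auto simp: \<gamma>_def)
  have \<gamma>: "\<gamma> \<in> curves (chart_inv c x) (chart_inv c y)"
    using p by (auto simp: curves_def piecewise_C1_curve_iff pathstart_def pathfinish_def \<gamma>_def intro: pw_curve.intros)
  then show "curves (chart_inv c x) (chart_inv c y) \<noteq> {}" by blast
  have "curve_length A g \<gamma> = integral {0..1} (speed_on g 0 1 \<gamma>)"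
    using speed_has_integral[OF g p] by (simp add: curve_length_speed integral_unique)
  also have "\<dots> \<le> integral {0..1} f"
  proof (rule integral_le[OF integrable_continuous_interval[OF continuous_speed_on[OF g p]] f])
    fix t :: real assume t: "t \<in> {0..1}"
    have "\<gamma> t \<in> fst c" using sub[OF t] c by (auto simp: \<gamma>_def chart_inv_in)
    have eq: "chart_inv c (x + t *\<^sub>R (y - x)) = \<gamma> t" by (simp add: \<gamma>_def)
    show "speed_on g 0 1 \<gamma> t \<le> f t"
      using le[OF t] unfolding eq speed_on_coord[OF g p t c \<open>\<gamma> t \<in> fst c\<close>] v[OF t] .
  qed
  finally show "riemannian_dist M A g (chart_inv c x) (chart_inv c y) \<le> integral {0..1} f"
    using dist_le_length[OF g \<gamma>] by simp
qed

text \<open>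
  For the constant norm \<open>norm (P *v u)\<close> the straight segment is the shortest curve: the
  chord is the integral of the velocity.
\<close>

lemma chord_le_length:
  assumes g: "continuous_metric M A g" and p: "C1_piece a b \<gamma>" and c: "c \<in> A" and sub: "\<gamma> ` {a..b} \<subseteq> fst c"
    and le: "\<And>t u. t \<in> {a..b} \<Longrightarrow> norm (P *v u) \<le> K * sqrt (u \<bullet> (tensor_matrix A g c (\<gamma> t) *v u))"
  shows "norm ((P :: real^'n^'n) *v (snd c (\<gamma> b) - snd c (\<gamma> a))) \<le> K * integral {a..b} (speed g \<gamma>)"
proof -
  have ab: "a \<le> b" using p by (simp add: C1_piece_def)
  let ?v = "\<lambda>t. vel_on a b \<gamma> t c"
  have "(?v has_integral ((snd c \<circ> \<gamma>) b - (snd c \<circ> \<gamma>) a)) {a..b}"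
  proof (rule fundamental_theorem_of_calculus[OF ab])
    fix t assume t: "t \<in> {a..b}"
    show "((snd c \<circ> \<gamma>) has_vector_derivative ?v t) (at t within {a..b})"
      by (rule C1_piece_derivative(2)[OF p c t]) (use sub t in auto)
  qed
  then have int: "((\<lambda>t. P *v ?v t) has_integral (P *v (snd c (\<gamma> b) - snd c (\<gamma> a)))) {a..b}"
    using has_integral_linear[of ?v _ "{a..b}" "(*v) P"] by (simp add: comp_def)
  have K: "((\<lambda>t. K * speed_on g a b \<gamma> t) has_integral K * integral {a..b} (speed_on g a b \<gamma>)) {a..b}"
    by (intro has_integral_mult_right integrable_integral integrable_continuous_interval continuous_speed_on g p)
  have "norm (integral {a..b} (\<lambda>t. P *v ?v t)) \<le> integral {a..b} (\<lambda>t. K * speed_on g a b \<gamma> t)"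
  proof (rule integral_norm_bound_integral)
    show "(\<lambda>t. P *v ?v t) integrable_on {a..b}" using int by blast
    show "(\<lambda>t. K * speed_on g a b \<gamma> t) integrable_on {a..b}" using K by blast
    fix t assume t: "t \<in> {a..b}"
    then have "\<gamma> t \<in> fst c" using sub by auto
    then show "norm (P *v ?v t) \<le> K * speed_on g a b \<gamma> t"
      using le[OF t, of "?v t"] speed_on_coord[OF g p t c] by simp
  qed
  then show ?thesis
    using integral_unique[OF int] integral_unique[OF K] integral_unique[OF speed_has_integral[OF g p]] by simp
qed

lemma chart_ball:
  assumes "x \<in> M"
  obtains c r where "c \<in> A" "x \<in> fst c" "0 < r" "cball (snd c x) r \<subseteq> snd c ` fst c"
proof -
  obtain c where c: "c \<in> A" "x \<in> fst c" using chart_cover assms by blast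
  then obtain r where "0 < r" "cball (snd c x) r \<subseteq> snd c ` fst c"
    using chart_image_open[OF c(1)] by (meson imageI open_contains_cball)
  then show ?thesis using that c by blast
qed

lemma segment_in_convex:
  assumes "convex S" "x \<in> S" "y \<in> S" "t \<in> {0..1}"
  shows "x + t *\<^sub>R (y - x) \<in> S"
proof -
  have "(1 - t) *\<^sub>R x + t *\<^sub>R y \<in> S" using assms by (intro convexD) auto
  then show ?thesis by (simp add: algebra_simps)
qed

text \<open>
  Being joined by curves in both directions is an equivalence relation, and its classes are open by
  chart segments.
\<close>

lemma curves_nonempty:
  assumes conn: "connected M" and ex: "continuous_metric M A g" and xy: "x \<in> M" "y \<in> M"
  shows "curves x y \<noteq> {}"
proof -
  \<comment> \<open>Both directions are put into the relation, so that symmetry needs no reversed curves.\<close>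
  let ?R = "\<lambda>x y. curves x y \<noteq> {} \<and> curves y x \<noteq> {}"
  have "?R x y"
  proof (rule connected_equivalence_relation[OF conn xy])
    show "?R z x" if "?R x z" for x z using that by blast
    show "?R x z" if "?R x y" "?R y z" for x y z
      using that join_curves(1)[OF ex] by blast
    fix a assume "a \<in> M"
    then obtain c r where c: "c \<in> A" "a \<in> fst c" "0 < r" "cball (snd c a) r \<subseteq> snd c ` fst c"
      by (rule chart_ball)
    have sub: "ball (snd c a) r \<subseteq> snd c ` fst c" using c(4) ball_subset_cball by blast
    let ?T = "chart_inv c ` ball (snd c a) r"
    have T: "openin (top_of_set M) ?T" using chart_inv_image_openin[OF c(1) open_ball sub] .
    have aT: "a \<in> ?T" using chart_inv_left[OF c(1,2)] c(3) by (metis centre_in_ball imageI)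
    have "curves (chart_inv c u) (chart_inv c w) \<noteq> {}" if "u \<in> ball (snd c a) r" "w \<in> ball (snd c a) r" for u w
    proof -
      have "C1_piece 0 1 (\<lambda>t. chart_inv c (u + t *\<^sub>R (w - u)))"
        by (rule segment_curve(1)[OF c(1)]) (use segment_in_convex[OF convex_ball that] sub in blast)
      then have "(\<lambda>t. chart_inv c (u + t *\<^sub>R (w - u))) \<in> curves (chart_inv c u) (chart_inv c w)"
        by (auto simp: curves_def piecewise_C1_curve_iff pathstart_def pathfinish_def intro: pw_curve.intros)
      then show ?thesis by blast
    qed
    then have "\<forall>z\<in>?T. ?R a z" using aT by auto
    then show "\<exists>T. openin (top_of_set M) T \<and> a \<in> T \<and> (\<forall>x\<in>T. ?R a x)" using T aT by blast
  qed
  then show ?thesis by blast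
qed

end

section \<open>Change of variables\<close>

text \<open>
  A copy of a finite index type, ordered by an enumeration. Relabelling the coordinates preserves Lebesgue
  measure and determinants, so the change of variables formula for vectors with well-ordered indices
  carries over to arbitrary finite indices.
\<close>

datatype 'k ordered_copy = Copy (orig: 'k)

instance ordered_copy :: (finite) finite
proof
  have "(UNIV :: 'a ordered_copy set) = Copy ` UNIV"
    by (metis UNIV_eq_I ordered_copy.exhaust rangeI)
  then show "finite (UNIV :: 'a ordered_copy set)" by (metis finite finite_imageI)
qed

instantiation ordered_copy :: (finite) wellorder
begin
definition less_eq_ordered_copy :: "'a ordered_copy \<Rightarrow> 'a ordered_copy \<Rightarrow> bool" where
  "less_eq_ordered_copy x y \<longleftrightarrow> to_nat (orig x) \<le> to_nat (orig y)"
definition less_ordered_copy :: "'a ordered_copy \<Rightarrow> 'a ordered_copy \<Rightarrow> bool" where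
  "less_ordered_copy x y \<longleftrightarrow> to_nat (orig x) < to_nat (orig y)"
instance
proof
  fix P :: "'a ordered_copy \<Rightarrow> bool" and a
  assume step: "\<And>x. (\<And>y. y < x \<Longrightarrow> P y) \<Longrightarrow> P x"
  show "P a"
    by (induction a rule: measure_induct_rule[where f = "\<lambda>x. to_nat (orig x)"])
       (rule step, simp add: less_ordered_copy_def)
qed (auto simp: less_eq_ordered_copy_def less_ordered_copy_def intro: ordered_copy.expand)
end

definition up :: "real^'k::finite \<Rightarrow> real^('k ordered_copy)" where
  "up x = (\<chi> i. x $ orig i)"

definition down :: "real^('k::finite ordered_copy) \<Rightarrow> real^'k" where
  "down y = (\<chi> i. y $ Copy i)"

lemma up_down [simp]: "up (down y) = y" "down (up x) = x"
  by (simp_all add: up_def down_def vec_eq_iff)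

lemma linear_up: "linear up" and linear_down: "linear down"
  by (auto intro!: linearI simp: up_def down_def vec_eq_iff)

lemma bounded_linear_up: "bounded_linear up" and bounded_linear_down: "bounded_linear down"
  using linear_up linear_down linear_linear by blast+

lemma continuous_on_up_down [continuous_intros]: "continuous_on S up" "continuous_on T down"
  by (auto intro: linear_continuous_on bounded_linear_up bounded_linear_down)

lemma borel_measurable_up [measurable]: "up \<in> borel_measurable borel"
  and borel_measurable_down [measurable]: "down \<in> borel_measurable borel"
  by (auto intro: borel_measurable_continuous_onI continuous_intros)

lemma bij_Copy: "bij Copy"
  by (metis bij_def inj_def ordered_copy.inject ordered_copy.exhaust surj_def)

lemma up_image_eq: "up ` S = down -` S"
  by (force simp: image_iff)

lemma prod_Basis_vec:
  fixes f :: "real^'k \<Rightarrow> real"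
  shows "(\<Prod>b\<in>Basis. f b) = (\<Prod>i\<in>UNIV. f (axis i 1))"
proof -
  have B: "(Basis :: (real^'k) set) = (\<lambda>i. axis i 1) ` UNIV"
    by (auto simp: Basis_vec_def)
  have "inj (\<lambda>i. axis i (1::real) :: real^'k)" by (auto simp: inj_def axis_eq_axis)
  from prod.reindex[OF this, of f] show ?thesis unfolding B by (simp add: comp_def)
qed

lemma lborel_up: "distr lborel borel (up :: real^'k::finite \<Rightarrow> _) = lborel"
proof (rule lborel_eqI[symmetric])
  fix l u :: "real^('k ordered_copy)"
  assume le: "\<And>b. b \<in> Basis \<Longrightarrow> l \<bullet> b \<le> u \<bullet> b"
  then have le': "l $ i \<le> u $ i" for i
    using le[of "axis i 1"] by (simp add: Basis_vec_def inner_axis) blast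
  have "up -` box l u = box (down l) (down u)"
  proof (intro set_eqI iffI)
    fix x assume "x \<in> up -` box l u"
    then show "x \<in> box (down l) (down u)"
      by (auto simp: mem_box_cart up_def down_def) (metis ordered_copy.sel)+
  next
    fix x assume "x \<in> box (down l) (down u)"
    then show "x \<in> up -` box l u"
      by (auto simp: mem_box_cart up_def down_def) (metis ordered_copy.collapse)+
  qed
  then have "emeasure (distr lborel borel up) (box l u) = emeasure lborel (box (down l) (down u))"
    by (simp add: emeasure_distr)
  also have "\<dots> = ennreal (\<Prod>b\<in>Basis. (down u - down l) \<bullet> b)"
  proof (rule emeasure_lborel_box)
    fix b :: "real^'k" assume "b \<in> Basis"
    then obtain i where "b = axis i 1" by (auto simp: Basis_vec_def)
    then show "down l \<bullet> b \<le> down u \<bullet> b" using le' by (simp add: inner_axis down_def)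
  qed
  also have "(\<Prod>b\<in>Basis. (down u - down l) \<bullet> b) = (\<Prod>i\<in>UNIV. (u - l) $ Copy i)"
    by (simp add: prod_Basis_vec inner_axis down_def)
  also have "\<dots> = (\<Prod>i\<in>UNIV. (u - l) $ i)"
    using prod.reindex_bij_betw[OF bij_Copy, of "\<lambda>i. (u - l) $ i"] by simp
  also have "\<dots> = (\<Prod>b\<in>Basis. (u - l) \<bullet> b)"
    by (simp add: prod_Basis_vec inner_axis)
  finally show "emeasure (distr lborel borel up) (box l u) = ennreal (\<Prod>b\<in>Basis. (u - l) \<bullet> b)" .
qed simp

lemma emeasure_down_vimage:
  assumes "S \<in> sets borel"
  shows "emeasure lborel (down -` S) = emeasure lborel (S :: (real^'k::finite) set)"
proof -
  have "emeasure lborel (down -` S) = emeasure (distr lborel borel up) (down -` S)"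
    by (simp add: lborel_up)
  also have "\<dots> = emeasure lborel (up -` (down -` S))"
    using assms measurable_sets[OF borel_measurable_down assms] by (subst emeasure_distr) auto
  also have "up -` (down -` S) = S" by auto
  finally show ?thesis .
qed

lemma nn_integral_down:
  assumes [measurable]: "f \<in> borel_measurable borel"
  shows "(\<integral>\<^sup>+y. f (down y) \<partial>lborel) = (\<integral>\<^sup>+x. f x \<partial>(lborel :: (real^'k::finite) measure))"
proof -
  have "(\<integral>\<^sup>+y. f (down y) \<partial>lborel) = (\<integral>\<^sup>+y. f (down y) \<partial>distr lborel borel up)"
    by (simp add: lborel_up)
  also have "\<dots> = (\<integral>\<^sup>+x. f x \<partial>lborel)"
    by (subst nn_integral_distr) auto
  finally show ?thesis .
qed

lemma det_ordered_copy:
  fixes B :: "real^'k^'k"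
  shows "det (\<chi> i j. B $ orig i $ orig j) = det B"
proof -
  let ?W = "Copy :: 'k \<Rightarrow> 'k ordered_copy"
  have inv: "inv ?W = orig"
    by (rule ext, rule inv_f_eq) (use bij_Copy in \<open>auto simp: bij_def\<close>)
  have surj: "range ?W = UNIV" by (rule bij_is_surj[OF bij_Copy])
  have mp: "map_permutation UNIV ?W p = Copy \<circ> p \<circ> orig" for p
    using surj by (simp add: map_permutation_def inv restrict_id_def fun_eq_iff)
  have perm: "bij_betw (map_permutation UNIV ?W) {p. p permutes UNIV} {p. p permutes UNIV}"
    using bij_betw_permutations[OF bij_Copy]
    by (rule back_subst[of "\<lambda>f. bij_betw f _ _"]) (simp add: mp inv fun_eq_iff)
  have "det (\<chi> i j. B $ orig i $ orig j) =
    (\<Sum>p\<in>{p. p permutes (UNIV :: 'k ordered_copy set)}. of_int (sign p) * (\<Prod>i\<in>UNIV. B $ orig i $ orig (p i)))"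
    by (simp add: det_def)
  also have "\<dots> = (\<Sum>p\<in>{p. p permutes (UNIV :: 'k set)}. of_int (sign (map_permutation UNIV ?W p)) *
      (\<Prod>i\<in>UNIV. B $ orig i $ orig (map_permutation UNIV ?W p i)))"
    by (rule sum.reindex_bij_betw[OF perm, symmetric])
  also have "\<dots> = (\<Sum>p\<in>{p. p permutes (UNIV :: 'k set)}. of_int (sign p) * (\<Prod>i\<in>UNIV. B $ i $ p i))"
  proof (rule sum.cong[OF HOL.refl])
    fix p :: "'k \<Rightarrow> 'k" assume p: "p \<in> {p. p permutes UNIV}"
    have "sign (map_permutation UNIV ?W p) = sign p"
      by (rule sign_map_permutation) (use p bij_Copy in \<open>auto simp: bij_def\<close>)
    moreover have "(\<Prod>i\<in>UNIV. B $ orig i $ orig (map_permutation UNIV ?W p i)) = (\<Prod>i\<in>UNIV. B $ i $ p i)"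
      using prod.reindex_bij_betw[OF bij_Copy, of "\<lambda>i. B $ orig i $ orig (map_permutation UNIV ?W p i)"]
      by (simp add: mp)
    ultimately show "of_int (sign (map_permutation UNIV ?W p)) *
      (\<Prod>i\<in>UNIV. B $ orig i $ orig (map_permutation UNIV ?W p i)) = of_int (sign p) * (\<Prod>i\<in>UNIV. B $ i $ p i)"
      by simp
  qed
  also have "\<dots> = det B" by (simp add: det_def)
  finally show ?thesis .
qed

lemma det_matrix_conjugate:
  fixes f :: "real^'k \<Rightarrow> real^'k"
  shows "det (matrix (up \<circ> f \<circ> down)) = det (matrix f)"
proof -
  have dn: "down (axis j 1) = axis (orig j) 1" for j :: "'k ordered_copy"
    by (auto simp: down_def axis_def vec_eq_iff)
  have "matrix (up \<circ> f \<circ> down) = (\<chi> i j. matrix f $ orig i $ orig j)"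
    by (simp add: matrix_def up_def dn)
  then show ?thesis by (simp add: det_ordered_copy)
qed

text \<open>
  The image has finite measure exactly if the Jacobian is integrable, so the formula for integrable
  Jacobians also settles the infinite case.
\<close>

lemma emeasure_image_wellorder:
  fixes f :: "real^'m::{finite,wellorder} \<Rightarrow> real^'m::_"
  assumes S [measurable]: "S \<in> sets borel" and fS: "f ` S \<in> sets borel"
    and der: "\<And>x. x \<in> S \<Longrightarrow> (f has_derivative f' x) (at x)" and inj: "inj_on f S"
    and J [measurable]: "(\<lambda>x. indicator S x * \<bar>det (matrix (f' x))\<bar>) \<in> borel_measurable borel"
  shows "emeasure lborel (f ` S) = (\<integral>\<^sup>+x. ennreal (indicator S x * \<bar>det (matrix (f' x))\<bar>) \<partial>lborel)"
proof -
  let ?J = "\<lambda>x. \<bar>det (matrix (f' x))\<bar>"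
  have S': "S \<in> sets lebesgue" by (simp add: S)
  have der': "\<And>x. x \<in> S \<Longrightarrow> (f has_derivative f' x) (at x within S)"
    using der by (simp add: has_derivative_at_withinI)
  note eq = measurable_differentiable_image_eq[OF S' der' inj]
  have ind: "?J integrable_on S \<longleftrightarrow> (\<lambda>x. indicator S x * ?J x) integrable_on UNIV"
    by (subst integrable_restrict_UNIV[symmetric], rule arg_cong[where f = "\<lambda>f. f integrable_on UNIV"])
       (auto simp: indicator_def)
  show ?thesis
  proof (cases "(\<integral>\<^sup>+x. ennreal (indicator S x * ?J x) \<partial>lborel) < \<infinity>")
    case True
    have "(\<lambda>x. indicator S x * ?J x) integrable_on UNIV"
      by (rule nn_integral_integrable_on) (use True in auto)
    then have int: "?J integrable_on S" by (simp add: ind)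
    then have meas: "f ` S \<in> lmeasurable" using eq by blast
    have "emeasure lborel (f ` S) = emeasure lebesgue (f ` S)" using fS by simp
    also have "\<dots> = ennreal (measure lebesgue (f ` S))"
      using meas by (simp add: emeasure_eq_measure2)
    also have "measure lebesgue (f ` S) = integral S ?J"
      by (rule measure_differentiable_image_eq[OF S' der' inj int])
    also have "\<dots> = integral UNIV (\<lambda>x. indicator S x * ?J x)"
      by (subst integral_restrict_UNIV[symmetric], rule arg_cong[where f = "integral UNIV"])
         (auto simp: indicator_def)
    also have "ennreal \<dots> = (\<integral>\<^sup>+x. ennreal (indicator S x * ?J x) \<partial>lborel)"
      by (rule nn_integral_lborel_eq_integral[symmetric]) (use True in auto)
    finally show ?thesis .
  next
    case False
    have "\<not> f ` S \<in> lmeasurable"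
    proof
      assume "f ` S \<in> lmeasurable"
      then have "?J integrable_on S" using eq by blast
      then obtain I where "(?J has_integral I) S" by blast
      then have "integral\<^sup>N lborel (\<lambda>x. indicator S x * ?J x) = I"
        by (intro nn_integral_has_integral_lebesgue) auto
      then show False using False by simp
    qed
    then have "emeasure lebesgue (f ` S) = \<infinity>"
      using fS by (auto simp: fmeasurable_def not_less top_unique)
    then show ?thesis using fS False by (simp add: not_less top_unique)
  qed
qed

lemma emeasure_image_change_of_variables:
  fixes f :: "real^'k \<Rightarrow> real^'k"
  assumes S [measurable]: "S \<in> sets borel" and fS: "f ` S \<in> sets borel"
    and der: "\<And>x. x \<in> S \<Longrightarrow> (f has_derivative f' x) (at x)" and inj: "inj_on f S"
    and J [measurable]: "(\<lambda>x. indicator S x * \<bar>det (matrix (f' x))\<bar>) \<in> borel_measurable borel"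
  shows "emeasure lborel (f ` S) = (\<integral>\<^sup>+x. ennreal (indicator S x * \<bar>det (matrix (f' x))\<bar>) \<partial>lborel)"
proof -
  let ?F = "up \<circ> f \<circ> down" and ?F' = "\<lambda>y. up \<circ> f' (down y) \<circ> down"
  have img: "?F ` (down -` S) = down -` (f ` S)"
  proof -
    have "down ` (down -` S) = S" by (auto simp: image_iff) (metis up_down(2))
    then show ?thesis by (metis up_image_eq image_comp)
  qed
  have ind: "indicator (down -` S) y * \<bar>det (matrix (?F' y))\<bar> = indicator S (down y) * \<bar>det (matrix (f' (down y)))\<bar>" for y
    by (simp add: det_matrix_conjugate indicator_def)
  have "emeasure lborel (f ` S) = emeasure lborel (?F ` (down -` S))"
    by (simp only: img emeasure_down_vimage[OF fS])
  also have "\<dots> = (\<integral>\<^sup>+y. ennreal (indicator (down -` S) y * \<bar>det (matrix (?F' y))\<bar>) \<partial>lborel)"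
  proof (rule emeasure_image_wellorder)
    show "down -` S \<in> sets borel" using measurable_sets[OF borel_measurable_down S] by simp
    show "?F ` (down -` S) \<in> sets borel" unfolding img using measurable_sets[OF borel_measurable_down fS] by simp
    show "inj_on ?F (down -` S)"
      using inj by (auto simp: inj_on_def) (metis up_down)
    show "(?F has_derivative ?F' y) (at y)" if "y \<in> down -` S" for y
      using der[of "down y"] that
      by (auto intro!: diff_chain_at bounded_linear_imp_has_derivative bounded_linear_up bounded_linear_down)
    show "(\<lambda>y. indicator (down -` S) y * \<bar>det (matrix (?F' y))\<bar>) \<in> borel_measurable borel"
      unfolding ind using measurable_compose[OF borel_measurable_down J] by simp
  qed
  also have "\<dots> = (\<integral>\<^sup>+y. ennreal (indicator S (down y) * \<bar>det (matrix (f' (down y)))\<bar>) \<partial>lborel)"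
    by (simp only: ind)
  also have "\<dots> = (\<integral>\<^sup>+x. ennreal (indicator S x * \<bar>det (matrix (f' x))\<bar>) \<partial>lborel)"
    by (rule nn_integral_down) measurable
  finally show ?thesis .
qed

text \<open>
  The formula for images of sets says that two measures on the target agree: Lebesgue measure on
  \<open>\<Omega>'\<close>, and the image under \<open>f\<close> of the measure on \<open>\<Omega>\<close> whose density is the Jacobian. Then they also agree on functions.
\<close>

lemma nn_integral_change_of_variables:
  fixes f :: "real^'k \<Rightarrow> real^'k"
  assumes hom: "homeomorphism \<Omega> \<Omega>' f k" and op: "open \<Omega>" "open \<Omega>'"
    and der: "\<And>x. x \<in> \<Omega> \<Longrightarrow> (f has_derivative f' x) (at x)"
    and cont: "continuous_on \<Omega> (\<lambda>x. det (matrix (f' x)))"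
    and h [measurable]: "h \<in> borel_measurable borel"
  shows "(\<integral>\<^sup>+y\<in>\<Omega>'. h y \<partial>lborel) = (\<integral>\<^sup>+x\<in>\<Omega>. ennreal \<bar>det (matrix (f' x))\<bar> * h (f x) \<partial>lborel)"
proof -
  let ?J = "\<lambda>x. indicator \<Omega> x * \<bar>det (matrix (f' x))\<bar>"
  have [measurable]: "\<Omega> \<in> sets borel" "\<Omega>' \<in> sets borel" using op by auto
  \<comment> \<open>Extension by 0 makes the map Borel measurable on the whole space.\<close>
  define f0 where "f0 x = (if x \<in> \<Omega> then f x else 0)" for x
  have f0 [measurable]: "f0 \<in> borel_measurable borel"
    unfolding f0_def using op hom
    by (intro borel_measurable_continuous_on_if) (auto simp: homeomorphism_def)
  have J [measurable]: "?J \<in> borel_measurable borel"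
  proof -
    have "(\<lambda>x. if x \<in> \<Omega> then \<bar>det (matrix (f' x))\<bar> else 0) \<in> borel_measurable borel"
      using op cont by (intro borel_measurable_continuous_on_if continuous_intros) auto
    then show ?thesis by (rule back_subst[of "\<lambda>f. f \<in> borel_measurable borel"]) (auto simp: indicator_def fun_eq_iff)
  qed
  have inj: "inj_on f \<Omega>" using hom by (metis homeomorphism_def inj_on_inverseI)
  have "density lborel (indicator \<Omega>') = distr (density lborel (\<lambda>x. ennreal (?J x))) borel f0"
  proof (rule measure_eqI)
    fix B :: "(real^'k) set" assume "B \<in> sets (density lborel (indicator \<Omega>'))"
    then have B [measurable]: "B \<in> sets borel" by simp
    define S where "S = \<Omega> \<inter> f0 -` B"
    have S [measurable]: "S \<in> sets borel"
      unfolding S_def using measurable_sets[OF f0 B] by auto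
    have fS: "f ` S = \<Omega>' \<inter> B"
      using hom unfolding S_def f0_def homeomorphism_def by (auto simp: image_iff) 
    have "emeasure (density lborel (indicator \<Omega>')) B = emeasure lborel (\<Omega>' \<inter> B)"
      by (subst emeasure_density) (auto simp: nn_integral_indicator[symmetric] indicator_inter_arith simp del: nn_integral_indicator)
    also have "\<dots> = emeasure lborel (f ` S)" by (simp add: fS)
    also have "\<dots> = (\<integral>\<^sup>+x. ennreal (indicator S x * \<bar>det (matrix (f' x))\<bar>) \<partial>lborel)"
    proof (rule emeasure_image_change_of_variables[OF S])
      show "f ` S \<in> sets borel" by (simp add: fS)
      show "\<And>x. x \<in> S \<Longrightarrow> (f has_derivative f' x) (at x)" using der by (simp add: S_def)
      show "inj_on f S" using inj by (rule inj_on_subset) (simp add: S_def)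
      have "(\<lambda>x. indicator S x * ?J x) \<in> borel_measurable borel" by measurable
      then show "(\<lambda>x. indicator S x * \<bar>det (matrix (f' x))\<bar>) \<in> borel_measurable borel"
        by (rule back_subst[of "\<lambda>f. f \<in> borel_measurable borel"]) (auto simp: indicator_def fun_eq_iff S_def)
    qed
    also have "\<dots> = (\<integral>\<^sup>+x. ennreal (?J x) * indicator (f0 -` B) x \<partial>lborel)"
      by (intro nn_integral_cong) (auto simp: indicator_def S_def)
    also have "\<dots> = emeasure (distr (density lborel (\<lambda>x. ennreal (?J x))) borel f0) B"
      using measurable_sets[OF f0 B] by (simp add: emeasure_distr emeasure_density)
    finally show "emeasure (density lborel (indicator \<Omega>')) B = emeasure (distr (density lborel (\<lambda>x. ennreal (?J x))) borel f0) B" .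
  qed simp
  then have "(\<integral>\<^sup>+y. h y \<partial>density lborel (indicator \<Omega>')) = (\<integral>\<^sup>+y. h y \<partial>distr (density lborel (\<lambda>x. ennreal (?J x))) borel f0)"
    by simp
  then have "(\<integral>\<^sup>+y. indicator \<Omega>' y * h y \<partial>lborel) = (\<integral>\<^sup>+x. ennreal (?J x) * h (f0 x) \<partial>lborel)"
    by (simp add: nn_integral_density nn_integral_distr)
  also have "\<dots> = (\<integral>\<^sup>+x\<in>\<Omega>. ennreal \<bar>det (matrix (f' x))\<bar> * h (f x) \<partial>lborel)"
    by (intro nn_integral_cong) (auto simp: indicator_def f0_def)
  finally show ?thesis by (simp add: mult.commute)
qed

section \<open>The Riemannian volume measure\<close>

lemma pos_def_det_pos:
  fixes Q :: "real^'n^'n"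
  assumes "pos_def Q"
  shows "0 < det Q"
proof -
  obtain E :: "real^'n^'n" where E: "transpose E ** Q ** E = mat 1"
    using pos_def_orthonormal[OF assms] by blast
  have "det (transpose E ** Q ** E) = (det E)\<^sup>2 * det Q"
    by (simp add: det_mul power2_eq_square)
  then have "(det E)\<^sup>2 * det Q = 1" by (simp add: E)
  then show ?thesis by (smt (verit) mult_nonneg_nonpos zero_le_power2)
qed

context smooth_atlas
begin

abbreviation borel_M :: "'a measure" where "borel_M \<equiv> restrict_space borel M"

lemma space_borel_M: "space borel_M = M"
  by (simp add: space_restrict_space)

lemma openin_sets_M: "openin (top_of_set M) W \<Longrightarrow> W \<in> sets borel_M"
  by (auto simp: openin_open sets_restrict_space)

lemma chart_domain_sets: "c \<in> A \<Longrightarrow> fst c \<in> sets borel_M"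
  by (simp add: chart_openin openin_sets_M)

lemma chart_inj: "c \<in> A \<Longrightarrow> inj_on (snd c) (fst c)"
  by (rule inj_on_inverseI[of _ "chart_inv c"]) (rule chart_inv_left)

text \<open>
  The image is the preimage under the inverse chart, which is continuous.
\<close>

lemma chart_image_borel:
  assumes c: "c \<in> A" and B: "B \<in> sets borel_M" "B \<subseteq> fst c"
  shows "snd c ` B \<in> sets borel"
proof -
  obtain B' where B': "B' \<in> sets borel" "B = M \<inter> B'" using B(1) by (auto simp: sets_restrict_space)
  have m: "chart_inv c \<in> borel_measurable (restrict_space borel (snd c ` fst c))"
    by (rule borel_measurable_continuous_on_restrict[OF chart_inv_continuous[OF c]])
  have "chart_inv c -` B' \<inter> space (restrict_space borel (snd c ` fst c)) \<in> sets (restrict_space borel (snd c ` fst c))"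
    by (rule measurable_sets[OF m B'(1)])
  moreover have "chart_inv c -` B' \<inter> space (restrict_space borel (snd c ` fst c)) = snd c ` B"
    using B B' c chart_subset[OF c] by (force simp: space_restrict_space chart_inv_left)
  ultimately have "snd c ` B \<in> sets (restrict_space borel (snd c ` fst c))" by simp
  moreover have "snd c ` fst c \<in> sets borel" using chart_image_open[OF c] by simp
  ultimately show ?thesis by (auto simp: sets_restrict_space)
qed

lemma chart_inv_image_sets:
  assumes c: "c \<in> A" and Y: "Y \<in> sets borel" "Y \<subseteq> snd c ` fst c"
  shows "chart_inv c ` Y \<in> sets borel_M"
proof -
  have "snd c \<in> borel_measurable (restrict_space borel (fst c))"
    by (rule borel_measurable_continuous_on_restrict[OF chart_continuous[OF c]])
  then have "snd c -` Y \<inter> fst c \<in> sets (restrict_space borel (fst c))"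
    using measurable_sets[of "snd c" "restrict_space borel (fst c)" borel Y] Y by (simp add: space_restrict_space)
  moreover have "snd c -` Y \<inter> fst c = chart_inv c ` Y"
  proof (intro set_eqI iffI)
    fix x assume "x \<in> snd c -` Y \<inter> fst c"
    then have "x = chart_inv c (snd c x)" "snd c x \<in> Y" using c by (auto simp: chart_inv_left)
    then show "x \<in> chart_inv c ` Y" by blast
  next
    fix x assume "x \<in> chart_inv c ` Y"
    then obtain y where y: "y \<in> Y" "x = chart_inv c y" by blast
    then have "y \<in> snd c ` fst c" using Y(2) by blast
    then show "x \<in> snd c -` Y \<inter> fst c" using y c by (simp add: chart_inv_right chart_inv_in)
  qed
  ultimately obtain B where B: "B \<in> sets borel" "chart_inv c ` Y = fst c \<inter> B" by (auto simp: sets_restrict_space)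
  obtain T where T: "open T" "fst c = M \<inter> T" using chart_openin[OF c] by (auto simp: openin_open)
  have "chart_inv c ` Y = M \<inter> (T \<inter> B)" using B T by blast
  then show ?thesis using B T by (auto simp: sets_restrict_space)
qed

text \<open>
  The chart density is extended by 0 off the image of the chart, to be Borel measurable on the whole
  space.
\<close>

definition density_fn :: "('a, 'n) tensor2 \<Rightarrow> ('a, 'n) chart \<Rightarrow> real^'n \<Rightarrow> real" where
  "density_fn g c y = (if y \<in> snd c ` fst c then sqrt (det (tensor_matrix A g c (chart_inv c y))) else 0)"

definition chart_vol :: "('a, 'n) tensor2 \<Rightarrow> ('a, 'n) chart \<Rightarrow> 'a set \<Rightarrow> ennreal" where
  "chart_vol g c B = (\<integral>\<^sup>+y\<in>snd c ` B. ennreal (sqrt (det (tensor_matrix A g c (chart_inv c y)))) \<partial>lborel)"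

lemma continuous_tensor_matrix_chart:
  assumes "continuous_metric M A g" "c \<in> A"
  shows "continuous_on (snd c ` fst c) (\<lambda>y. tensor_matrix A g c (chart_inv c y))"
  by (rule continuous_on_compose2[OF _ chart_inv_continuous[OF assms(2)], of "fst c"])
     (use assms in \<open>auto simp: continuous_metric_def chart_inv_in\<close>)

lemma continuous_density_fn:
  assumes "continuous_metric M A g" "c \<in> A"
  shows "continuous_on (snd c ` fst c) (density_fn g c)"
proof -
  have "continuous_on (snd c ` fst c) (\<lambda>y. sqrt (det (tensor_matrix A g c (chart_inv c y))))"
    by (intro continuous_intros continuous_on_det_nth continuous_tensor_matrix_chart assms)
  then show ?thesis by (rule continuous_on_eq) (simp add: density_fn_def)
qed

lemma density_fn_pos:
  assumes "continuous_metric M A g" "c \<in> A" "y \<in> snd c ` fst c"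
  shows "0 < density_fn g c y"
  using assms pos_def_det_pos[OF metric_pos_def[of g c "chart_inv c y"]] chart_inv_in[OF assms(2,3)]
  by (simp add: density_fn_def continuous_metric_def)

lemma density_fn_measurable [measurable]:
  assumes "continuous_metric M A g" "c \<in> A"
  shows "density_fn g c \<in> borel_measurable borel"
proof -
  have "(\<lambda>y. if y \<in> snd c ` fst c then density_fn g c y else 0) \<in> borel_measurable borel"
    using continuous_density_fn[OF assms] chart_image_open[OF assms(2)]
    by (intro borel_measurable_continuous_on_if) auto
  then show ?thesis by (rule back_subst[of "\<lambda>f. f \<in> borel_measurable borel"]) (auto simp: density_fn_def)
qed

lemma chart_vol_density:
  assumes "B \<subseteq> fst c"
  shows "chart_vol g c B = (\<integral>\<^sup>+y\<in>snd c ` B. ennreal (density_fn g c y) \<partial>lborel)"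
  unfolding chart_vol_def using assms
  by (intro nn_integral_cong) (auto simp: indicator_def density_fn_def)

lemma transition_homeomorphism:
  assumes "c \<in> A" "d \<in> A"
  shows "homeomorphism (snd c ` (fst c \<inter> fst d)) (snd d ` (fst c \<inter> fst d)) (transition c d) (transition d c)"
  unfolding homeomorphism_def
  using smooth_on_continuous[OF transition_smooth[OF assms]] smooth_on_continuous[OF transition_smooth[OF assms(2,1)]] assms
  by (auto simp: transition_at Int_commute image_iff)

text \<open>
  This is the change of variables formula for the transition map: the density picks up the factor
  \<open>\<bar>det\<bar>\<close> of its derivative.
\<close>

lemma chart_vol_change:
  assumes g: "continuous_metric M A g" and cd: "c \<in> A" "d \<in> A" and B: "B \<in> sets borel_M" "B \<subseteq> fst c" "B \<subseteq> fst d"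
  shows "chart_vol g c B = chart_vol g d B"
proof -
  let ?\<Omega> = "snd c ` (fst c \<inter> fst d)" and ?\<Omega>' = "snd d ` (fst c \<inter> fst d)"
  have [measurable]: "snd d ` B \<in> sets borel" by (rule chart_image_borel[OF cd(2) B(1,3)])
  note [measurable] = density_fn_measurable[OF g cd(2)]
  have gm: "metric_tensor M A g" using g by (simp add: continuous_metric_def)
  define h where "h y = ennreal (density_fn g d y) * indicator (snd d ` B) y" for y
  have h [measurable]: "h \<in> borel_measurable borel" unfolding h_def by measurable
  have cont: "continuous_on ?\<Omega> (\<lambda>y. det (matrix (transition_deriv c d (chart_inv c y))))"
  proof (rule continuous_on_det_nth)
    fix i j
    have "continuous_on ?\<Omega> (\<lambda>y. frechet_derivative (transition c d) (at y) (axis j 1) $ i)"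
      by (intro continuous_intros smooth_on_continuous_deriv[OF transition_smooth[OF cd]])
    then show "continuous_on ?\<Omega> (\<lambda>y. matrix (transition_deriv c d (chart_inv c y)) $ i $ j)"
      by (rule continuous_on_eq) (use cd in \<open>auto simp: matrix_def transition_deriv_def chart_inv_left\<close>)
  qed
  have "chart_vol g d B = (\<integral>\<^sup>+y\<in>?\<Omega>'. h y \<partial>lborel)"
    unfolding chart_vol_density[OF B(3)] h_def using B(2,3)
    by (intro nn_integral_cong) (auto simp: indicator_def)
  also have "\<dots> = (\<integral>\<^sup>+y\<in>?\<Omega>. ennreal \<bar>det (matrix (transition_deriv c d (chart_inv c y)))\<bar> * h (transition c d y) \<partial>lborel)"
  proof (rule nn_integral_change_of_variables[OF transition_homeomorphism[OF cd] overlap_open[OF cd] _ _ cont h])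
    show "open ?\<Omega>'" using overlap_open[OF cd(2,1)] by (simp add: Int_commute)
    fix y assume "y \<in> ?\<Omega>"
    then obtain x where "x \<in> fst c" "x \<in> fst d" "y = snd c x" by blast
    then show "(transition c d has_derivative transition_deriv c d (chart_inv c y)) (at y)"
      using transition_has_derivative[OF cd] cd by (simp add: chart_inv_left)
  qed
  also have "\<dots> = chart_vol g c B"
    unfolding chart_vol_density[OF B(2)]
  proof (intro nn_integral_cong)
    fix y
    show "ennreal \<bar>det (matrix (transition_deriv c d (chart_inv c y)))\<bar> * h (transition c d y) * indicator ?\<Omega> y =
      ennreal (density_fn g c y) * indicator (snd c ` B) y"
    proof (cases "y \<in> ?\<Omega>")
      case True
      then obtain x where x: "x \<in> fst c" "x \<in> fst d" "y = snd c x" by blast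
      have "snd d x \<in> snd d ` B \<longleftrightarrow> x \<in> B" "snd c x \<in> snd c ` B \<longleftrightarrow> x \<in> B"
        using inj_on_image_mem_iff[OF chart_inj] x B cd by blast+
      moreover have "density_fn g c y = \<bar>det (matrix (transition_deriv c d x))\<bar> * density_fn g d (snd d x)"
        using det_tensor_matrix_change[OF gm cd x(1,2)] x cd by (simp add: density_fn_def chart_inv_left)
      ultimately show ?thesis
        using True x cd by (auto simp: h_def chart_inv_left transition_at indicator_def ennreal_mult')
    next
      case False
      then show ?thesis using B by (auto simp: indicator_def)
    qed
  qed
  finally show ?thesis by simp
qed

lemma chart_vol_suminf:
  assumes g: "continuous_metric M A g" and c: "c \<in> A" and B: "\<And>i :: nat. B i \<in> sets borel_M" "\<And>i. B i \<subseteq> fst c" "disjoint_family B"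
  shows "(\<Sum>i. chart_vol g c (B i)) = chart_vol g c (\<Union>i. B i)"
proof -
  have [measurable]: "snd c ` B i \<in> sets borel" for i by (rule chart_image_borel[OF c B(1,2)])
  note [measurable] = density_fn_measurable[OF g c]
  have "snd c ` B i \<inter> snd c ` B j = {}" if "i \<noteq> j" for i j
  proof -
    have "B i \<inter> B j = {}" using B(3) that by (simp add: disjoint_family_on_def)
    then show ?thesis using inj_on_image_Int[OF chart_inj[OF c] B(2) B(2), of i j] by simp
  qed
  then have disj: "disjoint_family (\<lambda>i. snd c ` B i)" by (simp add: disjoint_family_on_def)
  have "(\<Sum>i. chart_vol g c (B i)) = (\<Sum>i. \<integral>\<^sup>+y\<in>snd c ` B i. ennreal (density_fn g c y) \<partial>lborel)"
    by (simp add: chart_vol_density B)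
  also have "\<dots> = (\<integral>\<^sup>+y. (\<Sum>i. ennreal (density_fn g c y) * indicator (snd c ` B i) y) \<partial>lborel)"
    by (rule nn_integral_suminf[symmetric]) measurable
  also have "\<dots> = (\<integral>\<^sup>+y\<in>(\<Union>i. snd c ` B i). ennreal (density_fn g c y) \<partial>lborel)"
    by (intro nn_integral_cong) (simp add: suminf_indicator[OF disj] ennreal_suminf_cmult)
  also have "\<dots> = chart_vol g c (\<Union>i. B i)"
    using B by (subst chart_vol_density) (auto simp: image_UN)
  finally show ?thesis .
qed

lemma finite_subcover:
  assumes "compact M" "\<And>x. x \<in> M \<Longrightarrow> openin (top_of_set M) (W x) \<and> x \<in> W x"
  shows "\<exists>F. finite F \<and> F \<subseteq> M \<and> M = (\<Union>x\<in>F. W x)"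
proof -
  have "\<forall>x\<in>M. \<exists>T. open T \<and> W x = M \<inter> T" using assms(2) by (meson openin_open)
  then obtain T where T: "\<And>x. x \<in> M \<Longrightarrow> open (T x) \<and> W x = M \<inter> T x" by metis
  have "M \<subseteq> (\<Union>x\<in>M. T x)" using T assms(2) by blast
  then obtain F where F: "F \<subseteq> M" "finite F" "M \<subseteq> (\<Union>x\<in>F. T x)"
    using compactE_image[OF assms(1), of M T] T by metis
  have "M = (\<Union>x\<in>F. W x)" using F T by blast
  then show ?thesis using F by blast
qed

lemma finite_chart_partition:
  assumes "compact M"
  obtains N :: nat and cs P where "\<And>i. i < N \<Longrightarrow> cs i \<in> A \<and> P i \<in> sets borel_M \<and> P i \<subseteq> fst (cs i)"
    "disjoint_family_on P {..<N}" "(\<Union>i<N. P i) = M"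
proof -
  obtain ch where ch: "\<And>x. x \<in> M \<Longrightarrow> ch x \<in> A \<and> x \<in> fst (ch x)" using chart_cover by metis
  obtain F where F: "finite F" "F \<subseteq> M" "M = (\<Union>x\<in>F. fst (ch x))"
    using finite_subcover[OF assms, of "\<lambda>x. fst (ch x)"] ch chart_openin by metis
  obtain xs where xs: "set xs = F" using finite_list[OF F(1)] by blast
  define N where "N = length xs"
  define cs where "cs i = ch (xs ! i)" for i
  define P where "P i = fst (cs i) - (\<Union>j<i. fst (cs j))" for i
  have cs: "cs i \<in> A" if "i < N" for i using that F(2) xs ch[of "xs ! i"] nth_mem[of i xs] by (auto simp: cs_def N_def)
  have cov: "M = (\<Union>i<N. fst (cs i))"
    unfolding F(3) xs[symmetric] by (auto simp: cs_def N_def set_conv_nth)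
  show ?thesis
  proof (rule that[of N cs P])
    fix i assume i: "i < N"
    have "(\<Union>j<i. fst (cs j)) \<in> sets borel_M"
      using cs i by (intro sets.finite_UN) (auto intro!: chart_domain_sets)
    then show "cs i \<in> A \<and> P i \<in> sets borel_M \<and> P i \<subseteq> fst (cs i)"
      unfolding P_def using cs[OF i] chart_domain_sets by auto
  next
    have "P i \<inter> P j = {}" if "i < j" for i j using that by (auto simp: P_def)
    then show "disjoint_family_on P {..<N}"
      unfolding disjoint_family_on_def by (metis Int_commute linorder_neqE_nat)
  next
    show "(\<Union>i<N. P i) = M"
    proof (rule set_eqI)
      fix x
      show "x \<in> (\<Union>i<N. P i) \<longleftrightarrow> x \<in> M"
      proof
        assume "x \<in> M"
        then have ex: "\<exists>i. i < N \<and> x \<in> fst (cs i)" using cov by blast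
        define i where "i = (LEAST i. i < N \<and> x \<in> fst (cs i))"
        have i: "i < N" "x \<in> fst (cs i)" using LeastI_ex[OF ex] by (auto simp: i_def)
        have "x \<notin> fst (cs j)" if "j < i" for j
          using not_less_Least[of j "\<lambda>i. i < N \<and> x \<in> fst (cs i)"] that i by (auto simp: i_def)
        then show "x \<in> (\<Union>i<N. P i)" using i by (auto simp: P_def)
      next
        assume "x \<in> (\<Union>i<N. P i)"
        then show "x \<in> M" using cov by (auto simp: P_def)
      qed
    qed
  qed
qed

definition is_volume :: "('a, 'n) tensor2 \<Rightarrow> 'a measure \<Rightarrow> bool" where
  "is_volume g V \<longleftrightarrow> sets V = sets borel_M \<and> (\<forall>c\<in>A. \<forall>B\<in>sets V. B \<subseteq> fst c \<longrightarrow> emeasure V B = chart_vol g c B)"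

text \<open>
  A finite Borel partition of \<open>M\<close> into subsets of chart domains defines a measure. By \<open>chart_vol_change\<close> it has the
  right value on a set in any chart, not only in those of the partition.
\<close>

lemma volume_exists:
  assumes g: "continuous_metric M A g" and M: "compact M"
  shows "\<exists>V. is_volume g V"
proof -
  obtain N :: nat and cs P where P: "\<And>i. i < N \<Longrightarrow> cs i \<in> A \<and> P i \<in> sets borel_M \<and> P i \<subseteq> fst (cs i)"
    "disjoint_family_on P {..<N}" "(\<Union>i<N. P i) = M"
    using finite_chart_partition[OF M] by metis
  have dj: "m = n" if "x \<in> P m" "x \<in> P n" "m < N" "n < N" for x m n
    using P(2) that unfolding disjoint_family_on_def by blast
  define \<mu> where "\<mu> B = (\<Sum>i<N. chart_vol g (cs i) (B \<inter> P i))" for B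
  define V where "V = measure_of M (sets borel_M) \<mu>"
  have sa: "sigma_algebra M (sets borel_M)" using sets.sigma_algebra_axioms[of borel_M] by (simp add: space_borel_M)
  have setsV: "sets V = sets borel_M" unfolding V_def using sets.sigma_sets_eq[of borel_M] sets.space_closed[of borel_M]
    by (simp add: space_borel_M)
  have add: "countably_additive (sets borel_M) \<mu>"
    unfolding countably_additive_def
  proof (intro allI impI)
    fix B :: "nat \<Rightarrow> 'a set" assume B: "range B \<subseteq> sets borel_M" "disjoint_family B"
    have "(\<Sum>n. \<mu> (B n)) = (\<Sum>i<N. \<Sum>n. chart_vol g (cs i) (B n \<inter> P i))"
      unfolding \<mu>_def by (rule suminf_sum) (rule summableI)
    also have "\<dots> = (\<Sum>i<N. chart_vol g (cs i) (\<Union>n. B n \<inter> P i))"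
    proof (rule sum.cong[OF HOL.refl])
      fix i assume "i \<in> {..<N}"
      then have i: "i < N" by simp
      show "(\<Sum>n. chart_vol g (cs i) (B n \<inter> P i)) = chart_vol g (cs i) (\<Union>n. B n \<inter> P i)"
        by (rule chart_vol_suminf[OF g]) (use P(1)[OF i] B in \<open>auto simp: disjoint_family_on_def\<close>)
    qed
    finally show "(\<Sum>n. \<mu> (B n)) = \<mu> (\<Union>n. B n)" by (simp add: \<mu>_def)
  qed
  have em: "emeasure V B = \<mu> B" if "B \<in> sets borel_M" for B
    unfolding V_def
    by (rule emeasure_measure_of_sigma[OF sa _ add that]) (simp add: positive_def \<mu>_def chart_vol_def)
  have "emeasure V B = chart_vol g c B" if c: "c \<in> A" and B: "B \<in> sets borel_M" "B \<subseteq> fst c" for c B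
  proof -
    have "\<mu> B = (\<Sum>i<N. chart_vol g c (B \<inter> P i))"
      unfolding \<mu>_def
    proof (rule sum.cong[OF HOL.refl])
      fix i assume "i \<in> {..<N}"
      then have i: "i < N" by simp
      show "chart_vol g (cs i) (B \<inter> P i) = chart_vol g c (B \<inter> P i)"
        by (rule chart_vol_change[OF g]) (use P(1)[OF i] B c in auto)
    qed
    also have "\<dots> = (\<Sum>i. chart_vol g c (if i < N then B \<inter> P i else {}))"
      by (subst suminf_finite[of "{..<N}"]) (auto simp: chart_vol_def)
    also have "\<dots> = chart_vol g c (\<Union>i. if i < N then B \<inter> P i else {})"
      by (rule chart_vol_suminf[OF g c])
         (use P(1) B in \<open>auto simp: disjoint_family_on_def split: if_splits dest: dj\<close>)
    also have "(\<Union>i. if i < N then B \<inter> P i else {}) = B"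
      using P(3) B(1) sets.sets_into_space[OF B(1)] by (auto simp: space_borel_M split: if_splits)
    finally show ?thesis using em[OF B(1)] by simp
  qed
  then have "is_volume g V" by (simp add: is_volume_def setsV)
  then show ?thesis by blast
qed

text \<open>
  On each set of the partition the measure is prescribed by a chart, and a measure is determined by its
  restrictions to the sets of a partition.
\<close>

lemma volume_unique:
  assumes M: "compact M" and V: "is_volume g V" "is_volume g V'"
  shows "V = V'"
proof -
  obtain N :: nat and cs P where P: "\<And>i. i < N \<Longrightarrow> cs i \<in> A \<and> P i \<in> sets borel_M \<and> P i \<subseteq> fst (cs i)"
    "disjoint_family_on P {..<N}" "(\<Union>i<N. P i) = M"
    using finite_chart_partition[OF M] by metis
  have dj: "m = n" if "x \<in> P m" "x \<in> P n" "m < N" "n < N" for x m n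
    using P(2) that unfolding disjoint_family_on_def by blast
  have decomp: "emeasure W B = (\<Sum>i<N. chart_vol g (cs i) (B \<inter> P i))" if W: "is_volume g W" and B: "B \<in> sets borel_M" for W B
  proof -
    have sW: "sets W = sets borel_M" using W by (simp add: is_volume_def)
    have "(\<Sum>i<N. emeasure W (B \<inter> P i)) = emeasure W (\<Union>i<N. B \<inter> P i)"
      by (rule sum_emeasure) (use P(1) B in \<open>auto simp: disjoint_family_on_def sW dest: dj\<close>)
    also have "(\<Union>i<N. B \<inter> P i) = B"
      using P(3) sets.sets_into_space[OF B] by (auto simp: space_borel_M)
    also have "(\<Sum>i<N. emeasure W (B \<inter> P i)) = (\<Sum>i<N. chart_vol g (cs i) (B \<inter> P i))"
    proof (rule sum.cong[OF HOL.refl])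
      fix i assume "i \<in> {..<N}"
      then have "cs i \<in> A" "P i \<in> sets borel_M" "P i \<subseteq> fst (cs i)" using P(1) by auto
      then show "emeasure W (B \<inter> P i) = chart_vol g (cs i) (B \<inter> P i)"
        using W B unfolding is_volume_def by (metis inf.coboundedI2 sets.Int)
    qed
    finally show ?thesis by simp
  qed
  show ?thesis
    by (rule measure_eqI) (use V decomp in \<open>auto simp: is_volume_def\<close>)
qed

lemma riemannian_volume:
  assumes "continuous_metric M A g" "compact M"
  shows "is_volume g (riemannian_volume M A g)"
proof -
  have "riemannian_volume M A g = (THE V. is_volume g V)"
    unfolding riemannian_volume_def is_volume_def chart_vol_def ..
  moreover have "\<exists>!V. is_volume g V"
    using volume_exists[OF assms] volume_unique[OF assms(2)] by blast
  ultimately show ?thesis by (metis theI')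
qed

section \<open>Chart balls and integration in charts\<close>

text \<open>
  A cone of length \<open>r\<close> from a point of \<open>ball a r\<close> stays in \<open>ball a (2 * r)\<close>. That the closed ball lies in
  the image of the chart gives two-sided bounds for the density by compactness.
\<close>

definition good_ball :: "('a, 'n) chart \<Rightarrow> real^'n \<Rightarrow> real \<Rightarrow> bool" where
  "good_ball c a r \<longleftrightarrow> c \<in> A \<and> 0 < r \<and> cball a (2 * r) \<subseteq> snd c ` fst c"

lemma good_ball_subset:
  assumes "good_ball c a r" "s \<le> 2 * r"
  shows "ball a s \<subseteq> snd c ` fst c"
proof -
  have "ball a s \<subseteq> cball a (2 * r)" using assms(2) by auto
  then show ?thesis using assms(1) unfolding good_ball_def by blast
qed

lemma good_ball_cover:
  assumes "compact M"
  obtains F where "finite F" "\<And>c a r. (c, a, r) \<in> F \<Longrightarrow> good_ball c a r" "M = (\<Union>(c, a, r)\<in>F. chart_inv c ` ball a r)"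
proof -
  have "\<exists>c a r. good_ball c a r \<and> x \<in> chart_inv c ` ball a r" if x: "x \<in> M" for x
  proof -
    obtain c r where c: "c \<in> A" "x \<in> fst c" "0 < r" "cball (snd c x) r \<subseteq> snd c ` fst c"
      using chart_ball[OF x] by metis
    have "x = chart_inv c (snd c x)" using c by (simp add: chart_inv_left)
    then have "x \<in> chart_inv c ` ball (snd c x) (r / 2)" using c(3) by (intro image_eqI[of _ _ "snd c x"]) auto
    moreover have "good_ball c (snd c x) (r / 2)" using c by (simp add: good_ball_def)
    ultimately show ?thesis by blast
  qed
  then obtain c a r where car: "\<And>x. x \<in> M \<Longrightarrow> good_ball (c x) (a x) (r x) \<and> x \<in> chart_inv (c x) ` ball (a x) (r x)"
    by metis
  have op: "openin (top_of_set M) (chart_inv (c x) ` ball (a x) (r x))" if "x \<in> M" for x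
    using car[OF that] by (intro chart_inv_image_openin good_ball_subset) (auto simp: good_ball_def)
  have "\<exists>F. finite F \<and> F \<subseteq> M \<and> M = (\<Union>x\<in>F. chart_inv (c x) ` ball (a x) (r x))"
    by (rule finite_subcover[OF assms]) (use car op in blast)
  then obtain F where F: "finite F" "F \<subseteq> M" "M = (\<Union>x\<in>F. chart_inv (c x) ` ball (a x) (r x))"
    by blast
  show ?thesis
  proof (rule that[of "(\<lambda>x. (c x, a x, r x)) ` F"])
    show "finite ((\<lambda>x. (c x, a x, r x)) ` F)" using F(1) by simp
    show "good_ball c' a' r'" if "(c', a', r') \<in> (\<lambda>x. (c x, a x, r x)) ` F" for c' a' r'
      using that car F(2) by auto
    have "(\<Union>(c, a, r)\<in>(\<lambda>x. (c x, a x, r x)) ` F. chart_inv c ` ball a r) = (\<Union>x\<in>F. chart_inv (c x) ` ball (a x) (r x))"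
      by simp
    then show "M = (\<Union>(c, a, r)\<in>(\<lambda>x. (c x, a x, r x)) ` F. chart_inv c ` ball a r)"
      using F(3) by metis
  qed
qed

lemma snd_chart_inv_image:
  assumes "c \<in> A" "Y \<subseteq> snd c ` fst c"
  shows "snd c ` chart_inv c ` Y = Y" "chart_inv c ` Y \<subseteq> fst c"
proof -
  have "snd c (chart_inv c y) = y" if "y \<in> Y" for y using chart_inv_right[OF assms(1)] that assms(2) by blast
  then show "snd c ` chart_inv c ` Y = Y" by (force simp: image_iff)
  show "chart_inv c ` Y \<subseteq> fst c" using chart_inv_in[OF assms(1)] assms(2) by blast
qed

context
  fixes g :: "('a, 'n) tensor2"
  assumes g: "continuous_metric M A g" and M: "compact M"
begin

abbreviation vol :: "'a measure" where "vol \<equiv> riemannian_volume M A g"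

lemma sets_vol: "sets vol = sets borel_M"
  and emeasure_vol_chart: "c \<in> A \<Longrightarrow> B \<in> sets borel_M \<Longrightarrow> B \<subseteq> fst c \<Longrightarrow> emeasure vol B = chart_vol g c B"
  using riemannian_volume[OF g M] by (auto simp: is_volume_def)

lemma space_vol: "space vol = M"
  using sets_eq_imp_space_eq[OF sets_vol] by (simp add: space_borel_M)

lemma M_sets_vol: "M \<in> sets vol"
  using sets.top[of vol] by (simp add: space_vol)

lemma density_bounds:
  assumes "good_ball c a r"
  obtains l u where "0 < l" "\<And>y. y \<in> cball a (2 * r) \<Longrightarrow> l \<le> density_fn g c y \<and> density_fn g c y \<le> u"
proof -
  have c: "c \<in> A" and sub: "cball a (2 * r) \<subseteq> snd c ` fst c" and ne: "cball a (2 * r) \<noteq> {}"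
    using assms by (auto simp: good_ball_def)
  have cont: "continuous_on (cball a (2 * r)) (density_fn g c)"
    by (rule continuous_on_subset[OF continuous_density_fn[OF g c] sub])
  obtain y0 where y0: "y0 \<in> cball a (2 * r)" "\<forall>y\<in>cball a (2 * r). density_fn g c y0 \<le> density_fn g c y"
    using continuous_attains_inf[OF compact_cball ne cont] by blast
  obtain y1 where y1: "\<forall>y\<in>cball a (2 * r). density_fn g c y \<le> density_fn g c y1"
    using continuous_attains_sup[OF compact_cball ne cont] by blast
  show ?thesis
    by (rule that[of "density_fn g c y0" "density_fn g c y1"]) (use y0 y1 density_fn_pos[OF g c] sub in auto)
qed

lemma vol_ball_finite:
  assumes "good_ball c a r"
  shows "emeasure vol (chart_inv c ` ball a r) < \<infinity>"
proof -
  have c: "c \<in> A" and r: "0 < r" and sub: "ball a r \<subseteq> snd c ` fst c"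
    using assms good_ball_subset[OF assms, of r] by (auto simp: good_ball_def)
  obtain l u where lu: "\<And>y. y \<in> cball a (2 * r) \<Longrightarrow> l \<le> density_fn g c y \<and> density_fn g c y \<le> u"
    using density_bounds[OF assms] by metis
  have "emeasure vol (chart_inv c ` ball a r) = (\<integral>\<^sup>+y\<in>ball a r. ennreal (density_fn g c y) \<partial>lborel)"
    using emeasure_vol_chart[OF c chart_inv_image_sets[OF c _ sub]] snd_chart_inv_image[OF c sub]
    by (simp add: chart_vol_density)
  also have "\<dots> \<le> (\<integral>\<^sup>+y. ennreal u * indicator (ball a r) y \<partial>lborel)"
    using lu r by (intro nn_integral_mono) (auto simp: indicator_def intro!: ennreal_leI)
  also have "\<dots> = ennreal u * emeasure lborel (ball a r)"
    by (rule nn_integral_cmult_indicator) simp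
  also have "\<dots> < \<infinity>" using r by (simp add: emeasure_ball ennreal_mult_less_top)
  finally show ?thesis .
qed

lemma vol_finite: "finite_measure vol"
proof (rule finite_measureI)
  obtain F where F: "finite F" "\<And>c a r. (c, a, r) \<in> F \<Longrightarrow> good_ball c a r" "M = (\<Union>(c, a, r)\<in>F. chart_inv c ` ball a r)"
    using good_ball_cover[OF M] by metis
  have "chart_inv c ` ball a r \<in> sets vol" if "(c, a, r) \<in> F" for c a r
    unfolding sets_vol using F(2)[OF that] good_ball_subset[OF F(2)[OF that], of r]
    by (intro chart_inv_image_sets) (auto simp: good_ball_def)
  then have "emeasure vol (\<Union>i\<in>F. (\<lambda>(c, a, r). chart_inv c ` ball a r) i) \<le> (\<Sum>i\<in>F. emeasure vol ((\<lambda>(c, a, r). chart_inv c ` ball a r) i))"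
    by (intro emeasure_subadditive_finite F(1)) auto
  also have "\<dots> < \<infinity>"
    using vol_ball_finite F(1,2) by (auto simp: ennreal_sum_less_top)
  finally show "emeasure vol (space vol) \<noteq> \<infinity>"
    unfolding space_vol F(3)[symmetric] by simp
qed

lemma vol_null_chart:
  assumes c: "c \<in> A" and X: "X \<in> sets borel_M" "X \<subseteq> fst c" "negligible (snd c ` X)"
  shows "emeasure vol X = 0"
proof -
  have "snd c ` X \<in> sets borel" by (rule chart_image_borel[OF c X(1,2)])
  then have "snd c ` X \<in> null_sets lborel"
    using X(3) by (simp add: negligible_iff_null_sets null_sets_def)
  then show ?thesis
    unfolding emeasure_vol_chart[OF c X(1,2)] chart_vol_def by (rule nn_integral_null_set)
qed

text \<open>
  The density is bounded below on the ball by some \<open>l > 0\<close>, so Lebesgue measure there is at most \<open>1 / l\<close>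
  times the volume measure in coordinates, for sets and hence for functions.
\<close>

lemma chart_pullback_le:
  assumes "good_ball c a r"
  obtains C where "0 < C" "\<And>h. h \<in> borel_measurable borel_M \<Longrightarrow>
     (\<integral>\<^sup>+y\<in>ball a (2 * r). h (chart_inv c y) \<partial>lborel) \<le> ennreal C * (\<integral>\<^sup>+x. h x \<partial>vol)"
proof -
  let ?B = "ball a (2 * r)"
  have c: "c \<in> A" and r: "0 < r" and sub: "?B \<subseteq> snd c ` fst c"
    using assms good_ball_subset[OF assms, of "2 * r"] by (auto simp: good_ball_def)
  obtain l u where lu: "0 < l" "\<And>y. y \<in> cball a (2 * r) \<Longrightarrow> l \<le> density_fn g c y \<and> density_fn g c y \<le> u"
    using density_bounds[OF assms] by metis
  note [measurable] = density_fn_measurable[OF g c]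
  have a: "a \<in> ?B" using r by simp
  \<comment> \<open>The inverse chart, continued by a constant so that it is measurable on the whole space.\<close>
  define \<psi> where "\<psi> y = (if y \<in> ?B then chart_inv c y else chart_inv c a)" for y
  have B_borel [measurable]: "?B \<in> sets borel" by simp
  have \<psi>_M: "\<psi> y \<in> M" for y
  proof -
    have "a \<in> snd c ` fst c" "y \<in> ?B \<Longrightarrow> y \<in> snd c ` fst c" using sub a by blast+
    then show ?thesis using chart_inv_in_M[OF c] by (simp add: \<psi>_def)
  qed
  have \<psi> [measurable]: "\<psi> \<in> measurable lborel borel_M"
  proof -
    have "(\<lambda>y. if y \<in> ?B then chart_inv c y else chart_inv c a) \<in> borel_measurable borel"
    proof (rule measurable_If_restrict_space_iff[THEN iffD2, OF _ conjI])
      show "{x \<in> space borel. x \<in> ?B} \<in> sets borel" by simp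
      have "continuous_on ?B (chart_inv c)" by (rule continuous_on_subset[OF chart_inv_continuous[OF c] sub])
      then show "chart_inv c \<in> borel_measurable (restrict_space borel {x. x \<in> ?B})"
        unfolding Collect_mem_eq by (rule borel_measurable_continuous_on_restrict)
    qed simp
    then show ?thesis using \<psi>_M by (intro measurable_restrict_space2) (auto simp: \<psi>_def[abs_def])
  qed
  \<comment> \<open>The part of the volume that lies in the ball, as an image measure.\<close>
  define \<nu> where "\<nu> = distr (density lborel (\<lambda>y. ennreal (density_fn g c y) * indicator ?B y)) borel_M \<psi>"
  have "\<nu> \<le> vol"
    unfolding le_measure_iff
  proof (simp add: \<nu>_def sets_vol space_vol space_borel_M, rule le_funI)
    fix X
    show "emeasure (distr (density lborel (\<lambda>y. ennreal (density_fn g c y) * indicator ?B y)) borel_M \<psi>) X \<le> emeasure vol X"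
    proof (cases "X \<in> sets borel_M")
      case True
      let ?Y = "?B \<inter> \<psi> -` X"
      have Y: "?Y \<in> sets borel" using measurable_sets[OF \<psi> True] by simp
      have Ysub: "?Y \<subseteq> snd c ` fst c" using sub by blast
      have "emeasure (distr (density lborel (\<lambda>y. ennreal (density_fn g c y) * indicator ?B y)) borel_M \<psi>) X =
         (\<integral>\<^sup>+y. ennreal (density_fn g c y) * indicator ?B y * indicator (\<psi> -` X) y \<partial>lborel)"
        using True measurable_sets[OF \<psi> True] by (simp add: emeasure_distr emeasure_density)
      also have "\<dots> = (\<integral>\<^sup>+y\<in>?Y. ennreal (density_fn g c y) \<partial>lborel)"
        by (intro nn_integral_cong) (auto simp: indicator_def)
      also have "\<dots> = emeasure vol (chart_inv c ` ?Y)"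
        using emeasure_vol_chart[OF c chart_inv_image_sets[OF c Y Ysub]] snd_chart_inv_image[OF c Ysub]
        by (simp add: chart_vol_density)
      also have "\<dots> \<le> emeasure vol X"
        using True by (intro emeasure_mono) (auto simp: \<psi>_def sets_vol)
      finally show ?thesis .
    qed (simp add: emeasure_notin_sets)
  qed
  moreover have "sets \<nu> = sets vol" by (simp add: \<nu>_def sets_vol)
  ultimately have mono: "nn_integral \<nu> h \<le> nn_integral vol h" for h by (rule nn_integral_mono_measure[rotated])
  show ?thesis
  proof (rule that[of "1 / l"])
    fix h :: "'a \<Rightarrow> ennreal" assume h [measurable]: "h \<in> borel_measurable borel_M"
    have hm [measurable]: "(\<lambda>y. h (\<psi> y)) \<in> borel_measurable lborel" by (rule measurable_compose[OF \<psi> h])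
    have "ennreal l * (\<integral>\<^sup>+y\<in>?B. h (chart_inv c y) \<partial>lborel) = ennreal l * (\<integral>\<^sup>+y\<in>?B. h (\<psi> y) \<partial>lborel)"
    proof -
      have "(\<integral>\<^sup>+y\<in>?B. h (chart_inv c y) \<partial>lborel) = (\<integral>\<^sup>+y\<in>?B. h (\<psi> y) \<partial>lborel)"
        by (intro nn_integral_cong) (simp add: \<psi>_def indicator_def)
      then show ?thesis by simp
    qed
    also have "\<dots> = (\<integral>\<^sup>+y. ennreal l * (h (\<psi> y) * indicator ?B y) \<partial>lborel)"
      by (rule nn_integral_cmult[symmetric]) measurable
    also have "\<dots> \<le> (\<integral>\<^sup>+y. ennreal (density_fn g c y) * indicator ?B y * h (\<psi> y) \<partial>lborel)"
    proof (intro nn_integral_mono)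
      fix y
      show "ennreal l * (h (\<psi> y) * indicator ?B y) \<le> ennreal (density_fn g c y) * indicator ?B y * h (\<psi> y)"
        using lu(2)[of y] by (cases "y \<in> ?B") (auto intro!: mult_right_mono ennreal_leI)
    qed
    also have "\<dots> = (\<integral>\<^sup>+x. h x \<partial>\<nu>)"
      unfolding \<nu>_def by (simp add: nn_integral_distr nn_integral_density)
    also have "\<dots> \<le> (\<integral>\<^sup>+x. h x \<partial>vol)" by (rule mono)
    finally have "ennreal (1 / l) * (ennreal l * (\<integral>\<^sup>+y\<in>?B. h (chart_inv c y) \<partial>lborel)) \<le> ennreal (1 / l) * (\<integral>\<^sup>+x. h x \<partial>vol)"
      by (intro mult_left_mono) simp_all
    then show "(\<integral>\<^sup>+y\<in>?B. h (chart_inv c y) \<partial>lborel) \<le> ennreal (1 / l) * (\<integral>\<^sup>+x. h x \<partial>vol)"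
      using lu(1) by (simp add: mult.assoc[symmetric] ennreal_mult[symmetric])
  qed (use lu in simp)
qed

lemma continuous_measurable_vol:
  fixes f :: "'a \<Rightarrow> real"
  assumes "continuous_on M f"
  shows "f \<in> borel_measurable borel_M"
  by (rule borel_measurable_continuous_on_restrict[OF assms])

lemma integrable_continuous_vol:
  fixes f :: "'a \<Rightarrow> real"
  assumes f: "continuous_on M f"
  shows "integrable vol f"
proof -
  interpret finite_measure vol by (rule vol_finite)
  obtain B where B: "\<And>x. x \<in> M \<Longrightarrow> norm (f x) \<le> B"
    using compact_imp_bounded[OF compact_continuous_image[OF f M]] by (auto simp: bounded_iff)
  show ?thesis
  proof (rule integrable_const_bound[of _ B])
    show "AE x in vol. norm (f x) \<le> B" using B by (auto simp: space_vol)
    show "f \<in> borel_measurable vol" using continuous_measurable_vol[OF f] by (simp cong: measurable_cong_sets add: sets_vol)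
  qed
qed

text \<open>
  The Bochner integral in the definition of the \<open>L\<^sup>p\<close> norm is an honest integral, because the integrand is
  continuous on a compact space.
\<close>

lemma nn_integral_eq_Lp:
  assumes f: "continuous_on M f" "\<And>x. x \<in> M \<Longrightarrow> 0 \<le> f x" and p: "0 < p"
  shows "(\<integral>\<^sup>+x. ennreal (f x powr p) \<partial>vol) = ennreal (((LINT x|vol. f x powr p) powr (1 / p)) powr p)"
proof -
  have "continuous_on M (\<lambda>x. f x powr p)"
    by (rule continuous_on_powr') (use f p in \<open>auto intro: continuous_intros\<close>)
  then have "integrable vol (\<lambda>x. f x powr p)" by (rule integrable_continuous_vol)
  then have "(\<integral>\<^sup>+x. ennreal (f x powr p) \<partial>vol) = ennreal (LINT x|vol. f x powr p)"
    by (rule nn_integral_eq_integral) simp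
  also have "0 \<le> (LINT x|vol. f x powr p)" by (rule integral_nonneg_AE) simp
  then have "(LINT x|vol. f x powr p) = ((LINT x|vol. f x powr p) powr (1 / p)) powr p"
    using p by (simp add: powr_powr)
  finally show ?thesis .
qed

end

section \<open>The norm of the difference of two metrics\<close>

lemma bilinear_form_diff:
  assumes "metric_tensor M A g" "metric_tensor M A g0" "c \<in> A" "x \<in> fst c"
  shows "bilinear (form (\<lambda>x u v. g x u v - g0 x u v) c x)"
  using metric_bilinear[OF assms(1,3,4)] metric_bilinear[OF assms(2,3,4)]
  unfolding bilinear_def form_def by (auto intro: linear_compose_sub)

lemma tensor_matrix_diff:
  "tensor_matrix A (\<lambda>x u v. g x u v - g0 x u v) c x = tensor_matrix A g c x - tensor_matrix A g0 c x"
  by (simp add: tensor_matrix_def vec_eq_iff)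

text \<open>
  In a chart the norm is the explicit expression of \<open>frame_norm_square\<close> in the tensor matrices, which
  are continuous.
\<close>

lemma continuous_tensor_norm_diff:
  assumes g: "continuous_metric M A g" and g0: "continuous_metric M A g0"
  shows "continuous_on M (tensor_norm A g0 (\<lambda>x u v. g x u v - g0 x u v))"
  unfolding continuous_on_eq_continuous_within
proof
  let ?h = "\<lambda>x u v. g x u v - g0 x u v"
  fix x assume "x \<in> M"
  then obtain c where c: "c \<in> A" "x \<in> fst c" using chart_cover by blast
  have gm: "metric_tensor M A g" "metric_tensor M A g0"
    and cont: "continuous_on (fst c) (tensor_matrix A g c)" "continuous_on (fst c) (tensor_matrix A g0 c)"
    using g g0 c by (auto simp: continuous_metric_def)
  have inv: "invertible (tensor_matrix A g0 c y)" if "y \<in> fst c" for y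
    using pos_def_det_pos[OF metric_pos_def[OF gm(2) c(1) that]] invertible_det_nz by (metis less_irrefl)
  have "continuous_on (fst c) (\<lambda>y. sqrt (\<Sum>a\<in>UNIV. \<Sum>b\<in>UNIV. \<Sum>a'\<in>UNIV. \<Sum>b'\<in>UNIV.
       tensor_matrix A ?h c y $ a $ b * tensor_matrix A ?h c y $ a' $ b' *
       matrix_inv (tensor_matrix A g0 c y) $ a $ a' * matrix_inv (tensor_matrix A g0 c y) $ b $ b'))"
    unfolding tensor_matrix_diff
    by (intro continuous_intros continuous_on_matrix_inv_nth cont inv)
  then have "continuous_on (fst c) (tensor_norm A g0 ?h)"
  proof (rule continuous_on_eq)
    fix y assume y: "y \<in> fst c"
    show "sqrt (\<Sum>a\<in>UNIV. \<Sum>b\<in>UNIV. \<Sum>a'\<in>UNIV. \<Sum>b'\<in>UNIV.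
       tensor_matrix A ?h c y $ a $ b * tensor_matrix A ?h c y $ a' $ b' *
       matrix_inv (tensor_matrix A g0 c y) $ a $ a' * matrix_inv (tensor_matrix A g0 c y) $ b $ b') = tensor_norm A g0 ?h y"
      by (rule tensor_norm_frame[OF gm(2) c(1) y bilinear_form_diff[OF gm c(1) y]])
         (simp add: frame_norm_square)
  qed
  then have "continuous (at x within fst c) (tensor_norm A g0 ?h)"
    using c by (simp add: continuous_on_eq_continuous_within)
  moreover obtain T where T: "open T" "fst c = M \<inter> T" using chart_openin[OF c(1)] by (auto simp: openin_open)
  have "at x within fst c = at x within M"
    by (rule at_within_nhd[of _ T]) (use T c in auto)
  ultimately show "continuous (at x within M) (tensor_norm A g0 ?h)" by simp
qed

lemma tensor_norm_nonneg: "0 \<le> tensor_norm A g h x"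
  by (simp add: tensor_norm_def Let_def sum_nonneg)

lemma metric_le_tensor_norm:
  assumes g: "metric_tensor M A g" and g0: "metric_tensor M A g0" and x: "x \<in> M" "v \<in> tangent_space A x"
  shows "g x v v \<le> (1 + tensor_norm A g0 (\<lambda>x u v. g x u v - g0 x u v) x) * g0 x v v"
proof -
  let ?h = "\<lambda>x u v. g x u v - g0 x u v"
  obtain c where c: "c \<in> A" "x \<in> fst c" using chart_cover x by blast
  obtain E :: "real^'n^'n" where E: "transpose E ** tensor_matrix A g0 c x ** E = mat 1"
    "tensor_norm A g0 ?h x = sqrt (\<Sum>i\<in>UNIV. \<Sum>j\<in>UNIV. (column i E \<bullet> (tensor_matrix A ?h c x *v column j E))\<^sup>2)"
    by (rule tensor_norm_frame[OF g0 c bilinear_form_diff[OF g g0 c]])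
  have "v c \<bullet> (tensor_matrix A ?h c x *v v c) \<le> tensor_norm A g0 ?h x * (v c \<bullet> (tensor_matrix A g0 c x *v v c))"
    using frame_norm_bound[OF E(1), of "v c" "tensor_matrix A ?h c x"] unfolding E(2) by linarith
  then show ?thesis
    using metric_tangent[OF g c x(2,2)] metric_tangent[OF g0 c x(2,2)]
    by (simp add: tensor_matrix_diff matrix_vector_mult_diff_rdistrib inner_diff_right distrib_right)
qed

end

section \<open>Almost constant metrics\<close>

lemma integral_reflect_unit:
  fixes h :: "real \<Rightarrow> real"
  assumes "h integrable_on {0..1}"
  shows "((\<lambda>t. h (1 - t)) has_integral integral {0..1} h) {0..1}"
proof -
  have "(h has_integral integral {0..1} h) (cbox 0 1)" using assms by (simp add: integrable_integral)
  from has_integral_affinity[OF this, of "-1" 1]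
  have "((\<lambda>t. h (1 - t)) has_integral integral {0..1} h) ((\<lambda>x. - x + 1) ` {0..1})"
    by simp
  moreover have "(\<lambda>x. - x + 1) ` {0..1} = {0..1 :: real}"
  proof -
    have "x = - (1 - x) + 1" "1 - x \<in> {0..1} \<longleftrightarrow> x \<in> {0..1}" for x :: real by auto
    then show ?thesis by (force simp: image_iff)
  qed
  ultimately show ?thesis by simp
qed

lemma nn_integral_unit_interval:
  fixes h :: "real \<Rightarrow> real"
  assumes "continuous_on {0..1} h" "\<And>t. t \<in> {0..1} \<Longrightarrow> 0 \<le> h t"
  shows "(\<integral>\<^sup>+t\<in>{0..1}. ennreal (h t) \<partial>lborel) = ennreal (integral {0..1} h)"
  by (rule nn_integral_has_integral_lebesgue'[OF assms(2)])
     (simp_all add: integrable_integral integrable_continuous_interval assms(1))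

lemma quadratic_form_le:
  fixes B :: "real^'n^'n"
  shows "\<bar>u \<bullet> (B *v u)\<bar> \<le> (\<Sum>i\<in>UNIV. \<Sum>j\<in>UNIV. \<bar>B $ i $ j\<bar>) * (norm u)\<^sup>2"
proof -
  have "\<bar>u \<bullet> (B *v u)\<bar> = \<bar>\<Sum>i\<in>UNIV. \<Sum>j\<in>UNIV. u $ i * (B $ i $ j * u $ j)\<bar>"
    by (simp add: inner_vec_def matrix_vector_mult_def sum_distrib_left)
  also have "\<dots> \<le> (\<Sum>i\<in>UNIV. \<Sum>j\<in>UNIV. \<bar>u $ i * (B $ i $ j * u $ j)\<bar>)"
    by (rule order_trans[OF sum_abs]) (intro sum_mono sum_abs)
  also have "\<dots> \<le> (\<Sum>i\<in>UNIV. \<Sum>j\<in>UNIV. \<bar>B $ i $ j\<bar> * (norm u)\<^sup>2)"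
  proof (intro sum_mono)
    fix i j
    have "\<bar>u $ i\<bar> * \<bar>u $ j\<bar> \<le> norm u * norm u"
      by (intro mult_mono component_le_norm_cart) auto
    then have "\<bar>B $ i $ j\<bar> * (\<bar>u $ i\<bar> * \<bar>u $ j\<bar>) \<le> \<bar>B $ i $ j\<bar> * (norm u * norm u)"
      by (rule mult_left_mono) simp
    then show "\<bar>u $ i * (B $ i $ j * u $ j)\<bar> \<le> \<bar>B $ i $ j\<bar> * (norm u)\<^sup>2"
      by (simp add: abs_mult power2_eq_square mult.left_commute)
  qed
  finally show ?thesis by (simp add: sum_distrib_right)
qed

text \<open>
  Freezing the metric at \<open>b\<close> gives the Euclidean norm of \<open>P *v u\<close>. By continuity the metric differs from
  it by a small multiple of \<open>norm u ^ 2\<close> nearby, and \<open>norm u\<close> is controlled by \<open>norm (P *v u)\<close> because \<open>P\<close> is injective.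
\<close>

lemma near_constant_norm:
  fixes G :: "real^'n \<Rightarrow> real^'n^'n"
  assumes cont: "continuous_on S G" and S: "open S" "b \<in> S" and pd: "pos_def (G b)" and \<epsilon>: "0 < \<epsilon>"
  obtains P :: "real^'n^'n" and \<rho> where "0 < \<rho>" "ball b \<rho> \<subseteq> S"
    "\<And>y u. y \<in> ball b \<rho> \<Longrightarrow> norm (P *v u) \<le> (1 + \<epsilon>) * sqrt (u \<bullet> (G y *v u))"
    "\<And>y u. y \<in> ball b \<rho> \<Longrightarrow> sqrt (u \<bullet> (G y *v u)) \<le> (1 + \<epsilon>) * norm (P *v u)"
proof -
  obtain P :: "real^'n^'n" where P: "invertible P" "\<And>u. u \<bullet> (G b *v u) = (norm (P *v u))\<^sup>2"
    using pos_def_norm[OF pd] by blast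
  have "inj ((*v) P)" using P(1) by (simp add: inj_matrix_vector_mult)
  then obtain B where B: "B > 0" "\<And>u. B * norm u \<le> norm (P *v u)"
    using linear_inj_bounded_below_pos[of "(*v) P"] by auto
  \<comment> \<open>Chosen so that \<open>(1 + \<epsilon>) (1 - \<tau>) = 1\<close>, hence \<open>1 / (1 - \<tau>) \<le> (1 + \<epsilon>)\<^sup>2\<close>.\<close>
  define \<tau> where "\<tau> = \<epsilon> / (1 + \<epsilon>)"
  have \<tau>: "0 < \<tau>" "\<tau> < 1" "\<tau> \<le> \<epsilon>" "(1 + \<epsilon>) * (1 - \<tau>) = 1"
    using \<epsilon> by (auto simp: \<tau>_def field_simps)
  define \<omega> where "\<omega> y = (\<Sum>i\<in>UNIV. \<Sum>j\<in>UNIV. \<bar>(G y - G b) $ i $ j\<bar>)" for y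
  have "continuous_on S \<omega>" unfolding \<omega>_def by (intro continuous_intros cont)
  then have "continuous (at b) \<omega>" using S by (simp add: continuous_on_eq_continuous_at)
  then have "(\<omega> \<longlongrightarrow> \<omega> b) (at b)" by (simp add: continuous_at)
  moreover have "\<omega> b < \<tau> * B\<^sup>2" using \<tau> B by (simp add: \<omega>_def)
  ultimately have "\<forall>\<^sub>F y in at b. \<omega> y < \<tau> * B\<^sup>2" by (rule order_tendstoD)
  then obtain d where d: "d > 0" "\<And>y. y \<noteq> b \<Longrightarrow> dist y b < d \<Longrightarrow> \<omega> y < \<tau> * B\<^sup>2"
    unfolding eventually_at by auto
  obtain e where e: "e > 0" "ball b e \<subseteq> S" using S openE by blast
  have main: "\<bar>u \<bullet> (G y *v u) - (norm (P *v u))\<^sup>2\<bar> \<le> \<tau> * (norm (P *v u))\<^sup>2" if y: "y \<in> ball b (min d e)" for y u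
  proof -
    have \<omega>: "\<omega> y \<le> \<tau> * B\<^sup>2"
      using d(2)[of y] y \<open>\<omega> b < \<tau> * B\<^sup>2\<close> by (cases "y = b") (auto simp: dist_commute intro: less_imp_le)
    have "\<bar>u \<bullet> (G y *v u) - (norm (P *v u))\<^sup>2\<bar> = \<bar>u \<bullet> ((G y - G b) *v u)\<bar>"
      by (simp add: matrix_vector_mult_diff_rdistrib inner_diff_right P(2))
    also have "\<dots> \<le> \<omega> y * (norm u)\<^sup>2" unfolding \<omega>_def by (rule quadratic_form_le)
    also have "\<dots> \<le> \<tau> * B\<^sup>2 * (norm u)\<^sup>2" using \<omega> by (rule mult_right_mono) simp
    also have "\<dots> = \<tau> * (B * norm u)\<^sup>2" by (simp add: power_mult_distrib)
    also have "\<dots> \<le> \<tau> * (norm (P *v u))\<^sup>2"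
      using B \<tau> by (intro mult_left_mono power_mono) auto
    finally show ?thesis .
  qed
  show ?thesis
  proof (rule that[of "min d e" P])
    show "0 < min d e" "ball b (min d e) \<subseteq> S" using d e by auto
    fix y u assume y: "y \<in> ball b (min d e)"
    let ?Q = "u \<bullet> (G y *v u)" and ?N = "norm (P *v u)"
    have "(1 - \<tau>) * ?N\<^sup>2 \<le> ?Q" using main[OF y, of u] by (simp add: algebra_simps)
    then have "(1 + \<epsilon>) * ((1 - \<tau>) * ?N\<^sup>2) \<le> (1 + \<epsilon>) * ?Q" using \<epsilon> by (intro mult_left_mono) auto
    then have 1: "?N\<^sup>2 \<le> (1 + \<epsilon>) * ?Q" using \<tau>(4) by (simp add: mult.assoc[symmetric])
    have Q0: "0 \<le> ?Q" using \<open>(1 - \<tau>) * ?N\<^sup>2 \<le> ?Q\<close> \<tau> by (smt (verit) mult_nonneg_nonneg zero_le_power2)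
    have "?N\<^sup>2 \<le> (1 + \<epsilon>)\<^sup>2 * ?Q"
    proof -
      have "0 \<le> \<epsilon> * ?Q" "0 \<le> \<epsilon> * (\<epsilon> * ?Q)" using Q0 \<epsilon> by auto
      moreover have "(1 + \<epsilon>)\<^sup>2 * ?Q = (1 + \<epsilon>) * ?Q + \<epsilon> * ?Q + \<epsilon> * (\<epsilon> * ?Q)"
        by (simp add: power2_eq_square algebra_simps)
      ultimately show ?thesis using 1 by linarith
    qed
    then have "sqrt (?N\<^sup>2) \<le> sqrt ((1 + \<epsilon>)\<^sup>2 * ?Q)" by (rule real_sqrt_le_mono)
    then show "?N \<le> (1 + \<epsilon>) * sqrt ?Q" using \<epsilon> by (simp add: real_sqrt_mult)
    have "?Q \<le> (1 + \<tau>) * ?N\<^sup>2" using main[OF y, of u] by (simp add: algebra_simps)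
    also have "\<dots> \<le> (1 + \<epsilon>)\<^sup>2 * ?N\<^sup>2"
    proof (rule mult_right_mono)
      have "(1 + \<epsilon>)\<^sup>2 = 1 + 2 * \<epsilon> + \<epsilon> * \<epsilon>" by (simp add: power2_eq_square algebra_simps)
      moreover have "0 \<le> \<epsilon> * \<epsilon>" by simp
      ultimately show "1 + \<tau> \<le> (1 + \<epsilon>)\<^sup>2" using \<tau>(3) \<epsilon> by linarith
    qed simp
    finally have "sqrt ?Q \<le> sqrt ((1 + \<epsilon>)\<^sup>2 * ?N\<^sup>2)" by (rule real_sqrt_le_mono)
    then show "sqrt ?Q \<le> (1 + \<epsilon>) * ?N" using \<epsilon> by (simp add: real_sqrt_mult)
  qed
qed

section \<open>Tame points\<close>

text \<open>
  The situation after passage to a fast subsequence. The function \<open>f k\<close> stands for the norm of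
  \<open>g k - g0\<close> and \<open>(\<kappa> k)\<^sup>2\<close> for the factor in the lower bound; \<open>balls\<close> is a finite cover of \<open>M\<close> by chart balls.
\<close>

locale pinched_metrics = smooth_atlas M A
  for M :: "'a::t2_space set" and A :: "('a, 'n::finite) chart set" +
  fixes g0 :: "('a, 'n) tensor2" and g :: "nat \<Rightarrow> ('a, 'n) tensor2"
    and f :: "nat \<Rightarrow> 'a \<Rightarrow> real" and \<kappa> :: "nat \<Rightarrow> real" and p :: real
    and balls :: "(('a, 'n) chart \<times> (real^'n) \<times> real) set"
  assumes compact_M: "compact M" and connected_M: "connected M"
    and g0: "continuous_metric M A g0" and g: "\<And>k. continuous_metric M A (g k)"
    and lower: "\<And>k x v. x \<in> M \<Longrightarrow> v \<in> tangent_space A x \<Longrightarrow> (\<kappa> k)\<^sup>2 * g0 x v v \<le> g k x v v"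
    and \<kappa>_nonneg: "\<And>k. 0 \<le> \<kappa> k" and \<kappa>_lim: "\<kappa> \<longlonglongrightarrow> 1"
    and upper: "\<And>k x v. x \<in> M \<Longrightarrow> v \<in> tangent_space A x \<Longrightarrow> g k x v v \<le> (1 + f k x) * g0 x v v"
    and f_cont: "\<And>k. continuous_on M (f k)" and f_nonneg: "\<And>k x. x \<in> M \<Longrightarrow> 0 \<le> f k x"
    and f_small: "\<And>k. (\<integral>\<^sup>+x. ennreal (f k x powr p) \<partial>riemannian_volume M A g0) \<le> ennreal ((1 / 4) ^ k)"
    and p: "1 / 2 \<le> p"
    and balls: "finite balls" "\<And>c a r. (c, a, r) \<in> balls \<Longrightarrow> good_ball c a r"
      "M = (\<Union>(c, a, r)\<in>balls. chart_inv c ` ball a r)"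
begin

text \<open>
  The bound on the relative increase of length that is caused by \<open>f k\<close>, in coordinates: by \<open>upper\<close> the
  speed for \<open>g k\<close> is at most \<open>1 + sqrt (f k)\<close> times the speed for \<open>g0\<close>.
\<close>

definition excess :: "nat \<Rightarrow> ('a, 'n) chart \<Rightarrow> real^'n \<Rightarrow> real \<Rightarrow> real^'n \<Rightarrow> real" where
  "excess k c a r y = (if y \<in> ball a (2 * r) then sqrt (f k (chart_inv c y)) else 0)"

text \<open>
  The bound \<open>1 / (k + 1)\<close> could be any null sequence that decays more slowly than \<open>2\<^bsup>-k/(2p)\<^esup>\<close>. It is imposed
  in all chart balls around \<open>x\<close>, so that the local estimate is free to use any of them.
\<close>

definition tame :: "nat \<Rightarrow> 'a set" where
  "tame k = {x \<in> M. \<forall>(c, a, r)\<in>balls. x \<in> chart_inv c ` ball a r \<longrightarrow>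
     cone_avg r (excess k c a r) (snd c x) \<le> ennreal (1 / (real k + 1))}"

definition tame_from :: "nat \<Rightarrow> 'a set" where
  "tame_from K = {x \<in> M. \<forall>k\<ge>K. x \<in> tame k}"

definition tame_set :: "'a set" where
  "tame_set = (\<Union>K. tame_from K)"

lemma ball_facts:
  assumes "(c, a, r) \<in> balls"
  shows "c \<in> A" "0 < r" "ball a r \<subseteq> snd c ` fst c" "ball a (2 * r) \<subseteq> snd c ` fst c"
  using balls(2)[OF assms] good_ball_subset[OF balls(2)[OF assms], of r] good_ball_subset[OF balls(2)[OF assms], of "2 * r"]
  by (auto simp: good_ball_def)

lemma excess_continuous:
  assumes "(c, a, r) \<in> balls"
  shows "continuous_on (ball a (2 * r)) (excess k c a r)"
proof -
  have "continuous_on (ball a (2 * r)) (\<lambda>y. f k (chart_inv c y))"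
    by (rule continuous_on_compose2[OF f_cont continuous_on_subset[OF chart_inv_continuous]])
       (use ball_facts[OF assms] chart_inv_in_M in blast)+
  then have "continuous_on (ball a (2 * r)) (\<lambda>y. sqrt (f k (chart_inv c y)))"
    by (intro continuous_intros)
  then show ?thesis by (rule continuous_on_eq) (simp add: excess_def)
qed

lemma excess_measurable:
  assumes "(c, a, r) \<in> balls"
  shows "excess k c a r \<in> borel_measurable borel"
proof -
  have "(\<lambda>y. if y \<in> ball a (2 * r) then excess k c a r y else 0) \<in> borel_measurable borel"
    using excess_continuous[OF assms] by (intro borel_measurable_continuous_on_if) auto
  then show ?thesis by (rule back_subst[of "\<lambda>f. f \<in> borel_measurable borel"]) (auto simp: excess_def)
qed

lemma excess_nonneg:
  assumes "(c, a, r) \<in> balls"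
  shows "0 \<le> excess k c a r y"
proof (cases "y \<in> ball a (2 * r)")
  case True
  then have "chart_inv c y \<in> M" using ball_facts[OF assms] chart_inv_in_M by blast
  then show ?thesis using f_nonneg by (simp add: excess_def)
qed (simp add: excess_def)

text \<open>
  The excess is a square root, so its power \<open>2 p\<close> is the power \<open>p\<close> of \<open>f k\<close>.
\<close>

lemma excess_Lp_small:
  assumes "(c, a, r) \<in> balls"
  obtains C where "0 \<le> C" "\<And>k. (\<integral>\<^sup>+y. ennreal (excess k c a r y powr (2 * p)) \<partial>lborel) \<le> ennreal (C * (1 / 4) ^ k)"
proof -
  obtain C where C: "0 < C" "\<And>h. h \<in> borel_measurable borel_M \<Longrightarrow>
     (\<integral>\<^sup>+y\<in>ball a (2 * r). h (chart_inv c y) \<partial>lborel) \<le> ennreal C * (\<integral>\<^sup>+x. h x \<partial>riemannian_volume M A g0)"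
    using chart_pullback_le[OF g0 compact_M balls(2)[OF assms]] by blast
  show ?thesis
  proof (rule that[of C])
    fix k
    have m: "(\<lambda>x. ennreal (f k x powr p)) \<in> borel_measurable borel_M"
    proof -
      have [measurable]: "f k \<in> borel_measurable borel_M"
        by (rule borel_measurable_continuous_on_restrict[OF f_cont])
      show ?thesis by measurable
    qed
    have "(\<integral>\<^sup>+y. ennreal (excess k c a r y powr (2 * p)) \<partial>lborel) = (\<integral>\<^sup>+y\<in>ball a (2 * r). ennreal (f k (chart_inv c y) powr p) \<partial>lborel)"
    proof (intro nn_integral_cong)
      fix y
      show "ennreal (excess k c a r y powr (2 * p)) = ennreal (f k (chart_inv c y) powr p) * indicator (ball a (2 * r)) y"
      proof (cases "y \<in> ball a (2 * r)")
        case True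
        then have "0 \<le> f k (chart_inv c y)" using ball_facts[OF assms] chart_inv_in_M f_nonneg by blast
        then have "sqrt (f k (chart_inv c y)) powr (2 * p) = f k (chart_inv c y) powr p"
          by (simp add: powr_half_sqrt[symmetric] powr_powr)
        then show ?thesis using True by (simp add: excess_def)
      qed (simp add: excess_def)
    qed
    also have "\<dots> \<le> ennreal C * (\<integral>\<^sup>+x. ennreal (f k x powr p) \<partial>riemannian_volume M A g0)"
      by (rule C(2)[OF m])
    also have "\<dots> \<le> ennreal C * ennreal ((1 / 4) ^ k)"
      by (intro mult_left_mono f_small) simp
    also have "\<dots> = ennreal (C * (1 / 4) ^ k)" using C(1) by (simp add: ennreal_mult)
    finally show "(\<integral>\<^sup>+y. ennreal (excess k c a r y powr (2 * p)) \<partial>lborel) \<le> ennreal (C * (1 / 4) ^ k)" .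
  qed (use C in simp)
qed

text \<open>
  In coordinates, the points of the ball whose cone averages are too large for infinitely many \<open>k\<close>. Since the balls
  are finitely many, a point that is wild in none of them is tame for all large \<open>k\<close>.
\<close>

definition wild :: "('a, 'n) chart \<Rightarrow> real^'n \<Rightarrow> real \<Rightarrow> (real^'n) set" where
  "wild c a r = {y \<in> ball a r. \<exists>\<^sub>F k in sequentially. \<not> cone_avg r (excess k c a r) y \<le> ennreal (1 / (real k + 1))}"

lemma content_null_wild:
  assumes B: "(c, a, r) \<in> balls" and s: "real CARD('n) - 2 * p < s"
  shows "content_null s (wild c a r)"
proof -
  obtain C where C: "0 \<le> C" "\<And>k. (\<integral>\<^sup>+y. ennreal (excess k c a r y powr (2 * p)) \<partial>lborel) \<le> ennreal (C * (1 / 4) ^ k)"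
    using excess_Lp_small[OF B] by blast
  have "content_null s {y. \<exists>\<^sub>F k in sequentially. \<not> cone_avg r (excess k c a r) y \<le> ennreal (1 / (real k + 1))}"
    by (rule content_null_cone_avg_large[where q = "2 * p", OF excess_measurable[OF B] excess_nonneg[OF B] _ ball_facts(2)[OF B] _ C])
       (use p s in auto)
  then show ?thesis by (rule content_null_subset) (auto simp: wild_def)
qed

lemma tame_subset: "tame k \<subseteq> M" "tame_from K \<subseteq> M" "tame_set \<subseteq> M"
  by (auto simp: tame_def tame_from_def tame_set_def)

lemma tame_set_complement: "M - tame_set \<subseteq> (\<Union>(c, a, r)\<in>balls. chart_inv c ` wild c a r)"
proof
  fix x assume x: "x \<in> M - tame_set"
  show "x \<in> (\<Union>(c, a, r)\<in>balls. chart_inv c ` wild c a r)"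
  proof (rule ccontr)
    assume nx: "x \<notin> (\<Union>(c, a, r)\<in>balls. chart_inv c ` wild c a r)"
    have "\<forall>B\<in>balls. \<forall>\<^sub>F k in sequentially. (case B of (c, a, r) \<Rightarrow> x \<in> chart_inv c ` ball a r \<longrightarrow>
       cone_avg r (excess k c a r) (snd c x) \<le> ennreal (1 / (real k + 1)))"
    proof
      fix B assume B: "B \<in> balls"
      obtain c a r where car: "B = (c, a, r)" by (cases B)
      show "\<forall>\<^sub>F k in sequentially. (case B of (c, a, r) \<Rightarrow> x \<in> chart_inv c ` ball a r \<longrightarrow>
         cone_avg r (excess k c a r) (snd c x) \<le> ennreal (1 / (real k + 1)))"
      proof (cases "x \<in> chart_inv c ` ball a r")
        case True
        then obtain y where y: "y \<in> ball a r" "x = chart_inv c y" by blast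
        have "y \<notin> wild c a r" using nx B car y(2) by blast
        then have "\<forall>\<^sub>F k in sequentially. cone_avg r (excess k c a r) y \<le> ennreal (1 / (real k + 1))"
          using y(1) by (simp add: wild_def frequently_def)
        moreover have "snd c x = y" using y ball_facts[of c a r] B car chart_inv_right[of c y] by blast
        ultimately show ?thesis by (simp add: car)
      next
        case False
        then show ?thesis by (simp add: car)
      qed
    qed
    then have "\<forall>\<^sub>F k in sequentially. \<forall>B\<in>balls. (case B of (c, a, r) \<Rightarrow> x \<in> chart_inv c ` ball a r \<longrightarrow>
       cone_avg r (excess k c a r) (snd c x) \<le> ennreal (1 / (real k + 1)))"
      by (rule eventually_ball_finite[OF balls(1)])
    then obtain K where "\<And>k. k \<ge> K \<Longrightarrow> x \<in> tame k"
      unfolding eventually_sequentially tame_def using x by blast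
    then have "x \<in> tame_from K" using x by (simp add: tame_from_def)
    then show False using x by (auto simp: tame_set_def)
  qed
qed

text \<open>
  The cone average is a Borel function on each chart ball, and only countably many conditions are
  imposed.
\<close>

lemma tame_from_sets: "tame_from K \<in> sets borel_M"
proof -
  have bad: "chart_inv c ` {y \<in> ball a r. \<not> cone_avg r (excess k c a r) y \<le> ennreal (1 / (real k + 1))} \<in> sets borel_M"
    if B: "(c, a, r) \<in> balls" for k c a r
  proof (rule chart_inv_image_sets[OF ball_facts(1)[OF B]])
    note [measurable] = measurable_cone_avg[OF excess_measurable[OF B]]
    show "{y \<in> ball a r. \<not> cone_avg r (excess k c a r) y \<le> ennreal (1 / (real k + 1))} \<in> sets borel"
      by measurable
  qed (use ball_facts(3)[OF B] in blast)
  have "tame k = M - (\<Union>(c, a, r)\<in>balls. chart_inv c ` {y \<in> ball a r. \<not> cone_avg r (excess k c a r) y \<le> ennreal (1 / (real k + 1))})" for k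
  proof -
    have "x \<in> chart_inv c ` ball a r \<and> \<not> cone_avg r (excess k c a r) (snd c x) \<le> ennreal (1 / (real k + 1)) \<longleftrightarrow>
      x \<in> chart_inv c ` {y \<in> ball a r. \<not> cone_avg r (excess k c a r) y \<le> ennreal (1 / (real k + 1))}"
      if B: "(c, a, r) \<in> balls" for x c a r
    proof -
      have "snd c (chart_inv c y) = y" if "y \<in> ball a r" for y
        using chart_inv_right ball_facts[OF B] that by blast
      then show ?thesis by (auto simp: image_iff)
    qed
    then show ?thesis unfolding tame_def by blast
  qed
  moreover have "(\<Union>(c, a, r)\<in>balls. chart_inv c ` {y \<in> ball a r. \<not> cone_avg r (excess k c a r) y \<le> ennreal (1 / (real k + 1))}) \<in> sets borel_M" for k
    using bad balls(1) by (intro sets.finite_UN) auto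
  moreover have M: "M \<in> sets borel_M" using sets.top[of borel_M] by (simp add: space_borel_M)
  ultimately have "tame k \<in> sets borel_M" for k by auto
  moreover have "tame_from K = M \<inter> (\<Inter>k\<in>{K..}. tame k)" by (auto simp: tame_from_def)
  ultimately show ?thesis using M by (auto intro!: sets.Int sets.countable_INT')
qed

lemma tame_set_sets: "tame_set \<in> sets borel_M"
  unfolding tame_set_def using tame_from_sets by blast

lemma negligible_wild:
  assumes "(c, a, r) \<in> balls"
  shows "negligible (wild c a r)"
  by (rule content_null_imp_negligible[OF content_null_wild[OF assms, of "real CARD('n)"]])
     (use p in auto)

lemma wild_sets:
  assumes B: "(c, a, r) \<in> balls"
  shows "wild c a r \<in> sets borel"
proof -
  note [measurable] = measurable_cone_avg[OF excess_measurable[OF B]]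
  show ?thesis unfolding wild_def frequently_sequentially by measurable
qed

lemma lipschitz_chart:
  assumes B: "(c, a, r) \<in> balls"
  obtains L where "0 < L" "\<And>y z. y \<in> ball a r \<Longrightarrow> z \<in> ball a r \<Longrightarrow>
    riemannian_dist M A g0 (chart_inv c y) (chart_inv c z) \<le> L * dist y z"
proof -
  have c: "c \<in> A" and r: "0 < r" and sub: "cball a (2 * r) \<subseteq> snd c ` fst c"
    using balls(2)[OF B] by (auto simp: good_ball_def)
  let ?G = "\<lambda>y. tensor_matrix A g0 c (chart_inv c y)"
  define \<omega> where "\<omega> y = (\<Sum>i\<in>UNIV. \<Sum>j\<in>UNIV. \<bar>?G y $ i $ j\<bar>)" for y
  have "continuous_on (cball a (2 * r)) ?G"
    by (rule continuous_on_subset[OF continuous_tensor_matrix_chart[OF g0 c] sub])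
  then have "continuous_on (cball a (2 * r)) \<omega>" unfolding \<omega>_def by (intro continuous_intros)
  then have "\<exists>x\<in>cball a (2 * r). \<forall>y\<in>cball a (2 * r). \<omega> y \<le> \<omega> x"
    using r by (intro continuous_attains_sup) auto
  then obtain y1 where y1: "\<And>y. y \<in> cball a (2 * r) \<Longrightarrow> \<omega> y \<le> \<omega> y1"
    by blast
  have \<omega>0: "0 \<le> \<omega> y" for y by (simp add: \<omega>_def sum_nonneg)
  show ?thesis
  proof (rule that[of "sqrt (\<omega> y1) + 1"])
    show "0 < sqrt (\<omega> y1) + 1" using \<omega>0[of y1] by (simp add: add_nonneg_pos)
    fix y z assume yz: "y \<in> ball a r" "z \<in> ball a r"
    have seg: "y + t *\<^sub>R (z - y) \<in> ball a r" if "t \<in> {0..1}" for t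
      by (rule segment_in_convex[OF convex_ball yz that])
    have "riemannian_dist M A g0 (chart_inv c y) (chart_inv c z) \<le> integral {0..1} (\<lambda>t :: real. sqrt (\<omega> y1) * norm (z - y))"
    proof (rule dist_le_segment(2)[OF g0 c])
      fix t :: real assume t: "t \<in> {0..1}"
      have in_c: "y + t *\<^sub>R (z - y) \<in> cball a (2 * r)" using seg[OF t] r by auto
      then show "y + t *\<^sub>R (z - y) \<in> snd c ` fst c" using sub by blast
      have "(z - y) \<bullet> (?G (y + t *\<^sub>R (z - y)) *v (z - y)) \<le> \<omega> (y + t *\<^sub>R (z - y)) * (norm (z - y))\<^sup>2"
        using quadratic_form_le[of "z - y" "?G (y + t *\<^sub>R (z - y))"] unfolding \<omega>_def by linarith
      also have "\<dots> \<le> \<omega> y1 * (norm (z - y))\<^sup>2"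
        by (intro mult_right_mono y1 in_c) simp
      finally have "sqrt ((z - y) \<bullet> (?G (y + t *\<^sub>R (z - y)) *v (z - y))) \<le> sqrt (\<omega> y1 * (norm (z - y))\<^sup>2)"
        by (rule real_sqrt_le_mono)
      then show "sqrt ((z - y) \<bullet> (?G (y + t *\<^sub>R (z - y)) *v (z - y))) \<le> sqrt (\<omega> y1) * norm (z - y)"
        by (simp add: real_sqrt_mult)
    qed (rule integrable_const_ivl)
    also have "\<dots> = sqrt (\<omega> y1) * dist y z" by (simp add: dist_norm norm_minus_commute)
    also have "\<dots> \<le> (sqrt (\<omega> y1) + 1) * dist y z" by (intro mult_right_mono) auto
    finally show "riemannian_dist M A g0 (chart_inv c y) (chart_inv c z) \<le> (sqrt (\<omega> y1) + 1) * dist y z" .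
  qed
qed

lemma curves_ne: "x \<in> M \<Longrightarrow> y \<in> M \<Longrightarrow> curves x y \<noteq> {}"
  by (rule curves_nonempty[OF connected_M g0])

text \<open>
  The inverse charts are Lipschitz from the Euclidean distance to \<open>d\<^sub>0\<close>, so the wild sets
  stay null for Hausdorff measure on the manifold.
\<close>

lemma hausdorff_dim_complement:
  assumes "2 * p \<le> real CARD('n)"
  shows "hausdorff_dim M (riemannian_dist M A g0) (M - tame_set) \<le> ereal (real CARD('n) - 2 * p)"
proof (rule hausdorff_dim_le)
  show "0 \<le> real CARD('n) - 2 * p" using assms by simp
  fix s assume s: "real CARD('n) - 2 * p < s"
  then have s0: "0 < s" using assms by linarith
  show "hausdorff_measure M (riemannian_dist M A g0) s (M - tame_set) = 0"
  proof (rule hausdorff_measure_0I)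
    fix \<delta> :: real assume \<delta>: "0 < \<delta>"
    have "small_covers M (riemannian_dist M A g0) s \<delta> (\<Union>B\<in>balls. case B of (c, a, r) \<Rightarrow> chart_inv c ` wild c a r)"
    proof (rule small_covers_finite_UN[OF balls(1)])
      fix B assume "B \<in> balls"
      then obtain c a r where B: "B = (c, a, r)" "(c, a, r) \<in> balls" by (cases B) auto
      obtain L where L: "0 < L" "\<And>y z. y \<in> ball a r \<Longrightarrow> z \<in> ball a r \<Longrightarrow>
        riemannian_dist M A g0 (chart_inv c y) (chart_inv c z) \<le> L * dist y z"
        using lipschitz_chart[OF B(2)] by blast
      have inM: "chart_inv c y \<in> M" if "y \<in> ball a r" for y
        using ball_facts[OF B(2)] chart_inv_in_M that by blast
      have "small_covers M (riemannian_dist M A g0) s \<delta> (chart_inv c ` wild c a r)"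
      proof (rule small_covers_lipschitz_image[OF content_null_wild[OF B(2) s] _ s0 \<delta> L(1) inM])
        show "wild c a r \<subseteq> ball a r" by (auto simp: wild_def)
        fix y z assume yz: "y \<in> ball a r" "z \<in> ball a r"
        show "0 \<le> riemannian_dist M A g0 (chart_inv c y) (chart_inv c z) \<and>
          riemannian_dist M A g0 (chart_inv c y) (chart_inv c z) \<le> L * dist y z"
          using L(2)[OF yz] dist_nonneg[OF g0 curves_ne[OF inM[OF yz(1)] inM[OF yz(2)]]] by blast
      qed
      then show "small_covers M (riemannian_dist M A g0) s \<delta> (case B of (c, a, r) \<Rightarrow> chart_inv c ` wild c a r)"
        by (simp add: B)
    qed
    then show "small_covers M (riemannian_dist M A g0) s \<delta> (M - tame_set)"
      by (rule small_covers_subset) (rule tame_set_complement)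
  qed
qed

lemma emeasure_complement: "emeasure (riemannian_volume M A g0) (M - tame_set) = 0"
proof -
  let ?V = "riemannian_volume M A g0"
  note sv = sets_vol[OF g0 compact_M]
  have W: "chart_inv c ` wild c a r \<in> sets borel_M \<and> emeasure ?V (chart_inv c ` wild c a r) = 0"
    if B: "(c, a, r) \<in> balls" for c a r
  proof -
    have sub: "wild c a r \<subseteq> snd c ` fst c" using ball_facts(3)[OF B] by (auto simp: wild_def)
    note c = ball_facts(1)[OF B]
    have sets: "chart_inv c ` wild c a r \<in> sets borel_M"
      by (rule chart_inv_image_sets[OF c wild_sets[OF B] sub])
    moreover have "emeasure ?V (chart_inv c ` wild c a r) = 0"
      by (rule vol_null_chart[OF g0 compact_M c sets])
         (simp_all add: snd_chart_inv_image[OF c sub] negligible_wild[OF B])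
    ultimately show ?thesis ..
  qed
  let ?W = "\<lambda>B. case B of (c, a, r) \<Rightarrow> chart_inv c ` wild c a r"
  have "emeasure ?V (M - tame_set) \<le> emeasure ?V (\<Union>B\<in>balls. ?W B)"
    by (rule emeasure_mono[OF tame_set_complement]) (use W balls(1) sv in \<open>auto intro!: sets.finite_UN\<close>)
  also have "\<dots> \<le> (\<Sum>B\<in>balls. emeasure ?V (?W B))"
    by (rule emeasure_subadditive_finite[OF balls(1)]) (use W sv in auto)
  also have "\<dots> = 0" using W by (intro sum.neutral) auto
  finally show ?thesis by simp
qed

text \<open>
  A nonempty open set has positive volume, since the chart densities are positive.
\<close>

lemma tame_set_dense:
  assumes W: "openin (top_of_set M) W" "x \<in> W"
  shows "W \<inter> tame_set \<noteq> {}"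
proof
  assume e: "W \<inter> tame_set = {}"
  have "x \<in> M" using W openin_imp_subset by blast
  then obtain c where c: "c \<in> A" "x \<in> fst c" using chart_cover by blast
  let ?Y = "snd c ` (W \<inter> fst c)"
  have op: "open ?Y" by (rule chart_image_openin[OF c(1) W(1)])
  have ne: "?Y \<noteq> {}" using W(2) c(2) by blast
  have sets: "W \<inter> fst c \<in> sets borel_M"
    using openin_sets_M[OF W(1)] chart_domain_sets[OF c(1)] by blast
  have "W \<inter> fst c \<subseteq> M - tame_set" using e openin_imp_subset[OF W(1)] by blast
  then have "emeasure (riemannian_volume M A g0) (W \<inter> fst c) \<le> emeasure (riemannian_volume M A g0) (M - tame_set)"
    by (rule emeasure_mono)
       (use tame_set_sets sets_vol[OF g0 compact_M] M_sets_vol[OF g0 compact_M] in auto)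
  then have "emeasure (riemannian_volume M A g0) (W \<inter> fst c) = 0" by (simp add: emeasure_complement)
  then have 0: "(\<integral>\<^sup>+y\<in>?Y. ennreal (density_fn g0 c y) \<partial>lborel) = 0"
    using emeasure_vol_chart[OF g0 compact_M c(1) sets] by (simp add: chart_vol_density)
  have [measurable]: "?Y \<in> sets borel" using op by simp
  note [measurable] = density_fn_measurable[OF g0 c(1)]
  have "AE y in lborel. ennreal (density_fn g0 c y) * indicator ?Y y = 0"
    using 0 by (subst (asm) nn_integral_0_iff_AE) measurable
  then have "AE y in lborel. y \<notin> ?Y"
  proof eventually_elim
    case (elim y)
    then show ?case using density_fn_pos[OF g0 c(1), of y] by (auto simp: indicator_def split: if_splits)
  qed
  then have "emeasure lborel ?Y = 0"
    by (subst (asm) AE_iff_measurable[of ?Y]) auto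
  then have "negligible ?Y" using op by (simp add: negligible_iff_null_sets null_sets_def)
  then show False using open_not_negligible[OF op ne] by blast
qed

section \<open>The local upper bound\<close>

abbreviation d0 :: "'a \<Rightarrow> 'a \<Rightarrow> real" where "d0 \<equiv> riemannian_dist M A g0"
abbreviation d :: "nat \<Rightarrow> 'a \<Rightarrow> 'a \<Rightarrow> real" where "d k \<equiv> riemannian_dist M A (g k)"

text \<open>
  The speed of the segment for \<open>g k\<close> is at most \<open>1 + excess\<close> times its speed for \<open>g0\<close>, which in turn is
  bounded by the constant norm. Both directions of the segment have the same bound.
\<close>

lemma dist_le_excess_segment:
  fixes k :: nat
  assumes B: "(c, a, r) \<in> balls" and S: "convex S" "S \<subseteq> ball a (2 * r)" and xz: "x \<in> S" "z \<in> S"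
    and K: "0 \<le> K" "\<And>y u. y \<in> S \<Longrightarrow> sqrt (u \<bullet> (tensor_matrix A g0 c (chart_inv c y) *v u)) \<le> K * norm ((P :: real^'n^'n) *v u)"
  defines "I \<equiv> integral {0..1} (\<lambda>t. excess k c a r (x + t *\<^sub>R (z - x)))"
  shows "d k (chart_inv c x) (chart_inv c z) \<le> K * norm (P *v (z - x)) * (1 + I)"
    "d k (chart_inv c z) (chart_inv c x) \<le> K * norm (P *v (z - x)) * (1 + I)"
    "0 \<le> I" "(\<integral>\<^sup>+t\<in>{0..1}. ennreal (excess k c a r (x + t *\<^sub>R (z - x))) \<partial>lborel) = ennreal I"
proof -
  note c = ball_facts(1)[OF B]
  let ?h = "\<lambda>t. excess k c a r (x + t *\<^sub>R (z - x))" and ?N = "norm (P *v (z - x))"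
  have seg: "x + t *\<^sub>R (z - x) \<in> S" if "t \<in> {0..1}" for t
    by (rule segment_in_convex[OF S(1) xz that])
  have seg_c: "y \<in> snd c ` fst c" if "y \<in> S" for y using that S(2) ball_facts(4)[OF B] by blast
  have hc: "continuous_on {0..1} ?h"
    by (rule continuous_on_compose2[OF excess_continuous[OF B]]) (use seg S(2) in \<open>auto intro!: continuous_intros\<close>)
  have h0: "0 \<le> ?h t" for t by (rule excess_nonneg[OF B])
  note hint = integrable_continuous_interval[OF hc]
  show I0: "0 \<le> I" unfolding I_def by (rule integral_nonneg[OF hint]) (rule h0)
  show "(\<integral>\<^sup>+t\<in>{0..1}. ennreal (?h t) \<partial>lborel) = ennreal I"
    unfolding I_def by (rule nn_integral_unit_interval[OF hc h0])
  have bound: "sqrt (u \<bullet> (tensor_matrix A (g k) c (chart_inv c y) *v u)) \<le> K * norm (P *v u) * (1 + excess k c a r y)"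
    if y: "y \<in> S" for y u
  proof -
    let ?x = "chart_inv c y" and ?v = "coord_vec A c (chart_inv c y) u"
    have x: "?x \<in> fst c" "?x \<in> M" using chart_inv_in[OF c seg_c[OF y]] chart_subset[OF c] by auto
    have gm: "metric_tensor M A (g k)" "metric_tensor M A g0" using g[of k] g0 by (auto simp: continuous_metric_def)
    have T: "?v \<in> tangent_space A ?x" by (rule coord_vec_tangent[OF c x(1)])
    have f0: "0 \<le> f k ?x" by (rule f_nonneg[OF x(2)])
    have "u \<bullet> (tensor_matrix A (g k) c ?x *v u) \<le> (1 + f k ?x) * (u \<bullet> (tensor_matrix A g0 c ?x *v u))"
      using upper[OF x(2) T, of k] by (simp add: metric_coord[OF gm(1) c x(1)] metric_coord[OF gm(2) c x(1)])
    then have "sqrt (u \<bullet> (tensor_matrix A (g k) c ?x *v u)) \<le> sqrt (1 + f k ?x) * sqrt (u \<bullet> (tensor_matrix A g0 c ?x *v u))"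
      by (metis real_sqrt_le_mono real_sqrt_mult)
    also have "\<dots> \<le> (1 + sqrt (f k ?x)) * (K * norm (P *v u))"
    proof (rule mult_mono)
      show "sqrt (1 + f k ?x) \<le> 1 + sqrt (f k ?x)"
        using f0 by (intro real_le_lsqrt) (auto simp: power2_eq_square algebra_simps)
      show "sqrt (u \<bullet> (tensor_matrix A g0 c ?x *v u)) \<le> K * norm (P *v u)" by (rule K(2)[OF y])
      have "0 \<le> g0 ?x ?v ?v" by (rule metric_nonneg[OF g0 x(2) T])
      then show "0 \<le> sqrt (u \<bullet> (tensor_matrix A g0 c ?x *v u))"
        by (simp add: metric_coord[OF gm(2) c x(1)])
    qed (use f0 in simp)
    finally show ?thesis using y S(2) by (auto simp: excess_def mult.commute subset_iff)
  qed
  have i1: "((\<lambda>t. K * ?N * (1 + ?h t)) has_integral K * ?N * (1 + I)) {0..1}"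
    unfolding I_def
    using has_integral_mult_right[OF has_integral_add[OF has_integral_const_real[of 1 0 1] integrable_integral[OF hint]]]
    by simp
  have i2: "((\<lambda>t. K * ?N * (1 + ?h (1 - t))) has_integral K * ?N * (1 + I)) {0..1}"
    unfolding I_def
    using has_integral_mult_right[OF has_integral_add[OF has_integral_const_real[of 1 0 1] integral_reflect_unit[OF hint]]]
    by simp
  have "d k (chart_inv c x) (chart_inv c z) \<le> integral {0..1} (\<lambda>t. K * ?N * (1 + ?h t))"
  proof (rule dist_le_segment(2)[OF g c])
    show "(\<lambda>t. K * ?N * (1 + ?h t)) integrable_on {0..1}" using i1 by blast
    fix t :: real assume t: "t \<in> {0..1}"
    show "x + t *\<^sub>R (z - x) \<in> snd c ` fst c" by (rule seg_c[OF seg[OF t]])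
    show "sqrt ((z - x) \<bullet> (tensor_matrix A (g k) c (chart_inv c (x + t *\<^sub>R (z - x))) *v (z - x))) \<le> K * ?N * (1 + ?h t)"
      by (rule bound[OF seg[OF t]])
  qed
  then show "d k (chart_inv c x) (chart_inv c z) \<le> K * ?N * (1 + I)"
    by (simp only: integral_unique[OF i1])
  have "d k (chart_inv c z) (chart_inv c x) \<le> integral {0..1} (\<lambda>t. K * ?N * (1 + ?h (1 - t)))"
  proof (rule dist_le_segment(2)[OF g c])
    show "(\<lambda>t. K * ?N * (1 + ?h (1 - t))) integrable_on {0..1}" using i2 by blast
    fix t :: real assume t: "t \<in> {0..1}"
    have eq: "z + t *\<^sub>R (x - z) = x + (1 - t) *\<^sub>R (z - x)" by (simp add: algebra_simps)
    have t': "1 - t \<in> {0..1}" using t by auto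
    show "z + t *\<^sub>R (x - z) \<in> snd c ` fst c" unfolding eq by (rule seg_c[OF seg[OF t']])
    have "norm (P *v (x - z)) = ?N" by (metis matrix_vector_mult_diff_distrib norm_minus_commute)
    then show "sqrt ((x - z) \<bullet> (tensor_matrix A (g k) c (chart_inv c (z + t *\<^sub>R (x - z))) *v (x - z))) \<le> K * ?N * (1 + ?h (1 - t))"
      using bound[OF seg[OF t'], of "x - z"] unfolding eq by simp
  qed
  then show "d k (chart_inv c z) (chart_inv c x) \<le> K * ?N * (1 + I)"
    by (simp only: integral_unique[OF i2])
qed

text \<open>
  Near \<open>x0\<close> the metric \<open>g0\<close> is almost the constant norm of \<open>P\<close>. A connecting point \<open>z\<close> in a small ball of
  radius \<open>\<rho>\<close> around \<open>y\<close> makes the integrals of the excess along the segments from \<open>x\<close> and from \<open>y\<close> to \<open>z\<close>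
  at most a constant times \<open>1 / (k + 1)\<close>. The detour through \<open>z\<close> costs an amount of order \<open>\<rho>\<close>. The set \<open>W\<close> and \<open>P\<close> do not
  depend on \<open>\<eta>\<close>, while \<open>\<rho>\<close> does.
\<close>

lemma local_estimate:
  assumes x0: "x0 \<in> M" and \<epsilon>: "0 < \<epsilon>"
  obtains W c and P :: "real^'n^'n" where "openin (top_of_set M) W" "x0 \<in> W" "c \<in> A" "W \<subseteq> fst c"
    "\<And>x u. x \<in> W \<Longrightarrow> norm (P *v u) \<le> (1 + \<epsilon>) * sqrt (u \<bullet> (tensor_matrix A g0 c x *v u))"
    "\<And>\<eta>. 0 < \<eta> \<Longrightarrow> \<forall>\<^sub>F k in sequentially. \<forall>x\<in>W \<inter> tame k. \<forall>y\<in>W \<inter> tame k.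
       d k x y \<le> (1 + \<epsilon>) * norm (P *v (snd c x - snd c y)) + \<eta>"
proof -
  obtain c a r where B: "(c, a, r) \<in> balls" and x0B: "x0 \<in> chart_inv c ` ball a r"
    using x0 balls(3) by blast
  note bf = ball_facts[OF B]
  then obtain b where b: "b \<in> ball a r" "x0 = chart_inv c b" using x0B by blast
  let ?G = "\<lambda>y. tensor_matrix A g0 c (chart_inv c y)"
  have "continuous_on (ball a r) ?G"
    by (rule continuous_on_subset[OF continuous_tensor_matrix_chart[OF g0 bf(1)] bf(3)])
  moreover have "pos_def (?G b)"
    using metric_pos_def[OF _ bf(1) chart_inv_in[OF bf(1)], of g0 b] g0 b bf(3) by (auto simp: continuous_metric_def)
  ultimately obtain P :: "real^'n^'n" and \<rho>1 where P: "0 < \<rho>1" "ball b \<rho>1 \<subseteq> ball a r"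
    "\<And>y u. y \<in> ball b \<rho>1 \<Longrightarrow> norm (P *v u) \<le> (1 + \<epsilon>) * sqrt (u \<bullet> (?G y *v u))"
    "\<And>y u. y \<in> ball b \<rho>1 \<Longrightarrow> sqrt (u \<bullet> (?G y *v u)) \<le> (1 + \<epsilon>) * norm (P *v u)"
    using near_constant_norm[of "ball a r" ?G b \<epsilon>] b(1) \<epsilon> by (metis open_ball)
  \<comment> \<open>Points of ball b \<rho>0 are closer than 2 \<rho>0 \<le> r to each other, so the small ball around y lies in the ball of radius r around x.\<close>
  define \<rho>0 where "\<rho>0 = min \<rho>1 (r / 2)"
  have \<rho>0: "0 < \<rho>0" "\<rho>0 \<le> \<rho>1" "2 * \<rho>0 \<le> r" using P(1) bf(2) by (auto simp: \<rho>0_def)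
  have S1: "ball b \<rho>0 \<subseteq> ball b \<rho>1" using \<rho>0 by auto
  have S: "ball b \<rho>0 \<subseteq> ball a r" "ball b \<rho>0 \<subseteq> ball a (2 * r)"
    using S1 P(2) bf(2) by (auto simp: subset_iff)
  define Y where "Y = ball b (\<rho>0 / 2)"
  have Y: "Y \<subseteq> ball b \<rho>0" using \<rho>0 by (auto simp: Y_def)
  have YO: "Y \<subseteq> snd c ` fst c" using Y S(1) bf(3) by blast
  obtain Bp where Bp: "0 < Bp" "\<And>u. norm (P *v u) \<le> Bp * norm u"
    using bounded_linear.pos_bounded[OF matrix_vector_mul_bounded_linear[of P]] by (auto simp: mult.commute)
  let ?W = "chart_inv c ` Y"
  have est: "\<forall>\<^sub>F k in sequentially. \<forall>x\<in>?W \<inter> tame k. \<forall>y\<in>?W \<inter> tame k.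
       d k x y \<le> (1 + \<epsilon>) * norm (P *v (snd c x - snd c y)) + \<eta>" if \<eta>: "0 < \<eta>" for \<eta>
  proof -
    \<comment> \<open>The detour has length at most 2 Bp \<rho> in the constant norm; it may use up half of \<eta>.\<close>
    define \<rho> where "\<rho> = min (\<rho>0 / 2) (\<eta> / (4 * (1 + \<epsilon>) * Bp))"
    have \<rho>: "0 < \<rho>" "\<rho> \<le> \<rho>0 / 2" "(1 + \<epsilon>) * (2 * Bp * \<rho>) \<le> \<eta> / 2"
    proof -
      show "0 < \<rho>" using \<rho>0 \<eta> \<epsilon> Bp by (simp add: \<rho>_def)
      show "\<rho> \<le> \<rho>0 / 2" unfolding \<rho>_def by (rule min.cobounded1)
      have "\<rho> \<le> \<eta> / (4 * (1 + \<epsilon>) * Bp)" by (simp add: \<rho>_def)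
      moreover have "0 < 4 * (1 + \<epsilon>) * Bp" using \<epsilon> Bp by simp
      ultimately have "\<rho> * (4 * (1 + \<epsilon>) * Bp) \<le> \<eta>" by (simp only: pos_le_divide_eq)
      then show "(1 + \<epsilon>) * (2 * Bp * \<rho>) \<le> \<eta> / 2" by (simp add: algebra_simps)
    qed
    define vl where "vl = unit_ball_vol (real CARD('n)) * \<rho> ^ CARD('n)"
    have vl: "0 < vl" "\<And>y :: real^'n. emeasure lborel (ball y \<rho>) = ennreal vl"
      using \<rho>(1) by (auto simp: vl_def emeasure_ball)
    \<comment> \<open>Any factor above 2 would do in place of 3: the two cone averages sum up to at most 2 / (k + 1), and a strict inequality is needed.\<close>
    define \<kappa>' where "\<kappa>' k = 3 * (1 / (real k + 1)) / vl" for k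
    \<comment> \<open>Bounds the lengths of the two segments in the constant norm, which multiply the integrals of the excess.\<close>
    define D where "D = (1 + \<epsilon>) * (Bp * (2 * \<rho>0)) * 2"
    have D: "0 < D" using \<epsilon> Bp \<rho>0 by (simp add: D_def)
    have t0: "(\<lambda>k. 1 / (real k + 1)) \<longlonglongrightarrow> 0"
      using LIMSEQ_inverse_real_of_nat by (simp add: divide_inverse add.commute)
    have "(\<lambda>k. D * \<kappa>' k) \<longlonglongrightarrow> D * (3 * 0 / vl)"
      unfolding \<kappa>'_def by (intro tendsto_intros t0) (use vl in simp)
    then have "\<forall>\<^sub>F k in sequentially. D * \<kappa>' k < \<eta> / 2"
      by (rule order_tendstoD) (use \<eta> in simp)
    then show ?thesis
    proof eventually_elim
      case (elim k)
      show ?case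
      proof (intro ballI)
        fix x y assume x: "x \<in> ?W \<inter> tame k" and y: "y \<in> ?W \<inter> tame k"
        obtain x' where x': "x' \<in> Y" "x = chart_inv c x'" using x by blast
        obtain y' where y': "y' \<in> Y" "y = chart_inv c y'" using y by blast
        have sx: "snd c x = x'" "snd c y = y'" using x' y' YO chart_inv_right[OF bf(1)] by blast+
        have inr: "x' \<in> ball a r" "y' \<in> ball a r" using x'(1) y'(1) Y S(1) by blast+
        have cx: "cone_avg r (excess k c a r) x' \<le> ennreal (1 / (real k + 1))"
          using x B inr(1) x'(2) sx(1) unfolding tame_def by blast
        have cy: "cone_avg r (excess k c a r) y' \<le> ennreal (1 / (real k + 1))"
          using y B inr(2) y'(2) sx(2) unfolding tame_def by blast
        have dxy: "dist b x' < \<rho>0 / 2" "dist b y' < \<rho>0 / 2" using x'(1) y'(1) by (auto simp: Y_def)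
        have near: "dist b z < \<rho>0 \<and> dist x' z < 2 * \<rho>0 \<and> dist y' z < 2 * \<rho>0" if "z \<in> ball y' \<rho>" for z
        proof -
          have 1: "dist y' z < \<rho>" using that by simp
          have "dist b z \<le> dist b y' + dist y' z" "dist x' z \<le> dist b x' + dist b z"
            using Real_Vector_Spaces.dist_triangle[of b z y'] dist_triangle3[of x' z b] by auto
          then show ?thesis using 1 dxy \<rho>(2) \<rho>0(1) by linarith
        qed
        have Z: "ball y' \<rho> \<subseteq> ball x' r" "ball y' \<rho> \<subseteq> ball y' r" "ball y' \<rho> \<subseteq> ball b \<rho>0"
          using near \<rho>0(3) by force+
        have lt: "2 * ennreal (1 / (real k + 1)) < ennreal (\<kappa>' k) * emeasure lborel (ball y' \<rho>)"
        proof -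
          have "2 * ennreal (1 / (real k + 1)) = ennreal 2 * ennreal (1 / (real k + 1))" by simp
          also have "\<dots> = ennreal (2 * (1 / (real k + 1)))" by (rule ennreal_mult[symmetric]) simp_all
          also have "\<dots> < ennreal (3 * (1 / (real k + 1)))" by (intro ennreal_lessI) (auto simp: field_simps)
          also have "\<dots> = ennreal (\<kappa>' k * vl)" using vl(1) by (simp add: \<kappa>'_def)
          also have "\<dots> = ennreal (\<kappa>' k) * emeasure lborel (ball y' \<rho>)"
            using vl by (simp add: ennreal_mult'')
          finally show ?thesis .
        qed
        obtain z where z: "z \<in> ball y' \<rho>"
          "(\<integral>\<^sup>+t\<in>{0..1}. ennreal (excess k c a r (x' + t *\<^sub>R (z - x'))) \<partial>lborel) +
           (\<integral>\<^sup>+t\<in>{0..1}. ennreal (excess k c a r (y' + t *\<^sub>R (z - y'))) \<partial>lborel) \<le> ennreal (\<kappa>' k)"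
          using exists_connecting_point[OF excess_measurable[OF B] Z(1,2) cx cy lt] by blast
        have inS: "x' \<in> ball b \<rho>0" "y' \<in> ball b \<rho>0" "z \<in> ball b \<rho>0" using x'(1) y'(1) Y z(1) Z(3) by blast+
        have K: "0 \<le> 1 + \<epsilon>" using \<epsilon> by simp
        have bd: "\<And>y u. y \<in> ball b \<rho>0 \<Longrightarrow> sqrt (u \<bullet> (?G y *v u)) \<le> (1 + \<epsilon>) * norm (P *v u)"
          using P(4) S1 by blast
        define I where "I = integral {0..1} (\<lambda>t. excess k c a r (x' + t *\<^sub>R (z - x')))"
        define J where "J = integral {0..1} (\<lambda>t. excess k c a r (y' + t *\<^sub>R (z - y')))"
        note s1 = dist_le_excess_segment[OF B convex_ball S(2) inS(1,3) K bd, where k = k, folded I_def]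
        note s2 = dist_le_excess_segment[OF B convex_ball S(2) inS(2,3) K bd, where k = k, folded J_def]
        have k0: "0 \<le> \<kappa>' k" using vl(1) by (simp add: \<kappa>'_def)
        have "ennreal (I + J) \<le> ennreal (\<kappa>' k)"
          using z(2) s1(3,4) s2(3,4) by simp
        then have IJ: "I + J \<le> \<kappa>' k" using k0 by (simp add: ennreal_le_iff)
        have zy: "norm (P *v (z - y')) \<le> Bp * \<rho>"
        proof -
          have "norm (z - y') \<le> \<rho>" using z(1) by (simp add: dist_norm norm_minus_commute)
          then have "Bp * norm (z - y') \<le> Bp * \<rho>" using Bp(1) by simp
          then show ?thesis using Bp(2)[of "z - y'"] by linarith
        qed
        have zx: "norm (P *v (z - x')) \<le> norm (P *v (x' - y')) + norm (P *v (z - y'))"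
        proof -
          have "P *v (z - x') = P *v (z - y') - P *v (x' - y')"
            by (simp add: matrix_vector_mult_diff_distrib)
          then show ?thesis using norm_triangle_ineq4[of "P *v (z - y')" "P *v (x' - y')"] by simp
        qed
        have zb: "norm (P *v (z - x')) \<le> Bp * (2 * \<rho>0)" "norm (P *v (z - y')) \<le> Bp * (2 * \<rho>0)"
        proof -
          have "norm (z - x') \<le> 2 * \<rho>0" "norm (z - y') \<le> 2 * \<rho>0"
            using near[OF z(1)] by (auto simp: dist_norm norm_minus_commute)
          then have "Bp * norm (z - x') \<le> Bp * (2 * \<rho>0)" "Bp * norm (z - y') \<le> Bp * (2 * \<rho>0)"
            using Bp(1) by auto
          then show "norm (P *v (z - x')) \<le> Bp * (2 * \<rho>0)" "norm (P *v (z - y')) \<le> Bp * (2 * \<rho>0)"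
            using Bp(2)[of "z - x'"] Bp(2)[of "z - y'"] by linarith+
        qed
        have M': "chart_inv c z \<in> M" "x \<in> M" "y \<in> M"
          using inS(3) S(1) bf(3) chart_inv_in_M[OF bf(1)] x y tame_subset(1) by blast+
        have "d k x y \<le> d k x (chart_inv c z) + d k (chart_inv c z) y"
          by (rule dist_triangle[OF g curves_ne[OF M'(2,1)] curves_ne[OF M'(1,3)]])
        also have "\<dots> \<le> (1 + \<epsilon>) * norm (P *v (z - x')) * (1 + I) + (1 + \<epsilon>) * norm (P *v (z - y')) * (1 + J)"
          using s1(1) s2(2) x'(2) y'(2) by simp
        also have "\<dots> = (1 + \<epsilon>) * (norm (P *v (z - x')) + norm (P *v (z - y'))) +
            ((1 + \<epsilon>) * norm (P *v (z - x')) * I + (1 + \<epsilon>) * norm (P *v (z - y')) * J)"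
          by (simp add: algebra_simps)
        also have "\<dots> \<le> (1 + \<epsilon>) * (norm (P *v (x' - y')) + 2 * Bp * \<rho>) +
            ((1 + \<epsilon>) * (Bp * (2 * \<rho>0)) * \<kappa>' k + (1 + \<epsilon>) * (Bp * (2 * \<rho>0)) * \<kappa>' k)"
        proof -
          have N: "norm (P *v (z - x')) + norm (P *v (z - y')) \<le> norm (P *v (x' - y')) + 2 * Bp * \<rho>"
            using zx zy by simp
          have Q: "0 \<le> (1 + \<epsilon>) * (Bp * (2 * \<rho>0))" using \<epsilon> Bp(1) \<rho>0(1) by simp
          have "I \<le> \<kappa>' k" "J \<le> \<kappa>' k" using IJ s1(3) s2(3) by auto
          then have "(1 + \<epsilon>) * norm (P *v (z - x')) * I \<le> (1 + \<epsilon>) * (Bp * (2 * \<rho>0)) * \<kappa>' k"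
            "(1 + \<epsilon>) * norm (P *v (z - y')) * J \<le> (1 + \<epsilon>) * (Bp * (2 * \<rho>0)) * \<kappa>' k"
            using mult_mono[OF mult_left_mono[OF zb(1) K] _ Q s1(3)] mult_mono[OF mult_left_mono[OF zb(2) K] _ Q s2(3)]
            by blast+
          moreover have "(1 + \<epsilon>) * (norm (P *v (z - x')) + norm (P *v (z - y'))) \<le> (1 + \<epsilon>) * (norm (P *v (x' - y')) + 2 * Bp * \<rho>)"
            by (rule mult_left_mono[OF N K])
          ultimately show ?thesis by linarith
        qed
        also have "\<dots> = (1 + \<epsilon>) * norm (P *v (x' - y')) + (1 + \<epsilon>) * (2 * Bp * \<rho>) + D * \<kappa>' k"
          by (simp add: D_def algebra_simps)
        also have "\<dots> \<le> (1 + \<epsilon>) * norm (P *v (x' - y')) + \<eta>" using \<rho>(3) elim by simp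
        finally show "d k x y \<le> (1 + \<epsilon>) * norm (P *v (snd c x - snd c y)) + \<eta>" by (simp add: sx)
      qed
    qed
  qed
  show ?thesis
  proof (rule that[of ?W c P])
    show "openin (top_of_set M) ?W" by (rule chart_inv_image_openin[OF bf(1) _ YO]) (simp add: Y_def)
    show "x0 \<in> ?W" using b(2) \<rho>0(1) by (auto simp: Y_def)
    show "c \<in> A" by (rule bf(1))
    show "?W \<subseteq> fst c" using snd_chart_inv_image(2)[OF bf(1) YO] .
    fix x u assume "x \<in> ?W"
    then show "norm (P *v u) \<le> (1 + \<epsilon>) * sqrt (u \<bullet> (tensor_matrix A g0 c x *v u))"
      using P(3) S1 Y by blast
  qed (rule est)
qed

section \<open>Convergence of the distances\<close>

lemma eventually_tame:
  assumes "x \<in> tame_set"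
  shows "\<forall>\<^sub>F k in sequentially. x \<in> tame k"
  using assms unfolding tame_set_def tame_from_def eventually_sequentially by auto

lemma continuous_chart_norm:
  assumes c: "c \<in> A" and W: "openin (top_of_set M) W" "W \<subseteq> fst c" "w \<in> W" and \<eta>: "0 < \<eta>"
  obtains V where "openin (top_of_set M) V" "w \<in> V" "V \<subseteq> W"
    "\<And>z. z \<in> V \<Longrightarrow> norm ((P :: real^'n^'n) *v (snd c z - snd c w)) < \<eta>"
proof -
  have cont: "continuous_on W (\<lambda>z. norm (P *v (snd c z - snd c w)))"
    by (intro continuous_on_norm bounded_linear.continuous_on[OF matrix_vector_mul_bounded_linear]
        continuous_on_diff continuous_on_const continuous_on_subset[OF chart_continuous[OF c] W(2)])
  let ?V = "W \<inter> (\<lambda>z. norm (P *v (snd c z - snd c w))) -` {..<\<eta>}"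
  have "openin (top_of_set W) ?V" by (rule continuous_openin_preimage_gen[OF cont]) simp
  then have "openin (top_of_set M) ?V" using W(1) openin_trans by blast
  then show ?thesis by (rule that) (use W \<eta> in auto)
qed

text \<open>
  Between tame points close to \<open>x\<close> and tame points close to \<open>y\<close> the upper limit of the distances exceeds \<open>C * L\<close>
  by an arbitrarily small amount at most. The points \<open>x\<close> and \<open>y\<close> will lie on a curve and need not be tame, so the bound
  cannot be stated for them.
\<close>

definition bounded_near :: "real \<Rightarrow> real \<Rightarrow> 'a \<Rightarrow> 'a \<Rightarrow> bool" where
  "bounded_near C L x y \<longleftrightarrow> (\<forall>\<eta>>0. \<exists>V W. openin (top_of_set M) V \<and> openin (top_of_set M) W \<and> x \<in> V \<and> y \<in> W \<and>
     (\<forall>z\<in>V \<inter> tame_set. \<forall>w\<in>W \<inter> tame_set. \<forall>\<^sub>F k in sequentially. d k z w \<le> C * L + \<eta>))"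

text \<open>
  By density there is a tame point close to \<open>y\<close>, through which the two bounds are joined.
\<close>

lemma bounded_near_trans:
  assumes "bounded_near C L x y" "bounded_near C L' y z"
  shows "bounded_near C (L + L') x z"
  unfolding bounded_near_def
proof (intro allI impI)
  fix \<eta> :: real assume \<eta>: "0 < \<eta>"
  then have \<eta>2: "0 < \<eta> / 2" by simp
  obtain V W where 1: "openin (top_of_set M) V" "openin (top_of_set M) W" "x \<in> V" "y \<in> W"
    "\<And>z w. z \<in> V \<inter> tame_set \<Longrightarrow> w \<in> W \<inter> tame_set \<Longrightarrow> \<forall>\<^sub>F k in sequentially. d k z w \<le> C * L + \<eta> / 2"
    using assms(1)[unfolded bounded_near_def, rule_format, OF \<eta>2] by blast
  obtain V' W' where 2: "openin (top_of_set M) V'" "openin (top_of_set M) W'" "y \<in> V'" "z \<in> W'"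
    "\<And>z w. z \<in> V' \<inter> tame_set \<Longrightarrow> w \<in> W' \<inter> tame_set \<Longrightarrow> \<forall>\<^sub>F k in sequentially. d k z w \<le> C * L' + \<eta> / 2"
    using assms(2)[unfolded bounded_near_def, rule_format, OF \<eta>2] by blast
  have "W \<inter> V' \<inter> tame_set \<noteq> {}"
    by (rule tame_set_dense[of _ y]) (use 1 2 in \<open>auto intro: openin_Int\<close>)
  then obtain u where u: "u \<in> W \<inter> tame_set" "u \<in> V' \<inter> tame_set" by blast
  have "\<forall>\<^sub>F k in sequentially. d k a b \<le> C * (L + L') + \<eta>" if a: "a \<in> V \<inter> tame_set" and b: "b \<in> W' \<inter> tame_set" for a b
    using 1(5)[OF a u(1)] 2(5)[OF u(2) b]
  proof eventually_elim
    case (elim k)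
    have "d k a b \<le> d k a u + d k u b"
      by (rule dist_triangle[OF g]; rule curves_ne) (use a b u tame_subset(3) in blast)+
    then show ?case using elim by (simp add: algebra_simps)
  qed
  then show "\<exists>V W. openin (top_of_set M) V \<and> openin (top_of_set M) W \<and> x \<in> V \<and> z \<in> W \<and>
     (\<forall>z\<in>V \<inter> tame_set. \<forall>w\<in>W \<inter> tame_set. \<forall>\<^sub>F k in sequentially. d k z w \<le> C * (L + L') + \<eta>)"
    using 1 2 by blast
qed

text \<open>
  The chord between the end points is at most \<open>1 + \<epsilon>\<close> times the \<open>g0\<close>-length of the curve, and the
  local estimate loses another factor \<open>1 + \<epsilon>\<close>.
\<close>

lemma bounded_near_local:
  assumes x0: "x0 \<in> M" and \<epsilon>: "0 < \<epsilon>"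
  obtains W where "openin (top_of_set M) W" "x0 \<in> W" 
    "\<And>a b \<gamma>. a \<le> b \<Longrightarrow> \<gamma> ` {a..b} \<subseteq> W \<Longrightarrow> a < b \<longrightarrow> C1_piece a b \<gamma> \<Longrightarrow>
      bounded_near ((1 + \<epsilon>)\<^sup>2) (integral {a..b} (speed g0 \<gamma>)) (\<gamma> a) (\<gamma> b)"
proof -
  obtain W c and P :: "real^'n^'n" where W: "openin (top_of_set M) W" "x0 \<in> W" "c \<in> A" "W \<subseteq> fst c"
    "\<And>x u. x \<in> W \<Longrightarrow> norm (P *v u) \<le> (1 + \<epsilon>) * sqrt (u \<bullet> (tensor_matrix A g0 c x *v u))"
    "\<And>\<eta>. 0 < \<eta> \<Longrightarrow> \<forall>\<^sub>F k in sequentially. \<forall>x\<in>W \<inter> tame k. \<forall>y\<in>W \<inter> tame k.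
       d k x y \<le> (1 + \<epsilon>) * norm (P *v (snd c x - snd c y)) + \<eta>"
    using local_estimate[OF x0 \<epsilon>] by blast
  show ?thesis
  proof (rule that[OF W(1,2)])
    fix a b \<gamma> assume ab: "a \<le> b" "\<gamma> ` {a..b} \<subseteq> W" "a < b \<longrightarrow> C1_piece a b \<gamma>"
    let ?L = "integral {a..b} (speed g0 \<gamma>)"
    have ends: "\<gamma> a \<in> W" "\<gamma> b \<in> W" using ab(1,2) by auto
    have chord: "norm (P *v (snd c (\<gamma> b) - snd c (\<gamma> a))) \<le> (1 + \<epsilon>) * ?L"
    proof (cases "a < b")
      case True
      show ?thesis
      proof (rule chord_le_length[OF g0 _ W(3)])
        show "C1_piece a b \<gamma>" using True ab(3) by blast
        show "\<gamma> ` {a..b} \<subseteq> fst c" using ab(2) W(4) by blast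
        fix t u assume "t \<in> {a..b}"
        then have "\<gamma> t \<in> W" using ab(2) by blast
        then show "norm (P *v u) \<le> (1 + \<epsilon>) * sqrt (u \<bullet> (tensor_matrix A g0 c (\<gamma> t) *v u))"
          by (rule W(5))
      qed
    next
      case False
      then have "a = b" using ab(1) by simp
      then show ?thesis by simp
    qed
    show "bounded_near ((1 + \<epsilon>)\<^sup>2) ?L (\<gamma> a) (\<gamma> b)"
      unfolding bounded_near_def
    proof (intro allI impI)
      fix \<eta> :: real assume \<eta>: "0 < \<eta>"
      define \<theta> where "\<theta> = \<eta> / (3 * (1 + \<epsilon>))"
      have \<theta>: "0 < \<theta>" "(1 + \<epsilon>) * \<theta> = \<eta> / 3" using \<eta> \<epsilon> by (auto simp: \<theta>_def field_simps)
      obtain V1 where V1: "openin (top_of_set M) V1" "\<gamma> a \<in> V1" "V1 \<subseteq> W"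
        "\<And>z. z \<in> V1 \<Longrightarrow> norm (P *v (snd c z - snd c (\<gamma> a))) < \<theta>"
        using continuous_chart_norm[OF W(3,1,4) ends(1) \<theta>(1)] by blast
      obtain V2 where V2: "openin (top_of_set M) V2" "\<gamma> b \<in> V2" "V2 \<subseteq> W"
        "\<And>z. z \<in> V2 \<Longrightarrow> norm (P *v (snd c z - snd c (\<gamma> b))) < \<theta>"
        using continuous_chart_norm[OF W(3,1,4) ends(2) \<theta>(1)] by blast
      have "\<forall>\<^sub>F k in sequentially. d k z w \<le> (1 + \<epsilon>)\<^sup>2 * ?L + \<eta>" if z: "z \<in> V1 \<inter> tame_set" and w: "w \<in> V2 \<inter> tame_set" for z w
      proof -
        have \<eta>3: "0 < \<eta> / 3" using \<eta> by simp
        have "\<forall>\<^sub>F k in sequentially. z \<in> tame k" "\<forall>\<^sub>F k in sequentially. w \<in> tame k"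
          using z w eventually_tame by auto
        then show ?thesis
          using W(6)[OF \<eta>3]
        proof eventually_elim
          case (elim k)
          have "P *v (snd c z - snd c w) = P *v (snd c z - snd c (\<gamma> a)) - P *v (snd c w - snd c (\<gamma> b)) - P *v (snd c (\<gamma> b) - snd c (\<gamma> a))"
            by (simp add: matrix_vector_mult_diff_distrib)
          then have "norm (P *v (snd c z - snd c w)) \<le> norm (P *v (snd c z - snd c (\<gamma> a))) + norm (P *v (snd c w - snd c (\<gamma> b))) + norm (P *v (snd c (\<gamma> b) - snd c (\<gamma> a)))"
            using norm_triangle_ineq4[of "P *v (snd c z - snd c (\<gamma> a)) - P *v (snd c w - snd c (\<gamma> b))" "P *v (snd c (\<gamma> b) - snd c (\<gamma> a))"]
              norm_triangle_ineq4[of "P *v (snd c z - snd c (\<gamma> a))" "P *v (snd c w - snd c (\<gamma> b))"]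
            by (simp only:)
          also have "\<dots> \<le> \<theta> + \<theta> + (1 + \<epsilon>) * ?L"
            using V1(4)[of z] V2(4)[of w] z w chord by (intro add_mono) auto
          finally have "(1 + \<epsilon>) * norm (P *v (snd c z - snd c w)) \<le> (1 + \<epsilon>) * (\<theta> + \<theta> + (1 + \<epsilon>) * ?L)"
            using \<epsilon> by (intro mult_left_mono) auto
          also have "\<dots> = 2 * (\<eta> / 3) + (1 + \<epsilon>)\<^sup>2 * ?L"
            unfolding \<theta>(2)[symmetric] by (simp add: power2_eq_square algebra_simps)
          finally have 1: "(1 + \<epsilon>) * norm (P *v (snd c z - snd c w)) \<le> 2 * (\<eta> / 3) + (1 + \<epsilon>)\<^sup>2 * ?L" .
          have "d k z w \<le> (1 + \<epsilon>) * norm (P *v (snd c z - snd c w)) + \<eta> / 3"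
            using elim z w V1(3) V2(3) by blast
          then show ?case using 1 by linarith
        qed
      qed
      then show "\<exists>V Wa. openin (top_of_set M) V \<and> openin (top_of_set M) Wa \<and> \<gamma> a \<in> V \<and> \<gamma> b \<in> Wa \<and>
        (\<forall>z\<in>V \<inter> tame_set. \<forall>w\<in>Wa \<inter> tame_set. \<forall>\<^sub>F k in sequentially. d k z w \<le> (1 + \<epsilon>)\<^sup>2 * ?L + \<eta>)"
        using V1 V2 by blast
    qed
  qed
qed

text \<open>
  The bound holds for short pieces by \<open>bounded_near_local\<close> and is additive by \<open>bounded_near_trans\<close>, so
  bisection extends it to the whole interval.
\<close>

lemma bounded_near_C1_piece:
  assumes p: "C1_piece a b \<gamma>" and \<epsilon>: "0 < \<epsilon>"
  shows "bounded_near ((1 + \<epsilon>)\<^sup>2) (integral {a..b} (speed g0 \<gamma>)) (\<gamma> a) (\<gamma> b)"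
proof -
  let ?Q = "\<lambda>s t. a \<le> s \<and> s \<le> t \<and> t \<le> b \<longrightarrow> bounded_near ((1 + \<epsilon>)\<^sup>2) (integral {s..t} (speed g0 \<gamma>)) (\<gamma> s) (\<gamma> t)"
  have ab: "a \<le> b" using p by (simp add: C1_piece_def)
  have int: "speed g0 \<gamma> integrable_on {a..b}" using speed_has_integral[OF g0 p] by blast
  have "?Q a b"
  proof (rule Bolzano[where P = ?Q, OF ab])
    fix s t u assume trans: "?Q s t" "?Q t u" "s \<le> t" "t \<le> u"
    show "?Q s u"
    proof
      assume *: "a \<le> s \<and> s \<le> u \<and> u \<le> b"
      have "integral {s..u} (speed g0 \<gamma>) = integral {s..t} (speed g0 \<gamma>) + integral {t..u} (speed g0 \<gamma>)"
        using Henstock_Kurzweil_Integration.integral_combine[of s t u "speed g0 \<gamma>"] trans(3,4) *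
          integrable_on_subinterval[OF int, of s u] by auto
      then show "bounded_near ((1 + \<epsilon>)\<^sup>2) (integral {s..u} (speed g0 \<gamma>)) (\<gamma> s) (\<gamma> u)"
        using bounded_near_trans[of "(1 + \<epsilon>)\<^sup>2" "integral {s..t} (speed g0 \<gamma>)" "\<gamma> s" "\<gamma> t" "integral {t..u} (speed g0 \<gamma>)" "\<gamma> u"]
          trans * by auto
    qed
  next
    fix t assume "a \<le> t" "t \<le> b"
    then have t: "t \<in> {a..b}" by simp
    then have "\<gamma> t \<in> M" using p by (auto simp: C1_piece_def)
    obtain W where W: "openin (top_of_set M) W" "\<gamma> t \<in> W"
      "\<And>a b \<gamma>. a \<le> b \<Longrightarrow> \<gamma> ` {a..b} \<subseteq> W \<Longrightarrow> a < b \<longrightarrow> C1_piece a b \<gamma> \<Longrightarrow>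
        bounded_near ((1 + \<epsilon>)\<^sup>2) (integral {a..b} (speed g0 \<gamma>)) (\<gamma> a) (\<gamma> b)"
      using bounded_near_local[OF \<open>\<gamma> t \<in> M\<close> \<epsilon>] by blast
    have "openin (top_of_set {a..b}) ({a..b} \<inter> \<gamma> -` W)"
      using p W(1) unfolding C1_piece_def by (meson continuous_openin_preimage image_subset_iff_funcset)
    then obtain e where e: "e > 0" "ball t e \<inter> {a..b} \<subseteq> {a..b} \<inter> \<gamma> -` W"
      using t W(2) by (metis (no_types, lifting) IntI openin_contains_ball vimageI)
    have "bounded_near ((1 + \<epsilon>)\<^sup>2) (integral {s..u} (speed g0 \<gamma>)) (\<gamma> s) (\<gamma> u)"
      if su: "s \<le> t" "t \<le> u" "u - s < e" and *: "a \<le> s \<and> s \<le> u \<and> u \<le> b" for s u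
    proof -
      have "{s..u} \<subseteq> ball t e \<inter> {a..b}" using su * by (auto simp: dist_real_def)
      then have "\<gamma> ` {s..u} \<subseteq> W" using e(2) by blast
      then show ?thesis
        using * C1_piece_subinterval[OF p, of s u] by (intro W(3)) auto
    qed
    then show "\<exists>d>0. \<forall>s u. s \<le> t \<and> t \<le> u \<and> u - s < d \<longrightarrow> ?Q s u" using e(1) by blast
  qed
  then show ?thesis using ab by blast
qed

lemma bounded_near_pw_curve:
  assumes "pw_curve \<gamma> a b" "a < b" and \<epsilon>: "0 < \<epsilon>"
  shows "bounded_near ((1 + \<epsilon>)\<^sup>2) (integral {a..b} (speed g0 \<gamma>)) (\<gamma> a) (\<gamma> b)"
  using assms(1,2)
proof induction
  case (step a b c)
  show ?case
  proof (cases "a = b")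
    case True
    then show ?thesis using bounded_near_C1_piece[OF step.hyps(2) \<epsilon>] by simp
  next
    case False
    then have "a < b" using pw_curve_le[OF step.hyps(1)] by simp
    have bc: "pw_curve \<gamma> b c" using step.hyps(2) by (auto intro: pw_curve.intros)
    show ?thesis
      unfolding pw_curve_integral_combine[OF step.hyps(1) bc g0]
      by (rule bounded_near_trans[OF step.IH[OF \<open>a < b\<close>] bounded_near_C1_piece[OF step.hyps(2) \<epsilon>]])
  qed
qed simp

lemma dist_lower: "x \<in> M \<Longrightarrow> y \<in> M \<Longrightarrow> \<kappa> k * d0 x y \<le> d k x y"
  by (rule dist_scale_mono[OF g0 g \<kappa>_nonneg curves_ne lower])

text \<open>
  A curve of length almost \<open>d\<^sub>0(x,y)\<close> joins \<open>x\<close> to \<open>y\<close>, and these two points are tame themselves.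
\<close>

lemma dist_upper_eventually:
  assumes x: "x \<in> tame_set" and y: "y \<in> tame_set" and e: "0 < e"
  shows "\<forall>\<^sub>F k in sequentially. d k x y < d0 x y + e"
proof -
  have xy: "x \<in> M" "y \<in> M" using x y tame_subset(3) by auto
  define L where "L = d0 x y + e / 4"
  have L: "0 < L" using dist_nonneg[OF g0 curves_ne[OF xy]] e by (simp add: L_def)
  obtain \<gamma> where \<gamma>: "\<gamma> \<in> curves x y" "curve_length A g0 \<gamma> < L"
    by (rule dist_less_obtain[OF curves_ne[OF xy], of g0 L]) (use e in \<open>auto simp: L_def\<close>)
  \<comment> \<open>For \<epsilon> \<le> 1 the factor \<open>(1 + \<epsilon>)\<^sup>2\<close> is at most \<open>1 + 3 \<epsilon>\<close>.\<close>
  define \<epsilon> where "\<epsilon> = min 1 (e / (12 * L))"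
  have \<epsilon>: "0 < \<epsilon>" "(1 + \<epsilon>)\<^sup>2 * L \<le> L + e / 4"
  proof -
    show "0 < \<epsilon>" using e L by (simp add: \<epsilon>_def)
    have "\<epsilon> \<le> 1" "\<epsilon> \<le> e / (12 * L)" by (auto simp: \<epsilon>_def)
    then have "\<epsilon> * \<epsilon> \<le> \<epsilon>" "12 * (\<epsilon> * L) \<le> e"
      using \<open>0 < \<epsilon>\<close> L by (auto simp: field_simps mult_left_le)
    have "(1 + \<epsilon>)\<^sup>2 = 1 + 2 * \<epsilon> + \<epsilon> * \<epsilon>" by (simp add: power2_eq_square algebra_simps)
    then have "(1 + \<epsilon>)\<^sup>2 \<le> 1 + 3 * \<epsilon>" using \<open>\<epsilon> * \<epsilon> \<le> \<epsilon>\<close> by linarith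
    then have "(1 + \<epsilon>)\<^sup>2 * L \<le> (1 + 3 * \<epsilon>) * L" using L by (intro mult_right_mono) auto
    also have "\<dots> = L + 3 * (\<epsilon> * L)" by (simp add: algebra_simps)
    finally show "(1 + \<epsilon>)\<^sup>2 * L \<le> L + e / 4" using \<open>12 * (\<epsilon> * L) \<le> e\<close> by linarith
  qed
  have "bounded_near ((1 + \<epsilon>)\<^sup>2) (curve_length A g0 \<gamma>) (\<gamma> 0) (\<gamma> 1)"
    unfolding curve_length_speed
    by (rule bounded_near_pw_curve[OF _ _ \<epsilon>(1)]) (use \<gamma>(1) in \<open>auto simp: curves_def piecewise_C1_curve_iff\<close>)
  then have bn: "bounded_near ((1 + \<epsilon>)\<^sup>2) (curve_length A g0 \<gamma>) x y"
    using \<gamma>(1) by (auto simp: curves_def pathstart_def pathfinish_def)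
  have e4: "0 < e / 4" using e by simp
  obtain V W where VW: "x \<in> V" "y \<in> W"
    "\<And>z w. z \<in> V \<inter> tame_set \<Longrightarrow> w \<in> W \<inter> tame_set \<Longrightarrow> \<forall>\<^sub>F k in sequentially. d k z w \<le> (1 + \<epsilon>)\<^sup>2 * curve_length A g0 \<gamma> + e / 4"
    using bn[unfolded bounded_near_def, rule_format, OF e4] by blast
  have "\<forall>\<^sub>F k in sequentially. d k x y \<le> (1 + \<epsilon>)\<^sup>2 * curve_length A g0 \<gamma> + e / 4"
    by (rule VW(3)) (use VW x y in auto)
  then show ?thesis
  proof eventually_elim
    case (elim k)
    have "(1 + \<epsilon>)\<^sup>2 * curve_length A g0 \<gamma> \<le> (1 + \<epsilon>)\<^sup>2 * L"
      using \<gamma>(2) by (intro mult_left_mono) auto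
    then show ?case using elim \<epsilon>(2) e unfolding L_def by linarith
  qed
qed

lemma eventually_kappa:
  assumes "0 < e"
  shows "\<forall>\<^sub>F k in sequentially. (1 - \<kappa> k) * D < e"
proof -
  have "(\<lambda>k. (1 - \<kappa> k) * D) \<longlonglongrightarrow> (1 - 1) * D" by (intro tendsto_intros \<kappa>_lim)
  then show ?thesis by (rule order_tendstoD) (use assms in simp)
qed

theorem dist_tendsto:
  assumes x: "x \<in> tame_set" and y: "y \<in> tame_set"
  shows "(\<lambda>k. d k x y) \<longlonglongrightarrow> d0 x y"
proof (rule tendstoI)
  fix e :: real assume e: "0 < e"
  have xy: "x \<in> M" "y \<in> M" using x y tame_subset(3) by auto
  show "\<forall>\<^sub>F k in sequentially. dist (d k x y) (d0 x y) < e"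
    using dist_upper_eventually[OF x y e] eventually_kappa[OF e, of "d0 x y"]
  proof eventually_elim
    case (elim k)
    then show ?case using dist_lower[OF xy, of k] by (simp add: dist_real_def algebra_simps abs_less_iff)
  qed
qed

text \<open>
  The local estimate is used here with the crude factor 2, in a neighbourhood that is small in the constant
  norm.
\<close>

lemma small_neighbourhood:
  assumes x0: "x0 \<in> M" and e: "0 < e"
  obtains W where "openin (top_of_set M) W" "x0 \<in> W"
    "\<forall>\<^sub>F k in sequentially. \<forall>x\<in>W \<inter> tame k. \<forall>y\<in>W \<inter> tame k. d k x y \<le> e"
proof -
  obtain W c and P :: "real^'n^'n" where W: "openin (top_of_set M) W" "x0 \<in> W" "c \<in> A" "W \<subseteq> fst c"
    "\<And>x u. x \<in> W \<Longrightarrow> norm (P *v u) \<le> (1 + 1) * sqrt (u \<bullet> (tensor_matrix A g0 c x *v u))"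
    "\<And>\<eta>. 0 < \<eta> \<Longrightarrow> \<forall>\<^sub>F k in sequentially. \<forall>x\<in>W \<inter> tame k. \<forall>y\<in>W \<inter> tame k.
       d k x y \<le> (1 + 1) * norm (P *v (snd c x - snd c y)) + \<eta>"
    using local_estimate[OF x0 zero_less_one] by blast
  have e8: "0 < e / 8" "0 < e / 2" using e by auto
  obtain V where V: "openin (top_of_set M) V" "x0 \<in> V" "V \<subseteq> W"
    "\<And>z. z \<in> V \<Longrightarrow> norm (P *v (snd c z - snd c x0)) < e / 8"
    using continuous_chart_norm[OF W(3,1,4,2) e8(1)] by blast
  have "\<forall>\<^sub>F k in sequentially. \<forall>x\<in>V \<inter> tame k. \<forall>y\<in>V \<inter> tame k. d k x y \<le> e"
    using W(6)[OF e8(2)]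
  proof eventually_elim
    case (elim k)
    show ?case
    proof (intro ballI)
      fix x y assume xy: "x \<in> V \<inter> tame k" "y \<in> V \<inter> tame k"
      have "P *v (snd c x - snd c y) = P *v (snd c x - snd c x0) - P *v (snd c y - snd c x0)"
        by (simp add: matrix_vector_mult_diff_distrib)
      then have "norm (P *v (snd c x - snd c y)) \<le> norm (P *v (snd c x - snd c x0)) + norm (P *v (snd c y - snd c x0))"
        using norm_triangle_ineq4[of "P *v (snd c x - snd c x0)" "P *v (snd c y - snd c x0)"] by simp
      then have "norm (P *v (snd c x - snd c y)) \<le> e / 4"
        using V(4)[of x] V(4)[of y] xy by auto
      moreover have "d k x y \<le> (1 + 1) * norm (P *v (snd c x - snd c y)) + e / 2"
        using elim xy V(3) by blast
      ultimately show "d k x y \<le> e" by simp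
    qed
  qed
  then show ?thesis using that V by blast
qed

text \<open>
  Every point of \<open>tame_from K\<close> is close to one of finitely many tame points \<open>q i\<close>, uniformly in \<open>d k\<close> for large
  \<open>k\<close> and then also in \<open>d\<^sub>0\<close> because of the lower bound. This reduces the upper bound to
  finitely many pairs. The lower bound is uniform since \<open>d\<^sub>0\<close> is bounded on \<open>tame_from K\<close>.
\<close>

theorem dist_uniform_limit:
  "uniform_limit (tame_from K \<times> tame_from K) (\<lambda>k (x, y). d k x y) (\<lambda>(x, y). d0 x y) sequentially"
proof (rule uniform_limitI)
  fix e :: real assume e: "0 < e"
  define \<eta> where "\<eta> = e / 8"
  have \<eta>: "0 < \<eta>" using e by (simp add: \<eta>_def)
  have KM: "tame_from K \<subseteq> M" "tame_from K \<subseteq> tame_set" using tame_subset by (auto simp: tame_set_def)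
  have "\<forall>x\<in>M. \<exists>W. openin (top_of_set M) W \<and> x \<in> W \<and> (\<forall>\<^sub>F k in sequentially. \<forall>y\<in>W \<inter> tame k. \<forall>z\<in>W \<inter> tame k. d k y z \<le> \<eta>)"
  proof
    fix x assume x: "x \<in> M"
    show "\<exists>W. openin (top_of_set M) W \<and> x \<in> W \<and> (\<forall>\<^sub>F k in sequentially. \<forall>y\<in>W \<inter> tame k. \<forall>z\<in>W \<inter> tame k. d k y z \<le> \<eta>)"
      by (rule small_neighbourhood[OF x \<eta>]) blast
  qed
  from bchoice[OF this] obtain W where W: "\<And>x. x \<in> M \<Longrightarrow> openin (top_of_set M) (W x) \<and> x \<in> W x"
    "\<And>x. x \<in> M \<Longrightarrow> \<forall>\<^sub>F k in sequentially. \<forall>y\<in>W x \<inter> tame k. \<forall>z\<in>W x \<inter> tame k. d k y z \<le> \<eta>"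
    by blast
  have "\<exists>F. finite F \<and> F \<subseteq> M \<and> M = (\<Union>x\<in>F. W x)"
    by (rule finite_subcover[OF compact_M W(1)])
  then obtain F where F: "finite F" "F \<subseteq> M" "M = (\<Union>x\<in>F. W x)" by blast
  \<comment> \<open>Only neighbourhoods that meet the set get a net point, which has to be chosen in the set.\<close>
  define F' where "F' = {x \<in> F. W x \<inter> tame_from K \<noteq> {}}"
  have F': "finite F'" using F(1) by (simp add: F'_def)
  have "\<exists>q. \<forall>x\<in>F'. q x \<in> W x \<inter> tame_from K" by (rule bchoice) (auto simp: F'_def)
  then obtain q where q: "\<And>x. x \<in> F' \<Longrightarrow> q x \<in> W x \<inter> tame_from K" by blast
  have net: "\<exists>i\<in>F'. x \<in> W i" if "x \<in> tame_from K" for x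
    using that KM(1) F(3) unfolding F'_def by blast
  have ev1: "\<forall>\<^sub>F k in sequentially. \<forall>i\<in>F'. \<forall>y\<in>W i \<inter> tame k. \<forall>z\<in>W i \<inter> tame k. d k y z \<le> \<eta>"
    by (rule eventually_ball_finite[OF F']) (use W(2) F(2) in \<open>auto simp: F'_def\<close>)
  have ev2: "\<forall>\<^sub>F k in sequentially. \<forall>i\<in>F'. \<forall>j\<in>F'. d k (q i) (q j) < d0 (q i) (q j) + \<eta>"
    by (intro eventually_ball_finite[OF F'] ballI dist_upper_eventually \<eta>) (use q KM(2) in blast)+
  have ev3: "\<forall>\<^sub>F k in sequentially. k \<ge> K" by (rule eventually_ge_at_top)
  \<comment> \<open>A positive lower bound for one value of \<kappa> compares the two distances.\<close>
  have ev4: "\<forall>\<^sub>F k in sequentially. 1 / 2 < \<kappa> k"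
    by (rule order_tendstoD[OF \<kappa>_lim]) simp
  have "\<forall>\<^sub>F k in sequentially. (\<forall>i\<in>F'. \<forall>y\<in>W i \<inter> tame k. \<forall>z\<in>W i \<inter> tame k. d k y z \<le> \<eta>) \<and> K \<le> k \<and> 1 / 2 < \<kappa> k"
    by (intro eventually_conj ev1 ev3 ev4)
  then obtain k0 where k0: "\<forall>i\<in>F'. \<forall>y\<in>W i \<inter> tame k0. \<forall>z\<in>W i \<inter> tame k0. d k0 y z \<le> \<eta>" "k0 \<ge> K" "1 / 2 < \<kappa> k0"
    unfolding eventually_sequentially by blast
  have d0_small: "d0 y z \<le> 2 * \<eta>" if "i \<in> F'" "y \<in> W i \<inter> tame_from K" "z \<in> W i \<inter> tame_from K" for i y z
  proof -
    have yz: "y \<in> M" "z \<in> M" "y \<in> W i \<inter> tame k0" "z \<in> W i \<inter> tame k0"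
      using that k0(2) KM(1) by (auto simp: tame_from_def)
    have "1 / 2 * d0 y z \<le> \<kappa> k0 * d0 y z"
      using k0(3) dist_nonneg[OF g0 curves_ne[OF yz(1,2)]] by (intro mult_right_mono) auto
    also have "\<dots> \<le> d k0 y z" by (rule dist_lower[OF yz(1,2)])
    also have "\<dots> \<le> \<eta>" using k0(1) that(1) yz(3,4) by blast
    finally show ?thesis by simp
  qed
  \<comment> \<open>A bound for the diameter of the set: the distance of two net points plus two steps of length 2 \<eta>.\<close>
  define D where "D = (\<Sum>i\<in>F'. \<Sum>j\<in>F'. d0 (q i) (q j)) + 4 * \<eta>"
  have qM: "q i \<in> M" if "i \<in> F'" for i using q[OF that] KM(1) by blast
  have d0_nonneg: "0 \<le> d0 y z" if "y \<in> M" "z \<in> M" for y z using dist_nonneg[OF g0 curves_ne[OF that]] .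
  have tri0: "d0 x z \<le> d0 x y + d0 y z" if "x \<in> M" "y \<in> M" "z \<in> M" for x y z
    by (rule dist_triangle[OF g0 curves_ne curves_ne]) (use that in auto)
  have tri: "d k x z \<le> d k x y + d k y z" if "x \<in> M" "y \<in> M" "z \<in> M" for k x y z
    by (rule dist_triangle[OF g curves_ne curves_ne]) (use that in auto)
  have d0_D: "d0 x y \<le> D" if x: "x \<in> tame_from K" and y: "y \<in> tame_from K" for x y
  proof -
    obtain i where i: "i \<in> F'" "x \<in> W i" using net[OF x] by blast
    obtain j where j: "j \<in> F'" "y \<in> W j" using net[OF y] by blast
    have M: "x \<in> M" "y \<in> M" using x y KM(1) by auto
    have "d0 (q i) (q j) \<le> (\<Sum>j\<in>F'. d0 (q i) (q j))"
      by (rule member_le_sum[OF j(1) _ F']) (use d0_nonneg qM i in auto)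
    also have "\<dots> \<le> (\<Sum>i\<in>F'. \<Sum>j\<in>F'. d0 (q i) (q j))"
      by (rule member_le_sum[OF i(1) _ F', of "\<lambda>i. \<Sum>j\<in>F'. d0 (q i) (q j)"]) (use d0_nonneg qM in \<open>auto intro!: sum_nonneg\<close>)
    finally have s: "d0 (q i) (q j) \<le> (\<Sum>i\<in>F'. \<Sum>j\<in>F'. d0 (q i) (q j))" .
    have "d0 x (q i) \<le> 2 * \<eta>" "d0 (q j) y \<le> 2 * \<eta>"
      using d0_small[OF i(1)] d0_small[OF j(1)] i j q x y by auto
    then show ?thesis
      using s tri0[OF M(1) qM[OF i(1)] M(2)] tri0[OF qM[OF i(1)] qM[OF j(1)] M(2)] unfolding D_def by linarith
  qed
  have ev5: "\<forall>\<^sub>F k in sequentially. (1 - \<kappa> k) * D < e" by (rule eventually_kappa[OF e])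
  show "\<forall>\<^sub>F k in sequentially. \<forall>xy\<in>tame_from K \<times> tame_from K. dist (case xy of (x, y) \<Rightarrow> d k x y) (case xy of (x, y) \<Rightarrow> d0 x y) < e"
    using ev1 ev2 ev3 ev5
  proof eventually_elim
    case (elim k)
    have "dist (d k x y) (d0 x y) < e" if x: "x \<in> tame_from K" and y: "y \<in> tame_from K" for x y
    proof -
      obtain i where i: "i \<in> F'" "x \<in> W i" using net[OF x] by blast
      obtain j where j: "j \<in> F'" "y \<in> W j" using net[OF y] by blast
      have M: "x \<in> M" "y \<in> M" using x y KM(1) by auto
      have t: "z \<in> tame k" if "z \<in> tame_from K" for z using that elim(3) by (auto simp: tame_from_def)
      have 1: "d k x (q i) \<le> \<eta>" "d k (q j) y \<le> \<eta>"
        using elim(1) i j q x y t by blast+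
      have 2: "d0 (q i) x \<le> 2 * \<eta>" "d0 y (q j) \<le> 2 * \<eta>"
        using d0_small[OF i(1)] d0_small[OF j(1)] i j q x y by auto
      have "d k x y \<le> d k x (q i) + d k (q i) (q j) + d k (q j) y"
        using tri[OF M(1) qM[OF i(1)] M(2), of k] tri[OF qM[OF i(1)] qM[OF j(1)] M(2), of k] by linarith
      moreover have "d k (q i) (q j) < d0 (q i) (q j) + \<eta>" using elim(2) i j by blast
      moreover have "d0 (q i) (q j) \<le> d0 (q i) x + d0 x y + d0 y (q j)"
        using tri0[OF qM[OF i(1)] M(1) qM[OF j(1)]] tri0[OF M(1) M(2) qM[OF j(1)]] by linarith
      \<comment> \<open>Two steps in d k of length \<eta>, the error \<eta> at the net points, and two steps in d0 of length 2 \<eta>.\<close>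
      ultimately have up: "d k x y < d0 x y + 7 * \<eta>" using 1 2 by linarith
      have "(1 - \<kappa> k) * d0 x y < e"
      proof (cases "0 \<le> 1 - \<kappa> k")
        case True
        then have "(1 - \<kappa> k) * d0 x y \<le> (1 - \<kappa> k) * D" using d0_D[OF x y] by (rule mult_left_mono[rotated])
        then show ?thesis using elim(4) by linarith
      next
        case False
        then have "(1 - \<kappa> k) * d0 x y \<le> 0" using d0_nonneg[OF M] by (intro mult_nonpos_nonneg) auto
        then show ?thesis using e by linarith
      qed
      then have "d0 x y - e < d k x y" using dist_lower[OF M, of k] by (simp add: algebra_simps)
      then show ?thesis using up e unfolding \<eta>_def by (simp add: dist_real_def abs_less_iff)
    qed
    then show ?case by auto
  qed
qed

lemma tame_from_complement_small:
  assumes "0 < \<epsilon>"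
  shows "\<exists>K. emeasure (riemannian_volume M A g0) (M - tame_from K) < ennreal \<epsilon>"
proof -
  let ?V = "riemannian_volume M A g0"
  note sv = sets_vol[OF g0 compact_M]
  interpret finite_measure ?V by (rule vol_finite[OF g0 compact_M])
  have M: "M \<in> sets ?V" by (rule M_sets_vol[OF g0 compact_M])
  have "(\<lambda>K. emeasure ?V (M - tame_from K)) \<longlonglongrightarrow> emeasure ?V (\<Inter>K. M - tame_from K)"
  proof (rule Lim_emeasure_decseq)
    show "range (\<lambda>K. M - tame_from K) \<subseteq> sets ?V" using M tame_from_sets sv by auto
    show "decseq (\<lambda>K. M - tame_from K)" by (auto simp: decseq_def tame_from_def)
    show "emeasure ?V (M - tame_from K) \<noteq> \<infinity>" for K by simp
  qed
  also have "(\<Inter>K. M - tame_from K) = M - tame_set" by (auto simp: tame_set_def)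
  finally have "(\<lambda>K. emeasure ?V (M - tame_from K)) \<longlonglongrightarrow> 0" by (simp add: emeasure_complement)
  then have "\<forall>\<^sub>F K in sequentially. emeasure ?V (M - tame_from K) < ennreal \<epsilon>"
    by (rule order_tendstoD) (use assms in simp)
  then show ?thesis unfolding eventually_sequentially by blast
qed

lemma emeasure_tame_set: "emeasure (riemannian_volume M A g0) tame_set = emeasure (riemannian_volume M A g0) M"
proof -
  let ?V = "riemannian_volume M A g0"
  have M: "M \<in> sets ?V" by (rule M_sets_vol[OF g0 compact_M])
  have U: "tame_set \<in> sets ?V" using tame_set_sets sets_vol[OF g0 compact_M] by simp
  have "emeasure ?V M = emeasure ?V tame_set + emeasure ?V (M - tame_set)"
    using plus_emeasure[of tame_set ?V "M - tame_set"] M U tame_subset(3) by (simp add: Un_absorb1 Un_Diff_cancel)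
  then show ?thesis by (simp add: emeasure_complement)
qed

end

section \<open>Passage to a fast subsequence\<close>

lemma smooth_metric_continuous:
  assumes "smooth_atlas M A" "smooth_metric M A g"
  shows "continuous_metric M A g"
proof -
  interpret smooth_atlas M A by fact
  have "continuous_on (fst c) (tensor_matrix A g c)" if c: "c \<in> A" for c
  proof -
    have "continuous_on (snd c ` fst c) (\<lambda>y. tensor_matrix A g c (chart_inv c y))"
      using assms(2) c by (auto simp: smooth_metric_def intro: smooth_on_continuous)
    then have "continuous_on (fst c) (\<lambda>x. tensor_matrix A g c (chart_inv c (snd c x)))"
      by (rule continuous_on_compose2[OF _ chart_continuous[OF c]]) simp
    then show ?thesis by (rule continuous_on_eq) (simp add: chart_inv_left[OF c])
  qed
  then show ?thesis using assms(2) by (simp add: smooth_metric_def continuous_metric_def)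
qed

lemma fast_subsequence:
  fixes X :: "nat \<Rightarrow> real" and b :: "nat \<Rightarrow> real"
  assumes "X \<longlonglongrightarrow> 0" "\<And>k. 0 < b k"
  shows "\<exists>r. strict_mono r \<and> (\<forall>k. 1 \<le> r k \<and> X (r k) \<le> b k)"
proof -
  have ex: "\<exists>n>m. X n \<le> b k" for m k
  proof -
    have "\<forall>\<^sub>F n in sequentially. X n < b k" by (rule order_tendstoD(2)[OF assms])
    moreover have "\<forall>\<^sub>F n in sequentially. n > m" by (rule eventually_gt_at_top)
    ultimately have "\<forall>\<^sub>F n in sequentially. X n < b k \<and> n > m" by (rule eventually_conj)
    then show ?thesis unfolding eventually_sequentially by (meson less_imp_le order_refl)
  qed
  have "\<exists>r. \<forall>k. (1 \<le> r k \<and> X (r k) \<le> b k) \<and> r k < r (Suc k)"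
  proof (rule dependent_nat_choice)
    show "\<exists>n. 1 \<le> n \<and> X n \<le> b 0" using ex[of 0 0] by (metis One_nat_def Suc_leI)
    show "\<exists>n'. (1 \<le> n' \<and> X n' \<le> b (Suc k)) \<and> n < n'" if "1 \<le> n \<and> X n \<le> b k" for n k
      using ex[of n "Suc k"] that by (meson less_imp_le order_trans)
  qed
  then show ?thesis using strict_mono_Suc_iff by blast
qed

theorem theorem1p2:
  fixes M :: "'a::t2_space set"
    and A :: "('a, 'n::finite) chart set"
    and g0 :: "('a, 'n) tensor2"
    and g :: "nat \<Rightarrow> ('a, 'n) tensor2"
    and p :: real
  assumes "oriented_smooth_manifold M A" and "compact M" and "connected M"
    and "smooth_metric M A g0"
    and "\<And>j. 1 \<le> j \<Longrightarrow> continuous_metric M A (g j)"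
    and "\<And>j x v. 1 \<le> j \<Longrightarrow> x \<in> M \<Longrightarrow> v \<in> tangent_space A x \<Longrightarrow>
           g j x v v \<ge> (1 - 1 / real j) * g0 x v v"
    and "1 / 2 \<le> p" and "p \<le> real CARD('n) / 2"
    and "(\<lambda>j. Lp_tensor_norm M A g0 p (\<lambda>x u v. g j x u v - g0 x u v)) \<longlonglongrightarrow> 0"
  shows "\<exists>r :: nat \<Rightarrow> nat. strict_mono r \<and> (\<forall>k. 1 \<le> r k) \<and>
     (\<exists>U \<in> sets (riemannian_volume M A g0).
        emeasure (riemannian_volume M A g0) U = emeasure (riemannian_volume M A g0) M \<and>
        hausdorff_dim M (riemannian_dist M A g0) (M - U) \<le> ereal (real CARD('n) - 2 * p) \<and>
        (\<forall>x\<in>U. \<forall>y\<in>U.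
           (\<lambda>k. riemannian_dist M A (g (r k)) x y) \<longlonglongrightarrow> riemannian_dist M A g0 x y)) \<and>
     (\<forall>\<epsilon>>0. \<exists>U\<epsilon> \<in> sets (riemannian_volume M A g0).
        emeasure (riemannian_volume M A g0) (M - U\<epsilon>) < ennreal \<epsilon> \<and>
        uniform_limit (U\<epsilon> \<times> U\<epsilon>)
          (\<lambda>k (x, y). riemannian_dist M A (g (r k)) x y)
          (\<lambda>(x, y). riemannian_dist M A g0 x y) sequentially)"
proof -
  interpret smooth_atlas M A
    by unfold_locales (use assms(1) in \<open>simp add: oriented_smooth_manifold_def\<close>)
  have g0: "continuous_metric M A g0"
    by (rule smooth_metric_continuous[OF smooth_atlas_axioms assms(4)])
  have p: "0 < p" using assms(7) by simp
  define h where "h j = (\<lambda>x u v. g j x u v - g0 x u v)" for j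
  have "(\<lambda>j. Lp_tensor_norm M A g0 p (h j) powr p) \<longlonglongrightarrow> 0 powr p"
    unfolding h_def
    by (rule tendsto_powr'[OF assms(9) tendsto_const])
       (use p in \<open>auto simp: Lp_tensor_norm_def\<close>)
  then have "(\<lambda>j. Lp_tensor_norm M A g0 p (h j) powr p) \<longlonglongrightarrow> 0" using p by simp
  from fast_subsequence[OF this, of "\<lambda>k. (1 / 4) ^ k"]
  obtain r where r: "strict_mono r" "\<And>k. 1 \<le> r k" "\<And>k. Lp_tensor_norm M A g0 p (h (r k)) powr p \<le> (1 / 4) ^ k"
    by auto
  define f where "f k = tensor_norm A g0 (h (r k))" for k
  define \<kappa> where "\<kappa> k = sqrt (1 - 1 / real (r k))" for k
  obtain balls where balls: "finite balls" "\<And>c a \<rho>. (c, a, \<rho>) \<in> balls \<Longrightarrow> good_ball c a \<rho>"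
    "M = (\<Union>(c, a, \<rho>)\<in>balls. chart_inv c ` ball a \<rho>)"
    by (rule good_ball_cover[OF assms(2)]) blast
  have gr: "continuous_metric M A (g (r k))" for k by (rule assms(5)[OF r(2)])
  have gm: "metric_tensor M A (g (r k))" "metric_tensor M A g0" for k
    using gr g0 by (auto simp: continuous_metric_def)
  have f_cont: "continuous_on M (f k)" for k
    unfolding f_def h_def by (rule continuous_tensor_norm_diff[OF gr g0])
  interpret pinched_metrics M A g0 "\<lambda>k. g (r k)" f \<kappa> p balls
  proof unfold_locales
    show "(\<kappa> k)\<^sup>2 * g0 x v v \<le> g (r k) x v v" if "x \<in> M" "v \<in> tangent_space A x" for k x v
    proof -
      have "1 / real (r k) \<le> 1" using r(2)[of k] by simp
      then have "(\<kappa> k)\<^sup>2 = 1 - 1 / real (r k)" by (simp add: \<kappa>_def)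
      then show ?thesis using assms(6)[OF r(2) that] by simp
    qed
    show "0 \<le> \<kappa> k" for k using r(2)[of k] by (simp add: \<kappa>_def)
    have "(\<lambda>k. 1 / real (r k)) \<longlonglongrightarrow> 0"
      using LIMSEQ_subseq_LIMSEQ[OF lim_inverse_n' r(1)] by (simp add: comp_def)
    then have "\<kappa> \<longlonglongrightarrow> sqrt (1 - 0)"
      unfolding \<kappa>_def by (intro tendsto_intros)
    then show "\<kappa> \<longlonglongrightarrow> 1" by simp
    show "g (r k) x v v \<le> (1 + f k x) * g0 x v v" if "x \<in> M" "v \<in> tangent_space A x" for k x v
      unfolding f_def h_def by (rule metric_le_tensor_norm[OF gm that])
    show "0 \<le> f k x" for k x unfolding f_def by (rule tensor_norm_nonneg)
    show "(\<integral>\<^sup>+x. ennreal (f k x powr p) \<partial>riemannian_volume M A g0) \<le> ennreal ((1 / 4) ^ k)" for k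
    proof -
      have "(\<integral>\<^sup>+x. ennreal (f k x powr p) \<partial>riemannian_volume M A g0) =
          ennreal (Lp_tensor_norm M A g0 p (h (r k)) powr p)"
        unfolding Lp_tensor_norm_def f_def[symmetric]
        by (rule nn_integral_eq_Lp[OF g0 assms(2) f_cont _ p]) (simp add: f_def tensor_norm_nonneg)
      then show ?thesis using r(3)[of k] by (simp add: ennreal_leI)
    qed
  qed (use assms gr g0 f_cont balls in blast)+
  have sets: "tame_set \<in> sets (riemannian_volume M A g0)" "tame_from K \<in> sets (riemannian_volume M A g0)" for K
    using tame_set_sets tame_from_sets sets_vol[OF g0 assms(2)] by auto
  have "\<exists>U \<in> sets (riemannian_volume M A g0).
        emeasure (riemannian_volume M A g0) U = emeasure (riemannian_volume M A g0) M \<and>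
        hausdorff_dim M (riemannian_dist M A g0) (M - U) \<le> ereal (real CARD('n) - 2 * p) \<and>
        (\<forall>x\<in>U. \<forall>y\<in>U.
           (\<lambda>k. riemannian_dist M A (g (r k)) x y) \<longlonglongrightarrow> riemannian_dist M A g0 x y)"
    using sets(1) emeasure_tame_set hausdorff_dim_complement assms(8) dist_tendsto
    by (intro bexI[of _ tame_set] conjI ballI) auto
  moreover have "\<forall>\<epsilon>>0. \<exists>U\<epsilon> \<in> sets (riemannian_volume M A g0).
        emeasure (riemannian_volume M A g0) (M - U\<epsilon>) < ennreal \<epsilon> \<and>
        uniform_limit (U\<epsilon> \<times> U\<epsilon>)
          (\<lambda>k (x, y). riemannian_dist M A (g (r k)) x y)
          (\<lambda>(x, y). riemannian_dist M A g0 x y) sequentially"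
  proof (intro allI impI)
    fix \<epsilon> :: real assume "0 < \<epsilon>"
    then obtain K where "emeasure (riemannian_volume M A g0) (M - tame_from K) < ennreal \<epsilon>"
      using tame_from_complement_small by blast
    then show "\<exists>U\<epsilon> \<in> sets (riemannian_volume M A g0).
        emeasure (riemannian_volume M A g0) (M - U\<epsilon>) < ennreal \<epsilon> \<and>
        uniform_limit (U\<epsilon> \<times> U\<epsilon>)
          (\<lambda>k (x, y). riemannian_dist M A (g (r k)) x y)
          (\<lambda>(x, y). riemannian_dist M A g0 x y) sequentially"
      using sets(2) dist_uniform_limit by blast
  qed
  ultimately show ?thesis using r(1,2) by blast
qed

end
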